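(* Suppose that $r$ is a rational number and that $n>1$ is an integer or a half-integer. Let $s$ and $s'$ be elements of $\hat{\mathbb{Q}}=\mathbb{Q}\cup\{\infty\}$ which belong to the same $\Gamma(r;n)$-orbit. Then the conjugacy classes $\alpha_s$ and $\alpha_{s'}$ in the Heckoid group $G(r;n)$ are equal. In particular, if $s$ belongs to the $\Gamma(r;n)$-orbit of $\infty$, then $\alpha_s$ is the trivial conjugacy class in $G(r;n)$.
   Context: Half-integer means an element of $\frac12\mathbb{Z}$; $\langle\langle\cdot\rangle\rangle$ denotes normal closure; $\pi_1$ of an orbifold is its orbifold fundamental group. Conway sphere. Let $H$ be the group of isometries of $\mathbb{R}^2$ generated by the $\pi$-rotations about the points of $\mathbb{Z}^2$, and $\boldsymbol{S}=(\mathbb{R}^2-\mathbb{Z}^2)/H$, a 4-times punctured sphere. For $s\in\hat{\mathbb{Q}}$, $\alpha_s$ is the simple loop in $\boldsymbol{S}$ obtained as the projection of a line of slope $s$ in $\mathbb{R}^2-\mathbb{Z}^2$. By abuse of notation $\alpha_s$ also denotes the pair of conjugacy classes represented by this loop with its two possible orientations, in $\pi_1(\boldsymbol{S})$ and, via the natural epimorphism $\pi_1(\boldsymbol{S})\to G(r;n)$, in $G(r;n)$; equality of $\alpha_s$ and $\alpha_{s'}$ is equality of these pairs. The orbifold $\boldsymbol{O}$. Let $\hat H$ be generated by the $\pi$-rotations about the points of $(\frac12\mathbb{Z})^2$, and $\boldsymbol{O}=(\mathbb{R}^2-\mathbb{Z}^2)/\hat H$, a once-punctured sphere with three cone points of order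 2, so $\pi_1(\boldsymbol{O})=\langle P,Q,R\mid P^2=Q^2=R^2=1\rangle$. For $s\in\hat{\mathbb{Q}}$, $\beta_s$ is the simple loop in $\boldsymbol{O}$ that is the image of a line of slope $s$ avoiding $(\frac12\mathbb{Z})^2$ (and the corresponding pair of mutually inverse conjugacy classes); the generators are chosen so that $\beta_0,\beta_\infty$ are represented by $RQ,PQ$. $\boldsymbol{S}\to\boldsymbol{O}$ is a $(\mathbb{Z}/2\mathbb{Z})^2$-covering, $\pi_1(\boldsymbol{S})\lhd\pi_1(\boldsymbol{O})$, and $\alpha_s=\beta_s^2$. Heckoid groups ($r\in\mathbb{Q}$). If $n\ge2$ is an integer, the even Heckoid group $G(r;n)$ is the orbifold fundamental group of the orbifold with underlying space the exterior of the 2-bridge link $K(r)$ (the union of the rational tangles of slopes $\infty$ and $r$) and singular set the core tunnel of the tangle of slope $r$ with index $n$; $G(r;n)\cong\pi_1(\boldsymbol{S})/\langle\langle\alpha_\infty,\alpha_r^n\rangle\rangle$. If $n>1$ is a non-integral half-integer and $m=2n$, the odd Heckoid group $G(r;n)$ is the image of the natural map $\pi_1(\boldsymbol{S})\to\pi_1(\boldsymbol{O})\to\pi_1(\boldsymbol{O})/\langle\langle\beta_\infty^2,\beta_r^m\rangle\rangle$. The group $\Gamma(r;n)$. Let $\mathcal{D}$ be the Farey tessellation of $\mathbb{H}^2$ by ideal triangles, obtained from the ideal triangle with vertices $0,1,\infty$ by repeated reflection in the edges; its set of ideal vertices is $\hat{\mathbb{Q}}$. $\Gamma_\infty$ is the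 group of automorphisms of $\mathcal{D}$ generated by the reflections in the edges of $\mathcal{D}$ with endpoint $\infty$. $C_r(2n)$ is the infinite cyclic group generated by the parabolic automorphism of $\mathcal{D}$ centered at the vertex $r$ which shifts by $2n$ units in the clockwise direction (one unit takes each edge of $\mathcal{D}$ ending at $r$ to the adjacent such edge). $\Gamma(r;n)$ is the group generated by $\Gamma_\infty$ and $C_r(2n)$; it acts on $\hat{\mathbb{Q}}$. *)

theory Defs
  imports
    "HOL-Analysis.Analysis"
    "HOL-Algebra.Bij"
    "HOL-Algebra.Coset"
    "HOL-Algebra.Generated_Groups"
begin

section \<open>Group theory\<close>

definition normal_closure :: "('a, 'b) monoid_scheme \<Rightarrow> 'a set \<Rightarrow> 'a set"
  where "normal_closure G A = \<Inter> {N. N \<lhd> G \<and> A \<subseteq> N}"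

definition conj_class :: "('a, 'b) monoid_scheme \<Rightarrow> 'a \<Rightarrow> 'a set"
  where "conj_class G x = {g \<otimes>\<^bsub>G\<^esub> x \<otimes>\<^bsub>G\<^esub> inv\<^bsub>G\<^esub> g | g. g \<in> carrier G}"


section \<open>Orbifold fundamental groups\<close>

text \<open>
  Let \<open>\<Gamma>\<close> be a group of homeomorphisms of a connected space \<open>X\<close>, acting effectively and properly
  discontinuously. A loop in the quotient orbifold \<open>X / \<Gamma>\<close> based at the image of \<open>x0\<close> lifts to a
  path in \<open>X\<close> from \<open>x0\<close> to \<open>\<gamma> x0\<close> together with the element \<open>\<gamma>\<close> of \<open>\<Gamma>\<close>. The orbifold fundamental
  group is the set of the pairs \<open>(\<gamma>, [p])\<close>, where \<open>[p]\<close> is the homotopy class in \<open>X\<close> (relative to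
  the end points) of such a path \<open>p\<close>, with the product
  \<open>(\<gamma>, [p]) (\<delta>, [q]) = (\<gamma> \<circ> \<delta>, [p followed by \<gamma> \<circ> q])\<close>.
  If the action is free, this is the fundamental group of the space \<open>X / \<Gamma>\<close>. If \<open>\<Gamma>\<close> is a subgroup
  of \<open>\<Delta>\<close>, then the homomorphism induced by \<open>X / \<Gamma> \<rightarrow> X / \<Delta>\<close> is the inclusion of carriers.
\<close>

definition path_class :: "'a::topological_space set \<Rightarrow> (real \<Rightarrow> 'a) \<Rightarrow> (real \<Rightarrow> 'a) set"
  where "path_class X p = {q. homotopic_paths X p q}"

definition orbifold_pi1 ::
    "'a::topological_space set \<Rightarrow> ('a \<Rightarrow> 'a) set \<Rightarrow> 'a \<Rightarrow> (('a \<Rightarrow> 'a) \<times> (real \<Rightarrow> 'a) set) monoid"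
  where "orbifold_pi1 X \<Gamma> x0 =
    \<lparr>carrier = {(\<gamma>, path_class X p) | \<gamma> p.
        \<gamma> \<in> \<Gamma> \<and> path p \<and> path_image p \<subseteq> X \<and> pathstart p = x0 \<and> pathfinish p = \<gamma> x0},
     mult = (\<lambda>(\<gamma>, A) (\<delta>, B).
        (\<gamma> \<circ> \<delta>, {h. \<exists>p\<in>A. \<exists>q\<in>B. homotopic_paths X (p +++ (\<gamma> \<circ> q)) h})),
     one = (id, path_class X (\<lambda>_. x0))\<rparr>"


section \<open>The Conway sphere and its quotient orbifold\<close>

type_synonym plane = "real \<times> real"

definition int_lattice :: "plane set"
  where "int_lattice = \<int> \<times> \<int>"

definition half_lattice :: "plane set"
  where "half_lattice = {a. 2 *\<^sub>R a \<in> int_lattice}"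

definition pi_rotation :: "plane \<Rightarrow> plane \<Rightarrow> plane"
  where "pi_rotation a = (\<lambda>x. 2 *\<^sub>R a - x)"

definition rotation_group :: "plane set \<Rightarrow> (plane \<Rightarrow> plane) set"
  where "rotation_group L = generate (BijGroup UNIV) (pi_rotation ` L)"

definition base_point :: plane
  where "base_point = (1/4, 1/4)"

text \<open>
  \<open>pi1_S\<close> and \<open>pi1_O\<close> are the groups of the quotients of the plane minus the integer lattice by the
  groups generated by the rotations about the integral and the half-integral lattice points. The
  first action is free. The carrier of \<open>pi1_S\<close> is contained in that of \<open>pi1_O\<close>.
\<close>

definition pi1_S :: "((plane \<Rightarrow> plane) \<times> (real \<Rightarrow> plane) set) monoid"
  where "pi1_S = orbifold_pi1 (- int_lattice) (rotation_group int_lattice) base_point"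

definition pi1_O :: "((plane \<Rightarrow> plane) \<times> (real \<Rightarrow> plane) set) monoid"
  where "pi1_O = orbifold_pi1 (- int_lattice) (rotation_group half_lattice) base_point"


section \<open>Simple loops of rational slope\<close>

text \<open>The rational numbers together with infinity.\<close>

datatype qhat = Fin rat | Infty

fun slope_vector :: "qhat \<Rightarrow> plane" where
  "slope_vector (Fin s) = (case quotient_of s of (p, q) \<Rightarrow> (real_of_int q, real_of_int p))"
| "slope_vector Infty = (0, 1)"

text \<open>
  \<open>simple_line_loop L s \<gamma> a\<close>: the line through \<open>a\<close> of slope \<open>s\<close> avoids \<open>L\<close>, and its segment from \<open>a\<close>
  to \<open>\<gamma> a\<close> projects to a simple closed curve in the quotient by \<open>rotation_group L\<close>, that is, it goes
  exactly once around the projection of the line, in one of the two directions.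
\<close>

definition simple_line_loop :: "plane set \<Rightarrow> qhat \<Rightarrow> (plane \<Rightarrow> plane) \<Rightarrow> plane \<Rightarrow> bool"
  where "simple_line_loop L s \<gamma> a \<longleftrightarrow>
    (\<forall>t::real. a + t *\<^sub>R slope_vector s \<notin> L) \<and>
    \<gamma> \<in> rotation_group L \<and> \<gamma> a \<noteq> a \<and> (\<exists>t::real. \<gamma> a = a + t *\<^sub>R slope_vector s) \<and>
    (\<forall>h \<in> rotation_group L. \<forall>t \<in> {0..<1}. \<forall>u \<in> {0..<1}.
        h (linepath a (\<gamma> a) t) = linepath a (\<gamma> a) u \<longrightarrow> t = u)"

text \<open>
  The based representatives of these loops: a path \<open>\<delta>\<close> from the base point to \<open>a\<close>, then the segment
  from \<open>a\<close> to \<open>\<gamma> a\<close>, then the lift \<open>\<gamma> \<circ> \<delta>\<close> of the first path, reversed. They fill the two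
  mutually inverse conjugacy classes given by the loop.
\<close>

definition line_loop_elements ::
    "plane set \<Rightarrow> qhat \<Rightarrow> ((plane \<Rightarrow> plane) \<times> (real \<Rightarrow> plane) set) set"
  where "line_loop_elements L s =
    {(\<gamma>, path_class (- int_lattice) (\<delta> +++ linepath a (\<gamma> a) +++ reversepath (\<gamma> \<circ> \<delta>))) | \<gamma> a \<delta>.
       simple_line_loop L s \<gamma> a \<and> path \<delta> \<and> path_image \<delta> \<subseteq> - int_lattice \<and>
       pathstart \<delta> = base_point \<and> pathfinish \<delta> = a}"

definition alpha_elements :: "qhat \<Rightarrow> ((plane \<Rightarrow> plane) \<times> (real \<Rightarrow> plane) set) set"
  where "alpha_elements s = line_loop_elements int_lattice s"

definition beta_elements :: "qhat \<Rightarrow> ((plane \<Rightarrow> plane) \<times> (real \<Rightarrow> plane) set) set"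
  where "beta_elements s = line_loop_elements half_lattice s"


section \<open>Heckoid groups\<close>

definition even_relators :: "rat \<Rightarrow> rat \<Rightarrow> ((plane \<Rightarrow> plane) \<times> (real \<Rightarrow> plane) set) set"
  where "even_relators r n =
    alpha_elements Infty \<union> {x [^]\<^bsub>pi1_S\<^esub> nat \<lfloor>n\<rfloor> | x. x \<in> alpha_elements (Fin r)}"

definition odd_relators :: "rat \<Rightarrow> rat \<Rightarrow> ((plane \<Rightarrow> plane) \<times> (real \<Rightarrow> plane) set) set"
  where "odd_relators r n =
    {x [^]\<^bsub>pi1_O\<^esub> (2::nat) | x. x \<in> beta_elements Infty} \<union>
    {x [^]\<^bsub>pi1_O\<^esub> nat \<lfloor>2 * n\<rfloor> | x. x \<in> beta_elements (Fin r)}"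

text \<open>
  \<open>heckoid_map r n\<close> is the natural epimorphism from \<open>pi1_S\<close> onto \<open>heckoid r n\<close>. In the even case
  (\<open>n\<close> an integer) the orbifold fundamental group of the Heckoid orbifold is taken in the form
  of the quotient of \<open>pi1_S\<close> by the normal closure of the relators; in the odd case the group is an
  image, i.e. a subgroup of a quotient of \<open>pi1_O\<close>.
\<close>

definition heckoid_map ::
    "rat \<Rightarrow> rat \<Rightarrow> (plane \<Rightarrow> plane) \<times> (real \<Rightarrow> plane) set
      \<Rightarrow> ((plane \<Rightarrow> plane) \<times> (real \<Rightarrow> plane) set) set"
  where "heckoid_map r n x =
    (if n \<in> \<int> then normal_closure pi1_S (even_relators r n) #>\<^bsub>pi1_S\<^esub> x
     else normal_closure pi1_O (odd_relators r n) #>\<^bsub>pi1_O\<^esub> x)"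

definition heckoid :: "rat \<Rightarrow> rat \<Rightarrow> ((plane \<Rightarrow> plane) \<times> (real \<Rightarrow> plane) set) set monoid"
  where "heckoid r n =
    (if n \<in> \<int> then pi1_S Mod normal_closure pi1_S (even_relators r n)
     else (pi1_O Mod normal_closure pi1_O (odd_relators r n))
            \<lparr>carrier := heckoid_map r n ` carrier pi1_S\<rparr>)"

text \<open>The pair of conjugacy classes of \<open>heckoid r n\<close> represented by the simple loop of slope \<open>s\<close>.\<close>

definition alpha :: "rat \<Rightarrow> rat \<Rightarrow> qhat \<Rightarrow> ((plane \<Rightarrow> plane) \<times> (real \<Rightarrow> plane) set) set set set"
  where "alpha r n s = conj_class (heckoid r n) ` heckoid_map r n ` alpha_elements s"


section \<open>The Farey tessellation and its automorphisms\<close>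

text \<open>
  The hyperbolic reflection in the geodesic of the upper half-plane with ideal end points \<open>a \<noteq> b\<close>,
  acting on the ideal points: the inversion in the semicircle with centre \<open>(a + b) / 2\<close> and radius
  \<open>\<bar>a - b\<bar> / 2\<close>, or the reflection in a vertical line.
\<close>

fun reflect :: "qhat \<Rightarrow> qhat \<Rightarrow> qhat \<Rightarrow> qhat" where
  "reflect (Fin a) (Fin b) (Fin x) =
     (if x = (a + b) / 2 then Infty
      else Fin ((a + b) / 2 + ((a - b) / 2)\<^sup>2 / (x - (a + b) / 2)))"
| "reflect (Fin a) (Fin b) Infty = Fin ((a + b) / 2)"
| "reflect (Fin a) Infty (Fin x) = Fin (2 * a - x)"
| "reflect (Fin a) Infty Infty = Infty"
| "reflect Infty (Fin a) (Fin x) = Fin (2 * a - x)"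
| "reflect Infty (Fin a) Infty = Infty"
| "reflect Infty Infty x = x"

text \<open>
  Ideal triangles and edges are given by their sets of ideal vertices, and an automorphism of
  the tessellation by its action on the set of all ideal vertices.
\<close>

inductive_set farey_triangles :: "qhat set set" where
  base: "{Fin 0, Fin 1, Infty} \<in> farey_triangles"
| reflection: "T \<in> farey_triangles \<Longrightarrow> a \<in> T \<Longrightarrow> b \<in> T \<Longrightarrow> a \<noteq> b \<Longrightarrow> reflect a b ` T \<in> farey_triangles"

definition farey_edge :: "qhat \<Rightarrow> qhat \<Rightarrow> bool"
  where "farey_edge a b \<longleftrightarrow> a \<noteq> b \<and> (\<exists>T \<in> farey_triangles. a \<in> T \<and> b \<in> T)"

definition farey_automorphism :: "(qhat \<Rightarrow> qhat) \<Rightarrow> bool"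
  where "farey_automorphism f \<longleftrightarrow> bij f \<and> (\<forall>T. f ` T \<in> farey_triangles \<longleftrightarrow> T \<in> farey_triangles)"

definition Gamma_infty :: "(qhat \<Rightarrow> qhat) set"
  where "Gamma_infty = generate (BijGroup UNIV) {reflect a Infty | a. farey_edge a Infty}"

text \<open>
  An automorphism that fixes \<open>r\<close> and takes each edge \<open>\<langle>r, x\<rangle>\<close> to an adjacent one (spanning a
  triangle with it) is parabolic and shifts the edges at \<open>r\<close> by one unit, clockwise or
  anticlockwise (a reflection of the bi-infinite sequence of these edges does not move each of
  them to a neighbour). The clockwise and the anticlockwise unit shift are inverse to each other,
  so it is immaterial which of them is used to generate the cyclic group.
\<close>

definition unit_shift :: "qhat \<Rightarrow> (qhat \<Rightarrow> qhat) \<Rightarrow> bool"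
  where "unit_shift r f \<longleftrightarrow> farey_automorphism f \<and> f r = r \<and>
    (\<forall>x. farey_edge r x \<longrightarrow> f x \<noteq> x \<and> {r, x, f x} \<in> farey_triangles)"

definition shift_group :: "qhat \<Rightarrow> nat \<Rightarrow> (qhat \<Rightarrow> qhat) set"
  where "shift_group r m = generate (BijGroup UNIV) {f ^^ m | f. unit_shift r f}"

definition Gamma_group :: "rat \<Rightarrow> rat \<Rightarrow> (qhat \<Rightarrow> qhat) set"
  where "Gamma_group r n =
    generate (BijGroup UNIV) (Gamma_infty \<union> shift_group (Fin r) (nat \<lfloor>2 * n\<rfloor>))"

end

theory Submission
  imports Defs
begin

text \<open>
  Each generator of \<open>\<Gamma>(r;n)\<close> acts on the slopes as an affine map \<open>A\<close> of the plane that permutes the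
  lattice points and normalises the two rotation groups. Such a map induces an isomorphism of orbifold
  fundamental groups that takes the loops of slope \<open>s\<close> to those of slope \<open>A s\<close>. So it is enough that,
  after a change of base point, this isomorphism is the identity modulo the relators.

  The reason is the same for all generators. The map \<open>A\<close> preserves each line parallel to a certain
  primitive vector \<open>v\<close>, the slope vector of \<open>\<infinity>\<close> for the reflections and of \<open>r\<close> for the shift, and some
  power of the simple loop in the direction of \<open>v\<close> is a relator; let the \<open>m\<close>-fold translation by \<open>v\<close>
  correspond to this power, so \<open>m = 2\<close> for \<open>\<infinity>\<close> and \<open>m = 2n\<close> for \<open>r\<close>. Draw \<open>v\<close> vertically, so that the
  lattice points lie on vertical lines, which bound strips without lattice points. A path and its
  image under \<open>A\<close> can be compared by moving the points of the path vertically to their images. This is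
  a homotopy as long as the path stays in a strip. If the path leaves a strip through a gap between
  consecutive lattice points of a vertical line, then \<open>A\<close> moves the gap up or down by some number \<open>\<sigma>\<close>
  of units, and passing from one side of the line to the other changes the comparison by the two
  vertical loops of length \<open>\<sigma>\<close> on the two sides. They are trivial modulo the relators as soon as \<open>m\<close>
  divides \<open>\<sigma>\<close>. The shift is the shear \<open>(x, y) \<mapsto> (x, y \<plusminus> m x)\<close>, and it moves the gaps on the line
  \<open>x = k\<close> by \<open>m k\<close>. For the reflection in the edge from \<open>a\<close> to \<open>\<infinity>\<close> the map is \<open>(x, y) \<mapsto> (x, 2 a x + 1 - y)\<close>,
  which moves the gap above the point \<open>(k, j)\<close> by \<open>2 (a k - j)\<close>; the summand \<open>1\<close>, invisible on the level
  of slopes, makes this number even.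

  In the formal argument paths with different end points are composed in the action groupoid, in
  which the orbifold fundamental group is a vertex group. The comparison is a natural transformation
  from the identity to the functor given by \<open>A\<close>, up to the congruence defined by the relators
  (\<open>\<theta>_indep\<close>, \<open>\<theta>_natural_local\<close>, \<open>\<theta>_natural\<close>, \<open>coset_transport\<close>). It is checked on small paths, by means of a
  cover of the punctured plane with simply connected cells, each of which is two adjacent strips
  joined through one gap (\<open>mor_induct\<close>). The even and the odd case differ only in the group of
  rotations, and are treated together in the locale \<open>heckoid_quotient\<close>.

  On the side of the Farey tessellation it has to be shown that a unit shift at \<open>r\<close>, which is only
  assumed to be an automorphism that moves the edges at \<open>r\<close> to adjacent ones, is a shear
  (\<open>unit_shift_eq_shear\<close>). This rests on the rigidity of the tessellation: an edge belongs to just two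
  triangles, so that an automorphism is determined by its values on one triangle.
\<close>

section \<open>The action groupoid\<close>

lemma path_class_eq_iff:
  assumes "path p" "path_image p \<subseteq> X"
  shows "path_class X p = path_class X q \<longleftrightarrow> homotopic_paths X p q"
proof
  assume "path_class X p = path_class X q"
  moreover have "p \<in> path_class X p"
    using assms by (simp add: path_class_def)
  ultimately show "homotopic_paths X p q"
    by (metis homotopic_paths_sym mem_Collect_eq path_class_def)
next
  assume "homotopic_paths X p q"
  then show "path_class X p = path_class X q"
    unfolding path_class_def by (auto intro: homotopic_paths_trans dest: homotopic_paths_sym)
qed

text \<open>
  The morphisms of the action groupoid: \<open>arrow X \<gamma> p\<close> goes from \<open>z\<close> to \<open>w\<close> if \<open>p\<close> is a path from \<open>z\<close> to
  \<open>\<gamma> w\<close>. The product is that of the orbifold fundamental group, but it is also used for arrows that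
  are not loops; sources and targets are recorded by the sets \<open>mor z w\<close> below.
\<close>

definition arrow :: "'a::topological_space set \<Rightarrow> ('a \<Rightarrow> 'a) \<Rightarrow> (real \<Rightarrow> 'a) \<Rightarrow> ('a \<Rightarrow> 'a) \<times> (real \<Rightarrow> 'a) set"
  where "arrow X \<gamma> p = (\<gamma>, path_class X p)"

definition arrow_mult :: "'a::topological_space set \<Rightarrow> ('a \<Rightarrow> 'a) \<times> (real \<Rightarrow> 'a) set
    \<Rightarrow> ('a \<Rightarrow> 'a) \<times> (real \<Rightarrow> 'a) set \<Rightarrow> ('a \<Rightarrow> 'a) \<times> (real \<Rightarrow> 'a) set"
  where "arrow_mult X = (\<lambda>(\<gamma>, A) (\<delta>, B). (\<gamma> \<circ> \<delta>, {h. \<exists>p\<in>A. \<exists>q\<in>B. homotopic_paths X (p +++ (\<gamma> \<circ> q)) h}))"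

lemma arrow_cong: "\<gamma> = \<delta> \<Longrightarrow> homotopic_paths X p q \<Longrightarrow> arrow X \<gamma> p = arrow X \<delta> q"
  by (simp add: arrow_def path_class_eq_iff homotopic_paths_imp_path homotopic_paths_imp_subset)

lemma arrow_mult_arrow:
  assumes p: "path p" "path_image p \<subseteq> X" and q: "path q" "path_image q \<subseteq> X"
    and \<gamma>: "continuous_on UNIV \<gamma>" "\<gamma> ` X \<subseteq> X" and e: "pathfinish p = \<gamma> (pathstart q)"
  shows "arrow_mult X (arrow X \<gamma> p) (arrow X \<delta> q) = arrow X (\<gamma> \<circ> \<delta>) (p +++ (\<gamma> \<circ> q))"
proof -
  have *: "homotopic_paths X (p' +++ (\<gamma> \<circ> q')) (p +++ (\<gamma> \<circ> q))"
    if "homotopic_paths X p p'" "homotopic_paths X q q'" for p' q'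
  proof (rule homotopic_paths_join)
    show "homotopic_paths X p' p" using that(1) by (rule homotopic_paths_sym)
    show "homotopic_paths X (\<gamma> \<circ> q') (\<gamma> \<circ> q)"
      by (rule homotopic_paths_continuous_image[OF homotopic_paths_sym[OF that(2)]])
        (use \<gamma> in \<open>auto intro: continuous_on_subset\<close>)
    show "pathfinish p' = pathstart (\<gamma> \<circ> q')"
      using that e by (metis homotopic_paths_imp_pathfinish homotopic_paths_imp_pathstart pathstart_compose)
  qed
  have "{h. \<exists>p'\<in>path_class X p. \<exists>q'\<in>path_class X q. homotopic_paths X (p' +++ (\<gamma> \<circ> q')) h}
      = path_class X (p +++ (\<gamma> \<circ> q))"
  proof (intro equalityI subsetI)
    fix h assume "h \<in> {h. \<exists>p'\<in>path_class X p. \<exists>q'\<in>path_class X q. homotopic_paths X (p' +++ (\<gamma> \<circ> q')) h}"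
    then show "h \<in> path_class X (p +++ (\<gamma> \<circ> q))"
      using * unfolding path_class_def by (blast intro: homotopic_paths_trans homotopic_paths_sym)
  next
    fix h assume "h \<in> path_class X (p +++ (\<gamma> \<circ> q))"
    moreover have "p \<in> path_class X p" "q \<in> path_class X q"
      using p q by (simp_all add: path_class_def)
    ultimately show "h \<in> {h. \<exists>p'\<in>path_class X p. \<exists>q'\<in>path_class X q. homotopic_paths X (p' +++ (\<gamma> \<circ> q')) h}"
      unfolding path_class_def by blast
  qed
  then show ?thesis
    by (simp add: arrow_mult_def arrow_def)
qed

locale action =
  fixes X :: "'a::real_normed_vector set" and \<Gamma> :: "('a \<Rightarrow> 'a) set"
  assumes id_mem: "id \<in> \<Gamma>"
    and comp_mem: "\<gamma> \<in> \<Gamma> \<Longrightarrow> \<delta> \<in> \<Gamma> \<Longrightarrow> \<gamma> \<circ> \<delta> \<in> \<Gamma>"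
    and inverse_mem: "\<gamma> \<in> \<Gamma> \<Longrightarrow> \<exists>\<delta>\<in>\<Gamma>. \<gamma> \<circ> \<delta> = id \<and> \<delta> \<circ> \<gamma> = id"
    and cont: "\<gamma> \<in> \<Gamma> \<Longrightarrow> continuous_on UNIV \<gamma>"
    and maps: "\<gamma> \<in> \<Gamma> \<Longrightarrow> \<gamma> ` X \<subseteq> X"
begin

abbreviation mult (infixl "\<odot>" 70) where "x \<odot> y \<equiv> arrow_mult X x y"

definition mor :: "'a \<Rightarrow> 'a \<Rightarrow> (('a \<Rightarrow> 'a) \<times> (real \<Rightarrow> 'a) set) set"
  where "mor z w = {arrow X \<gamma> p | \<gamma> p. \<gamma> \<in> \<Gamma> \<and> path p \<and> path_image p \<subseteq> X \<and> pathstart p = z \<and> pathfinish p = \<gamma> w}"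

definition unit :: "'a \<Rightarrow> ('a \<Rightarrow> 'a) \<times> (real \<Rightarrow> 'a) set"
  where "unit z = arrow X id (\<lambda>_. z)"

lemma path_comp: "\<gamma> \<in> \<Gamma> \<Longrightarrow> path p \<Longrightarrow> path (\<gamma> \<circ> p)"
  by (rule path_continuous_image) (auto intro: continuous_on_subset[OF cont])

lemma path_image_comp: "\<gamma> \<in> \<Gamma> \<Longrightarrow> path_image p \<subseteq> X \<Longrightarrow> path_image (\<gamma> \<circ> p) \<subseteq> X"
  unfolding path_image_compose using maps by blast

lemma morI:
  "\<gamma> \<in> \<Gamma> \<Longrightarrow> path p \<Longrightarrow> path_image p \<subseteq> X \<Longrightarrow> pathstart p = z \<Longrightarrow> pathfinish p = \<gamma> w \<Longrightarrow> arrow X \<gamma> p \<in> mor z w"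
  unfolding mor_def by blast

lemma morE:
  assumes "x \<in> mor z w"
  obtains \<gamma> p where "x = arrow X \<gamma> p" "\<gamma> \<in> \<Gamma>" "path p" "path_image p \<subseteq> X" "pathstart p = z" "pathfinish p = \<gamma> w"
  using assms unfolding mor_def by blast

lemma mult_arrow:
  assumes "\<gamma> \<in> \<Gamma>" "path p" "path_image p \<subseteq> X" "path q" "path_image q \<subseteq> X" "pathfinish p = \<gamma> (pathstart q)"
  shows "arrow X \<gamma> p \<odot> arrow X \<delta> q = arrow X (\<gamma> \<circ> \<delta>) (p +++ (\<gamma> \<circ> q))"
  using assms by (intro arrow_mult_arrow) (auto simp: cont maps)

lemma mult_mor [intro]:
  assumes "x \<in> mor z w" "y \<in> mor w u" shows "x \<odot> y \<in> mor z u"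
proof -
  obtain \<gamma> p where x: "x = arrow X \<gamma> p" "\<gamma> \<in> \<Gamma>" "path p" "path_image p \<subseteq> X" "pathstart p = z" "pathfinish p = \<gamma> w"
    using assms(1) by (rule morE)
  obtain \<delta> q where y: "y = arrow X \<delta> q" "\<delta> \<in> \<Gamma>" "path q" "path_image q \<subseteq> X" "pathstart q = w" "pathfinish q = \<delta> u"
    using assms(2) by (rule morE)
  have "x \<odot> y = arrow X (\<gamma> \<circ> \<delta>) (p +++ (\<gamma> \<circ> q))"
    using x y by (simp add: mult_arrow)
  also have "\<dots> \<in> mor z u"
    using x y by (intro morI comp_mem subset_path_image_join path_image_comp path_join_imp path_comp)
      (simp_all add: pathstart_compose pathfinish_compose)
  finally show ?thesis .
qed

lemma mult_assoc:
  assumes "x \<in> mor z w" "y \<in> mor w u" "t \<in> mor u s"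
  shows "x \<odot> y \<odot> t = x \<odot> (y \<odot> t)"
proof -
  obtain \<gamma> p where x: "x = arrow X \<gamma> p" "\<gamma> \<in> \<Gamma>" "path p" "path_image p \<subseteq> X" "pathstart p = z" "pathfinish p = \<gamma> w"
    using assms(1) by (rule morE)
  obtain \<delta> q where y: "y = arrow X \<delta> q" "\<delta> \<in> \<Gamma>" "path q" "path_image q \<subseteq> X" "pathstart q = w" "pathfinish q = \<delta> u"
    using assms(2) by (rule morE)
  obtain \<epsilon> r where t: "t = arrow X \<epsilon> r" "\<epsilon> \<in> \<Gamma>" "path r" "path_image r \<subseteq> X" "pathstart r = u" "pathfinish r = \<epsilon> s"
    using assms(3) by (rule morE)
  note [simp] = path_comp path_image_comp comp_mem pathstart_compose pathfinish_compose subset_path_image_join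
  have "x \<odot> y \<odot> t = arrow X (\<gamma> \<circ> \<delta> \<circ> \<epsilon>) ((p +++ (\<gamma> \<circ> q)) +++ (\<gamma> \<circ> \<delta> \<circ> r))"
    using x y t by (simp add: mult_arrow)
  also have "\<dots> = arrow X (\<gamma> \<circ> (\<delta> \<circ> \<epsilon>)) (p +++ ((\<gamma> \<circ> q) +++ (\<gamma> \<circ> (\<delta> \<circ> r))))"
    unfolding comp_assoc
    by (intro arrow_cong[OF refl] homotopic_paths_sym[OF homotopic_paths_assoc] path_comp path_image_comp)
      (use x y t in \<open>simp_all\<close>)
  also have "\<dots> = x \<odot> (y \<odot> t)"
    using x y t by (simp add: mult_arrow path_compose_join)
  finally show ?thesis .
qed

lemma unit_mor [intro]: "z \<in> X \<Longrightarrow> unit z \<in> mor z z"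
  unfolding unit_def by (rule morI) (auto simp: id_mem path_image_def pathstart_def pathfinish_def path_def)

lemma const_eq_linepath: "(\<lambda>_. z) = linepath z z"
  by (simp add: linepath_refl fun_eq_iff)

lemma mor_source: "x \<in> mor z w \<Longrightarrow> z \<in> X"
  by (elim morE) (use pathstart_in_path_image in blast)

lemma unit_left:
  assumes "x \<in> mor z w" shows "unit z \<odot> x = x"
proof -
  obtain \<gamma> p where x: "x = arrow X \<gamma> p" "\<gamma> \<in> \<Gamma>" "path p" "path_image p \<subseteq> X" "pathstart p = z" "pathfinish p = \<gamma> w"
    using assms(1) by (rule morE)
  have "z \<in> X" using assms by (rule mor_source)
  then have "unit z \<odot> x = arrow X (id \<circ> \<gamma>) (linepath z z +++ (id \<circ> p))"
    unfolding unit_def const_eq_linepath x(1) using x by (intro mult_arrow) (auto simp: id_mem)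
  also have "\<dots> = x"
    unfolding x(1) using x by (intro arrow_cong) (auto intro: homotopic_paths_lid')
  finally show ?thesis .
qed

lemma unit_right:
  assumes "x \<in> mor z w" shows "x \<odot> unit w = x"
proof -
  obtain \<gamma> p where x: "x = arrow X \<gamma> p" "\<gamma> \<in> \<Gamma>" "path p" "path_image p \<subseteq> X" "pathstart p = z" "pathfinish p = \<gamma> w"
    using assms(1) by (rule morE)
  have w: "w \<in> X"
  proof -
    obtain \<delta> where "\<delta> \<in> \<Gamma>" "\<delta> \<circ> \<gamma> = id" using inverse_mem x(2) by blast
    moreover have "\<gamma> w \<in> X" using x pathfinish_in_path_image by fastforce
    ultimately show ?thesis using maps by (metis comp_apply id_apply image_subset_iff)
  qed
  have "\<gamma> \<circ> linepath w w = linepath (\<gamma> w) (\<gamma> w)"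
    by (auto simp: fun_eq_iff linepath_refl)
  then show ?thesis
    unfolding unit_def const_eq_linepath using x w
    by (auto simp: mult_arrow intro!: arrow_cong homotopic_paths_rid')
qed

text \<open>
  The inverse is explicit because \<open>conjugate_arrow\<close> needs the path that represents it.
\<close>

lemma inverse_arrow:
  assumes x: "\<gamma> \<in> \<Gamma>" "path p" "path_image p \<subseteq> X" "pathstart p = z" "pathfinish p = \<gamma> w"
    and d: "\<delta> \<in> \<Gamma>" "\<gamma> \<circ> \<delta> = id" "\<delta> \<circ> \<gamma> = id"
  shows "arrow X \<delta> (reversepath (\<delta> \<circ> p)) \<in> mor w z"
    "arrow X \<gamma> p \<odot> arrow X \<delta> (reversepath (\<delta> \<circ> p)) = unit z"
    "arrow X \<delta> (reversepath (\<delta> \<circ> p)) \<odot> arrow X \<gamma> p = unit w"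
proof -
  let ?y = "arrow X \<delta> (reversepath (\<delta> \<circ> p))"
  have dg: "\<delta> (\<gamma> t) = t" for t using d(3) by (metis comp_apply id_apply)
  have p: "path (\<delta> \<circ> p)" "path_image (\<delta> \<circ> p) \<subseteq> X"
    using x d path_comp path_image_comp by auto
  show "?y \<in> mor w z"
    using x d p dg by (intro morI) (auto simp: pathstart_compose pathfinish_compose)
  have "\<gamma> \<circ> reversepath (\<delta> \<circ> p) = reversepath p"
    using d(2) by (simp add: path_compose_reversepath flip: o_assoc) (simp add: o_assoc)
  then have "arrow X \<gamma> p \<odot> ?y = arrow X (\<gamma> \<circ> \<delta>) (p +++ reversepath p)"
    using x p dg by (subst mult_arrow) (auto simp: pathfinish_compose)
  also have "\<dots> = unit z"
    unfolding unit_def const_eq_linepath using x d homotopic_paths_rinv[of p X]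
    by (intro arrow_cong) auto
  finally show "arrow X \<gamma> p \<odot> ?y = unit z" .
  have "?y \<odot> arrow X \<gamma> p = arrow X (\<delta> \<circ> \<gamma>) (reversepath (\<delta> \<circ> p) +++ (\<delta> \<circ> p))"
    using x d p by (subst mult_arrow) (auto simp: pathstart_compose)
  also have "\<dots> = unit w"
    unfolding unit_def const_eq_linepath using x d dg p homotopic_paths_linv[of "\<delta> \<circ> p" X]
    by (intro arrow_cong) (auto simp: pathfinish_compose)
  finally show "?y \<odot> arrow X \<gamma> p = unit w" .
qed

lemma mor_inverse:
  assumes "x \<in> mor z w"
  shows "\<exists>y \<in> mor w z. x \<odot> y = unit z \<and> y \<odot> x = unit w"
proof -
  obtain \<gamma> p where x: "x = arrow X \<gamma> p" "\<gamma> \<in> \<Gamma>" "path p" "path_image p \<subseteq> X" "pathstart p = z" "pathfinish p = \<gamma> w"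
    using assms(1) by (rule morE)
  obtain \<delta> where "\<delta> \<in> \<Gamma>" "\<gamma> \<circ> \<delta> = id" "\<delta> \<circ> \<gamma> = id" using inverse_mem x(2) by blast
  then show ?thesis using inverse_arrow[OF x(2-6)] unfolding x(1) by blast
qed

lemma carrier_pi1: "carrier (orbifold_pi1 X \<Gamma> b) = mor b b"
  unfolding orbifold_pi1_def mor_def arrow_def by auto

lemma mult_pi1: "x \<otimes>\<^bsub>orbifold_pi1 X \<Gamma> b\<^esub> y = x \<odot> y"
  by (simp add: orbifold_pi1_def arrow_mult_def)

lemma one_pi1: "\<one>\<^bsub>orbifold_pi1 X \<Gamma> b\<^esub> = unit b"
  by (simp add: orbifold_pi1_def unit_def arrow_def)

lemma group_pi1: "b \<in> X \<Longrightarrow> group (orbifold_pi1 X \<Gamma> b)"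
  by (rule groupI) (auto simp: carrier_pi1 mult_pi1 one_pi1 mult_assoc unit_left dest: mor_inverse)

text \<open>
  A conjugate of a loop, written in the form in which the based representatives of the simple loops
  are defined. If \<open>\<gamma>\<close> is not the identity, conjugation also moves the loop in the plane by \<open>\<gamma>\<close>.
\<close>

lemma conjugate_arrow:
  assumes g: "\<gamma> \<in> \<Gamma>" "path p" "path_image p \<subseteq> X" "pathstart p = z" "pathfinish p = \<gamma> w"
    and d: "\<delta> \<in> \<Gamma>" "\<gamma> \<circ> \<delta> = id" "\<delta> \<circ> \<gamma> = id"
    and q: "\<tau> \<in> \<Gamma>" "path q" "path_image q \<subseteq> X" "pathstart q = w" "pathfinish q = \<tau> w"
    and h: "h \<in> mor w z" "h \<odot> arrow X \<gamma> p = unit w"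
  shows "arrow X \<gamma> p \<odot> arrow X \<tau> q \<odot> h =
    arrow X (\<gamma> \<circ> \<tau> \<circ> \<delta>) (p +++ (\<gamma> \<circ> q) +++ reversepath ((\<gamma> \<circ> \<tau> \<circ> \<delta>) \<circ> p))"
proof -
  let ?g = "arrow X \<gamma> p" and ?x = "arrow X \<tau> q" and ?y = "arrow X \<delta> (reversepath (\<delta> \<circ> p))"
  note y = inverse_arrow[OF g d]
  have gm: "?g \<in> mor z w" and xm: "?x \<in> mor w w" using g q by (auto intro: morI)
  have "h = h \<odot> (?g \<odot> ?y)" using unit_right[OF h(1)] y(2) by simp
  also have "\<dots> = ?y" using mult_assoc[OF h(1) gm y(1)] h(2) unit_left[OF y(1)] by simp
  finally have hy: "h = ?y" .
  have dg: "\<delta> (\<gamma> t) = t" for t using d(3) by (metis comp_apply id_apply)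
  have p: "path (\<delta> \<circ> p)" "path_image (\<delta> \<circ> p) \<subseteq> X"
    using g d path_comp path_image_comp by auto
  have tp: "path (\<tau> \<circ> reversepath (\<delta> \<circ> p))" "path_image (\<tau> \<circ> reversepath (\<delta> \<circ> p)) \<subseteq> X"
    using p q path_comp[of \<tau> "reversepath (\<delta> \<circ> p)"] path_image_comp[of \<tau> "reversepath (\<delta> \<circ> p)"] by auto
  have "?g \<odot> ?x \<odot> ?y = ?g \<odot> (?x \<odot> ?y)" by (rule mult_assoc[OF gm xm y(1)])
  also have "?x \<odot> ?y = arrow X (\<tau> \<circ> \<delta>) (q +++ (\<tau> \<circ> reversepath (\<delta> \<circ> p)))"
    using q p g dg by (intro mult_arrow) (auto simp: pathfinish_compose)
  also have "?g \<odot> \<dots> = arrow X (\<gamma> \<circ> (\<tau> \<circ> \<delta>)) (p +++ (\<gamma> \<circ> (q +++ (\<tau> \<circ> reversepath (\<delta> \<circ> p)))))"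
    using q p tp g dg by (intro mult_arrow subset_path_image_join) (auto simp: pathstart_compose pathfinish_compose)
  also have "\<dots> = arrow X (\<gamma> \<circ> \<tau> \<circ> \<delta>) (p +++ (\<gamma> \<circ> q) +++ reversepath ((\<gamma> \<circ> \<tau> \<circ> \<delta>) \<circ> p))"
    by (simp add: path_compose_join path_compose_reversepath o_assoc)
  finally show ?thesis unfolding hy .
qed

definition mutually_inverse where
  "mutually_inverse z w g h \<longleftrightarrow> g \<in> mor z w \<and> h \<in> mor w z \<and> g \<odot> h = unit z \<and> h \<odot> g = unit w"

lemma conjugate_mult:
  assumes gh: "mutually_inverse z w g h" and x: "x \<in> mor w w" and y: "y \<in> mor w w"
  shows "(g \<odot> x \<odot> h) \<odot> (g \<odot> y \<odot> h) = g \<odot> (x \<odot> y) \<odot> h"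
proof -
  have g: "g \<in> mor z w" and h: "h \<in> mor w z" and hg: "h \<odot> g = unit w" using gh by (auto simp: mutually_inverse_def)
  have "(g \<odot> x \<odot> h) \<odot> (g \<odot> y \<odot> h) = g \<odot> x \<odot> (h \<odot> (g \<odot> y \<odot> h))"
    by (rule mult_assoc[OF mult_mor[OF g x] h mult_mor[OF mult_mor[OF g y] h]])
  also have "h \<odot> (g \<odot> y \<odot> h) = h \<odot> (g \<odot> (y \<odot> h))" using mult_assoc[OF g y h] by simp
  also have "\<dots> = h \<odot> g \<odot> (y \<odot> h)" by (rule mult_assoc[OF h g mult_mor[OF y h], symmetric])
  also have "\<dots> = y \<odot> h" unfolding hg by (rule unit_left[OF mult_mor[OF y h]])
  also have "g \<odot> x \<odot> (y \<odot> h) = g \<odot> x \<odot> y \<odot> h" by (rule mult_assoc[OF mult_mor[OF g x] y h, symmetric])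
  also have "g \<odot> x \<odot> y = g \<odot> (x \<odot> y)" by (rule mult_assoc[OF g x y])
  finally show ?thesis .
qed

lemma mutually_inverse_mult:
  assumes "mutually_inverse z w g h" "mutually_inverse w u g' h'"
  shows "mutually_inverse z u (g \<odot> g') (h' \<odot> h)"
proof -
  have g: "g \<in> mor z w" "h \<in> mor w z" "g \<odot> h = unit z" "h \<odot> g = unit w"
    and g': "g' \<in> mor w u" "h' \<in> mor u w" "g' \<odot> h' = unit w" "h' \<odot> g' = unit u"
    using assms by (auto simp: mutually_inverse_def)
  have "g \<odot> g' \<odot> (h' \<odot> h) = g \<odot> (g' \<odot> h' \<odot> h)"
    using mult_assoc[OF g(1) g'(1) mult_mor[OF g'(2) g(2)]] mult_assoc[OF g'(1,2) g(2)] by simp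
  then have 1: "g \<odot> g' \<odot> (h' \<odot> h) = unit z" using g'(3) g(3) unit_left[OF g(2)] by simp
  have "h' \<odot> h \<odot> (g \<odot> g') = h' \<odot> (h \<odot> g \<odot> g')"
    using mult_assoc[OF g'(2) g(2) mult_mor[OF g(1) g'(1)]] mult_assoc[OF g(2,1) g'(1)] by simp
  then have "h' \<odot> h \<odot> (g \<odot> g') = unit u" using g(4) g'(4) unit_left[OF g'(1)] by simp
  with 1 show ?thesis using g g' by (auto simp: mutually_inverse_def)
qed

text \<open>
  Change of base point can be done in steps.
\<close>

lemma conjugate_conjugate:
  assumes "mutually_inverse z w g h" "mutually_inverse w u g' h'" and x: "x \<in> mor u u"
  shows "g \<odot> (g' \<odot> x \<odot> h') \<odot> h = (g \<odot> g') \<odot> x \<odot> (h' \<odot> h)"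
proof -
  have g: "g \<in> mor z w" "h \<in> mor w z" and g': "g' \<in> mor w u" "h' \<in> mor u w"
    using assms by (auto simp: mutually_inverse_def)
  have "g \<odot> (g' \<odot> x \<odot> h') \<odot> h = g \<odot> (g' \<odot> x) \<odot> h' \<odot> h"
    using mult_assoc[OF g(1) mult_mor[OF g'(1) x] g'(2)] by simp
  also have "\<dots> = g \<odot> g' \<odot> x \<odot> h' \<odot> h" using mult_assoc[OF g(1) g'(1) x] by simp
  also have "\<dots> = (g \<odot> g') \<odot> x \<odot> (h' \<odot> h)"
    by (rule mult_assoc[OF mult_mor[OF mult_mor[OF g(1) g'(1)] x] g'(2) g(2)])
  finally show ?thesis .
qed

end

locale action_mod = action X \<Gamma> for X :: "'a::real_normed_vector set" and \<Gamma> +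
  fixes b :: 'a and N
  assumes base: "b \<in> X" and normal: "N \<lhd> orbifold_pi1 X \<Gamma> b"
begin

abbreviation "G \<equiv> orbifold_pi1 X \<Gamma> b"

text \<open>
  The congruence modulo the normal subgroup \<open>N\<close> of one vertex group, extended to the groupoid: two
  parallel arrows are compared by completing them to loops at \<open>b\<close> in all possible ways.
\<close>

definition eqv where
  "eqv z w x y \<longleftrightarrow> x \<in> mor z w \<and> y \<in> mor z w \<and>
     (\<forall>g \<in> mor b z. \<forall>h \<in> mor w b. N #>\<^bsub>G\<^esub> (g \<odot> x \<odot> h) = N #>\<^bsub>G\<^esub> (g \<odot> y \<odot> h))"

lemma eqv_mor: "eqv z w x y \<Longrightarrow> x \<in> mor z w" "eqv z w x y \<Longrightarrow> y \<in> mor z w"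
  by (auto simp: eqv_def)

lemma eqv_refl: "x \<in> mor z w \<Longrightarrow> eqv z w x x"
  by (simp add: eqv_def)

lemma eqv_sym: "eqv z w x y \<Longrightarrow> eqv z w y x"
  by (simp add: eqv_def)

lemma eqv_trans [trans]: "eqv z w x y \<Longrightarrow> eqv z w y t \<Longrightarrow> eqv z w x t"
  by (simp add: eqv_def)

lemma eqv_mult:
  assumes xx: "eqv z w x x'" and yy: "eqv w u y y'"
  shows "eqv z u (x \<odot> y) (x' \<odot> y')"
  unfolding eqv_def
proof (intro conjI ballI)
  note x = eqv_mor(1)[OF xx] and x' = eqv_mor(2)[OF xx] and y = eqv_mor(1)[OF yy] and y' = eqv_mor(2)[OF yy]
  show "x \<odot> y \<in> mor z u" "x' \<odot> y' \<in> mor z u" by (auto intro: eqv_mor[OF xx] eqv_mor[OF yy])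
  fix g h assume g: "g \<in> mor b z" and h: "h \<in> mor u b"
  have "N #>\<^bsub>G\<^esub> (g \<odot> (x \<odot> y) \<odot> h) = N #>\<^bsub>G\<^esub> (g \<odot> x \<odot> (y \<odot> h))"
    using mult_assoc[OF g x y] mult_assoc[OF mult_mor[OF g x] y h] by simp
  also have "\<dots> = N #>\<^bsub>G\<^esub> (g \<odot> x' \<odot> (y \<odot> h))"
    using xx g h mult_mor[OF eqv_mor(1)[OF yy] h] by (auto simp: eqv_def)
  also have "\<dots> = N #>\<^bsub>G\<^esub> (g \<odot> x' \<odot> y \<odot> h)"
    using mult_assoc[OF mult_mor[OF g x'] y h] by simp
  also have "\<dots> = N #>\<^bsub>G\<^esub> (g \<odot> x' \<odot> y' \<odot> h)"
    using yy h mult_mor[OF g eqv_mor(2)[OF xx]] by (auto simp: eqv_def)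
  also have "\<dots> = N #>\<^bsub>G\<^esub> (g \<odot> (x' \<odot> y') \<odot> h)"
    using mult_assoc[OF g x' y'] by simp
  finally show "N #>\<^bsub>G\<^esub> (g \<odot> (x \<odot> y) \<odot> h) = N #>\<^bsub>G\<^esub> (g \<odot> (x' \<odot> y') \<odot> h)" .
qed

lemma eqv_coset:
  assumes "eqv b b x y" shows "N #>\<^bsub>G\<^esub> x = N #>\<^bsub>G\<^esub> y"
proof -
  have "N #>\<^bsub>G\<^esub> (unit b \<odot> x \<odot> unit b) = N #>\<^bsub>G\<^esub> (unit b \<odot> y \<odot> unit b)"
    using assms unit_mor[OF base] unfolding eqv_def by blast
  then show ?thesis
    by (simp add: unit_left[OF eqv_mor(1)[OF assms]] unit_left[OF eqv_mor(2)[OF assms]]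
        unit_right[OF eqv_mor(1)[OF assms]] unit_right[OF eqv_mor(2)[OF assms]])
qed

text \<open>
  Normality of \<open>N\<close> is used here: one way of completing a loop to a loop at \<open>b\<close>, namely with mutually
  inverse arrows, decides about all of them.
\<close>

lemma eqv_unitI:
  assumes x: "x \<in> mor z z" and z: "z \<in> X"
    and N: "\<And>g h. g \<in> mor b z \<Longrightarrow> h \<in> mor z b \<Longrightarrow> g \<odot> h = unit b \<Longrightarrow> h \<odot> g = unit z \<Longrightarrow> g \<odot> x \<odot> h \<in> N"
  shows "eqv z z x (unit z)"
  unfolding eqv_def
proof (intro conjI ballI x unit_mor[OF z])
  fix g h' assume g: "g \<in> mor b z" and h': "h' \<in> mor z b"
  obtain h where h: "h \<in> mor z b" "g \<odot> h = unit b" "h \<odot> g = unit z"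
    using mor_inverse[OF g] by blast
  interpret N: normal N G by (rule normal)
  have n: "g \<odot> x \<odot> h \<in> N" using N g h by blast
  have "g \<odot> x \<odot> h' = g \<odot> x \<odot> (h \<odot> g \<odot> h')"
    using h h' by (simp add: unit_left)
  also have "\<dots> = (g \<odot> x \<odot> h) \<odot> (g \<odot> h')"
    using mult_assoc[OF h(1) g h'] mult_assoc[OF mult_mor[OF g x] h(1) mult_mor[OF g h']] by simp
  finally have e: "g \<odot> x \<odot> h' = (g \<odot> x \<odot> h) \<otimes>\<^bsub>G\<^esub> (g \<odot> h')" by (simp add: mult_pi1)
  have gh: "g \<odot> h' \<in> carrier G" using g h' by (auto simp: carrier_pi1)
  have "N #>\<^bsub>G\<^esub> (g \<odot> x \<odot> h') = N #>\<^bsub>G\<^esub> (g \<odot> x \<odot> h) #>\<^bsub>G\<^esub> (g \<odot> h')"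
    unfolding e by (rule N.coset_mult_assoc[symmetric]) (use gh n N.subset in auto)
  also have "N #>\<^bsub>G\<^esub> (g \<odot> x \<odot> h) = N"
    using n by (simp add: N.coset_join2 N.subgroup_axioms N.subset[THEN subsetD])
  finally show "N #>\<^bsub>G\<^esub> (g \<odot> x \<odot> h') = N #>\<^bsub>G\<^esub> (g \<odot> unit z \<odot> h')"
    using g by (simp add: unit_right)
qed

end

section \<open>Arrows in simply connected sets\<close>

context action
begin

definition chart :: "'a set \<Rightarrow> bool" where "chart Y \<longleftrightarrow> simply_connected Y \<and> Y \<subseteq> X"

text \<open>
  In a simply connected set an arrow is determined by its end points and its group element, so that
  homotopies of such arrows become equations between end points and between group elements. The
  choice of the path is harmless by \<open>arrow_local_arrow\<close>.
\<close>

definition local_arrow :: "'a set \<Rightarrow> ('a \<Rightarrow> 'a) \<Rightarrow> 'a \<Rightarrow> 'a \<Rightarrow> ('a \<Rightarrow> 'a) \<times> (real \<Rightarrow> 'a) set"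
  where "local_arrow Y \<gamma> z w =
    arrow X \<gamma> (SOME p. path p \<and> path_image p \<subseteq> Y \<and> pathstart p = z \<and> pathfinish p = \<gamma> w)"

lemma local_arrow_path:
  assumes "chart Y" "z \<in> Y" "t \<in> Y"
  obtains p where "path p" "path_image p \<subseteq> Y" "path_image p \<subseteq> X" "pathstart p = z" "pathfinish p = t"
proof -
  have "path_connected Y" using assms(1) by (simp add: chart_def simply_connected_imp_path_connected)
  then show ?thesis using assms that unfolding path_connected_def chart_def by (meson order_trans)
qed

lemma arrow_local_arrow:
  assumes Y: "chart Y" and p: "path p" "path_image p \<subseteq> Y" "pathstart p = z" "pathfinish p = \<gamma> w"
  shows "arrow X \<gamma> p = local_arrow Y \<gamma> z w"
proof -
  define q where "q = (SOME p. path p \<and> path_image p \<subseteq> Y \<and> pathstart p = z \<and> pathfinish p = \<gamma> w)"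
  have q: "path q \<and> path_image q \<subseteq> Y \<and> pathstart q = z \<and> pathfinish q = \<gamma> w"
    unfolding q_def by (rule someI[of _ p]) (use p in auto)
  have "homotopic_paths Y p q"
    using Y p q by (simp add: chart_def simply_connected_eq_homotopic_paths)
  then have "homotopic_paths X p q"
    using Y homotopic_paths_subset by (auto simp: chart_def)
  then show ?thesis
    unfolding local_arrow_def q_def[symmetric] by (intro arrow_cong) auto
qed

lemma local_arrow_mor:
  assumes "chart Y" "z \<in> Y" "\<gamma> w \<in> Y" "\<gamma> \<in> \<Gamma>"
  shows "local_arrow Y \<gamma> z w \<in> mor z w"
proof -
  obtain p where p: "path p" "path_image p \<subseteq> Y" "path_image p \<subseteq> X" "pathstart p = z" "pathfinish p = \<gamma> w"
    using local_arrow_path[OF assms(1-3)] .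
  then show ?thesis using assms by (subst arrow_local_arrow[OF assms(1), symmetric]) (auto intro!: morI)
qed

lemma local_arrow_subset:
  assumes "chart Y" "chart Y'" "Y \<subseteq> Y'" "z \<in> Y" "\<gamma> w \<in> Y"
  shows "local_arrow Y \<gamma> z w = local_arrow Y' \<gamma> z w"
proof -
  obtain p where p: "path p" "path_image p \<subseteq> Y" "path_image p \<subseteq> X" "pathstart p = z" "pathfinish p = \<gamma> w"
    using local_arrow_path[OF assms(1,4,5)] .
  then show ?thesis using assms by (metis arrow_local_arrow order_trans)
qed

lemma local_arrow_mult:
  assumes Y: "chart Y" "z \<in> Y" "\<gamma> w \<in> Y" "\<gamma> \<in> \<Gamma>" and Y': "chart Y'" "w \<in> Y'" "\<delta> u \<in> Y'"
    and sub: "\<gamma> ` Y' \<subseteq> Y"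
  shows "local_arrow Y \<gamma> z w \<odot> local_arrow Y' \<delta> w u = local_arrow Y (\<gamma> \<circ> \<delta>) z u"
proof -
  obtain p where p: "path p" "path_image p \<subseteq> Y" "path_image p \<subseteq> X" "pathstart p = z" "pathfinish p = \<gamma> w"
    using local_arrow_path[OF Y(1-3)] .
  obtain q where q: "path q" "path_image q \<subseteq> Y'" "path_image q \<subseteq> X" "pathstart q = w" "pathfinish q = \<delta> u"
    using local_arrow_path[OF Y'(1-3)] .
  have "local_arrow Y \<gamma> z w \<odot> local_arrow Y' \<delta> w u = arrow X \<gamma> p \<odot> arrow X \<delta> q"
    using arrow_local_arrow[where \<gamma>=\<gamma> and w=w, OF Y(1) p(1,2,4,5)] arrow_local_arrow[where \<gamma>=\<delta> and w=u, OF Y'(1) q(1,2,4,5)] by simp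
  also have "\<dots> = arrow X (\<gamma> \<circ> \<delta>) (p +++ (\<gamma> \<circ> q))"
    using p q Y by (intro mult_arrow) auto
  also have "\<dots> = local_arrow Y (\<gamma> \<circ> \<delta>) z u"
  proof (rule arrow_local_arrow[OF Y(1)])
    show "path (p +++ (\<gamma> \<circ> q))"
      using p q path_comp[OF Y(4)] by (simp add: pathstart_compose)
    have "path_image (\<gamma> \<circ> q) \<subseteq> Y" unfolding path_image_compose using q sub by blast
    then show "path_image (p +++ (\<gamma> \<circ> q)) \<subseteq> Y"
      using p by (intro subset_path_image_join)
  qed (use p q in \<open>auto simp: pathfinish_compose\<close>)
  finally show ?thesis .
qed

lemma local_arrow_const: "chart Y \<Longrightarrow> z \<in> Y \<Longrightarrow> local_arrow Y id z z = unit z"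
  unfolding unit_def const_eq_linepath by (rule arrow_local_arrow[symmetric]) auto

text \<open>
  The part of the van Kampen theorem that is needed: all arrows are products of arrows in the members
  of an open cover by simply connected sets. A path is cut into small pieces by bisection, and the group
  element is put into a constant path at the end.
\<close>

lemma mor_induct:
  assumes x: "x \<in> mor z w"
    and charts: "\<And>Y. Y \<in> \<Y> \<Longrightarrow> chart Y \<and> open Y" and cover: "X \<subseteq> \<Union>\<Y>"
    and local_arrow: "\<And>Y \<gamma> z w. Y \<in> \<Y> \<Longrightarrow> \<gamma> \<in> \<Gamma> \<Longrightarrow> z \<in> Y \<Longrightarrow> \<gamma> w \<in> Y \<Longrightarrow> P z w (local_arrow Y \<gamma> z w)"
    and mult: "\<And>x y z w u. x \<in> mor z w \<Longrightarrow> y \<in> mor w u \<Longrightarrow> P z w x \<Longrightarrow> P w u y \<Longrightarrow> P z u (x \<odot> y)"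
  shows "P z w x"
proof -
  obtain \<gamma> p where p: "x = arrow X \<gamma> p" "\<gamma> \<in> \<Gamma>" "path p" "path_image p \<subseteq> X" "pathstart p = z" "pathfinish p = \<gamma> w"
    using x by (rule morE)
  define s where "s a b = arrow X id (subpath a b p)" for a b
  define Q where "Q a b \<longleftrightarrow> (0 \<le> a \<longrightarrow> a \<le> b \<longrightarrow> b \<le> 1 \<longrightarrow> P (p a) (p b) (s a b))" for a b :: real
  have sub: "path (subpath a b p)" "path_image (subpath a b p) \<subseteq> X" if "a \<in> {0..1}" "b \<in> {0..1}" for a b
    using p that path_image_subpath_subset[of a b p] by auto
  have smor: "s a b \<in> mor (p a) (p b)" if "a \<in> {0..1}" "b \<in> {0..1}" for a b
    unfolding s_def using sub[OF that] by (intro morI) (auto simp: id_mem)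
  have "Q 0 1"
  proof (rule Bolzano)
    fix a b c assume Q: "Q a b" "Q b c" "a \<le> b" "b \<le> c"
    show "Q a c" unfolding Q_def
    proof (intro impI)
      assume i: "0 \<le> a" "a \<le> c" "c \<le> 1"
      then have I: "a \<in> {0..1}" "b \<in> {0..1}" "c \<in> {0..1}" using Q by auto
      have "s a b \<odot> s b c = arrow X (id \<circ> id) (subpath a b p +++ (id \<circ> subpath b c p))"
        unfolding s_def using sub I by (intro mult_arrow) (auto simp: id_mem)
      also have "\<dots> = s a c"
        unfolding s_def using I p by (intro arrow_cong) (auto intro: homotopic_join_subpaths)
      finally have e: "s a b \<odot> s b c = s a c" .
      have "P (p a) (p b) (s a b)" "P (p b) (p c) (s b c)"
        using Q i unfolding Q_def by auto
      then show "P (p a) (p c) (s a c)" unfolding e[symmetric] using mult[OF smor[OF I(1,2)] smor[OF I(2,3)]] by blast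
    qed
  next
    fix t :: real assume t: "0 \<le> t" "t \<le> 1"
    then have "p t \<in> X" using p(4) by (auto simp: path_image_def)
    then obtain Y where Y: "Y \<in> \<Y>" "p t \<in> Y" using cover by auto
    then have oY: "open Y" "chart Y" using charts by auto
    have "continuous_on {0..1} p" using p(3) by (simp add: path_def)
    then obtain U where U: "open U" "U \<inter> {0..1} = p -` Y \<inter> {0..1}"
      using oY(1) continuous_on_open_invariant[of "{0..1}" p] by meson
    have Up: "y \<in> U \<longleftrightarrow> p y \<in> Y" if "y \<in> {0..1}" for y
      using arg_cong[OF U(2), of "\<lambda>S. y \<in> S"] that by simp
    have "t \<in> U" using t Y Up by auto
    then obtain d where d: "d > 0" "ball t d \<subseteq> U" using U(1) open_contains_ball by meson
    have "Q a b" if ab: "a \<le> t" "t \<le> b" "b - a < d" for a b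
      unfolding Q_def
    proof (intro impI)
      assume i: "0 \<le> a" "a \<le> b" "b \<le> 1"
      have "p y \<in> Y" if "y \<in> {a..b}" for y
      proof -
        have "y \<in> U" using ab that by (intro d(2)[THEN subsetD]) (auto simp: dist_real_def abs_if)
        then show ?thesis using Up[of y] that i by auto
      qed
      then have im: "path_image (subpath a b p) \<subseteq> Y"
        using i by (auto simp: path_image_subpath)
      have "s a b = local_arrow Y id (p a) (p b)"
        unfolding s_def using sub[of a b] i im by (intro arrow_local_arrow[OF oY(2)]) auto
      moreover have "p a \<in> Y" "p b \<in> Y" using im i by (auto simp: path_image_subpath)
      ultimately show "P (p a) (p b) (s a b)" using local_arrow[OF Y(1) id_mem] by simp
    qed
    then show "\<exists>d>0. \<forall>a b. a \<le> t \<and> t \<le> b \<and> b - a < d \<longrightarrow> Q a b" using d(1) by blast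
  qed simp
  then have P1: "P z (\<gamma> w) (arrow X id p)"
    using p by (simp add: Q_def s_def pathstart_def pathfinish_def)
  have gw: "\<gamma> w \<in> X" using p pathfinish_in_path_image by fastforce
  then obtain Y where Y: "Y \<in> \<Y>" "\<gamma> w \<in> Y" using cover by auto
  then have cY: "chart Y" using charts by auto
  have "x = arrow X id p \<odot> local_arrow Y \<gamma> (\<gamma> w) w"
  proof -
    have "local_arrow Y \<gamma> (\<gamma> w) w = arrow X \<gamma> (linepath (\<gamma> w) (\<gamma> w))"
      using Y by (intro arrow_local_arrow[OF cY, symmetric]) auto
    then have "arrow X id p \<odot> local_arrow Y \<gamma> (\<gamma> w) w = arrow X (id \<circ> \<gamma>) (p +++ (id \<circ> linepath (\<gamma> w) (\<gamma> w)))"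
      using p gw by (simp only:) (intro mult_arrow; auto simp: id_mem)
    also have "\<dots> = x"
      unfolding p(1) by (intro arrow_cong) (use p in \<open>auto intro: homotopic_paths_sym homotopic_paths_rid'\<close>)
    finally show ?thesis by simp
  qed
  then show ?thesis
    using mult[OF _ local_arrow_mor[where \<gamma>=\<gamma> and w=w, OF cY Y(2,2) p(2)] P1 local_arrow[where \<gamma>=\<gamma> and w=w, OF Y(1) p(2) Y(2,2)]] p
    by (simp add: morI id_mem)
qed

end

section \<open>Automorphisms of the action\<close>

locale action_automorphism = action X \<Gamma> for X :: "'a::real_normed_vector set" and \<Gamma> +
  fixes A A' :: "'a \<Rightarrow> 'a"
  assumes inverses: "A \<circ> A' = id" "A' \<circ> A = id" and A_cont: "continuous_on UNIV A" and A_maps: "A ` X \<subseteq> X"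
    and conj_mem: "\<gamma> \<in> \<Gamma> \<Longrightarrow> A \<circ> \<gamma> \<circ> A' \<in> \<Gamma>"
begin

text \<open>
  The functor given by \<open>A\<close>; on the objects it is \<open>A\<close> itself, so that it moves the base point.
\<close>

definition transport :: "('a \<Rightarrow> 'a) \<times> (real \<Rightarrow> 'a) set \<Rightarrow> ('a \<Rightarrow> 'a) \<times> (real \<Rightarrow> 'a) set"
  where "transport = (\<lambda>(\<gamma>, C). (A \<circ> \<gamma> \<circ> A', {h. \<exists>p\<in>C. homotopic_paths X (A \<circ> p) h}))"

lemma A'_A [simp]: "A' (A z) = z"
  using inverses(2) by (metis comp_apply id_apply)

lemma transport_arrow:
  assumes "path p" "path_image p \<subseteq> X"
  shows "transport (arrow X \<gamma> p) = arrow X (A \<circ> \<gamma> \<circ> A') (A \<circ> p)"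
proof -
  have *: "homotopic_paths X (A \<circ> p) (A \<circ> q)" if "homotopic_paths X p q" for q
    by (rule homotopic_paths_continuous_image[OF that]) (use A_cont A_maps in \<open>auto intro: continuous_on_subset\<close>)
  have "{h. \<exists>q\<in>path_class X p. homotopic_paths X (A \<circ> q) h} = path_class X (A \<circ> p)"
  proof (intro equalityI subsetI)
    fix h assume "h \<in> {h. \<exists>q\<in>path_class X p. homotopic_paths X (A \<circ> q) h}"
    then show "h \<in> path_class X (A \<circ> p)"
      using * unfolding path_class_def by (blast intro: homotopic_paths_trans)
  next
    fix h assume "h \<in> path_class X (A \<circ> p)"
    moreover have "p \<in> path_class X p" using assms by (simp add: path_class_def)
    ultimately show "h \<in> {h. \<exists>q\<in>path_class X p. homotopic_paths X (A \<circ> q) h}"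
      unfolding path_class_def by blast
  qed
  then show ?thesis by (simp add: transport_def arrow_def)
qed

lemma A_path: "path p \<Longrightarrow> path (A \<circ> p)"
  by (rule path_continuous_image) (auto intro: continuous_on_subset[OF A_cont])

lemma A_path_image: "path_image p \<subseteq> X \<Longrightarrow> path_image (A \<circ> p) \<subseteq> X"
  unfolding path_image_compose using A_maps by blast

lemma transport_mor:
  assumes "x \<in> mor z w" shows "transport x \<in> mor (A z) (A w)"
proof -
  obtain \<gamma> p where x: "x = arrow X \<gamma> p" "\<gamma> \<in> \<Gamma>" "path p" "path_image p \<subseteq> X" "pathstart p = z" "pathfinish p = \<gamma> w"
    using assms(1) by (rule morE)
  show ?thesis unfolding x(1) transport_arrow[OF x(3,4)]
    using x by (intro morI conj_mem A_path A_path_image) (auto simp: pathstart_compose pathfinish_compose)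
qed

lemma transport_mult:
  assumes "x \<in> mor z w" "y \<in> mor w u" shows "transport (x \<odot> y) = transport x \<odot> transport y"
proof -
  obtain \<gamma> p where x: "x = arrow X \<gamma> p" "\<gamma> \<in> \<Gamma>" "path p" "path_image p \<subseteq> X" "pathstart p = z" "pathfinish p = \<gamma> w"
    using assms(1) by (rule morE)
  obtain \<delta> q where y: "y = arrow X \<delta> q" "\<delta> \<in> \<Gamma>" "path q" "path_image q \<subseteq> X" "pathstart q = w" "pathfinish q = \<delta> u"
    using assms(2) by (rule morE)
  have c: "(A \<circ> \<gamma> \<circ> A') \<circ> (A \<circ> q) = A \<circ> (\<gamma> \<circ> q)" by (simp add: fun_eq_iff)
  have c': "(A \<circ> \<gamma> \<circ> A') \<circ> (A \<circ> \<delta> \<circ> A') = A \<circ> (\<gamma> \<circ> \<delta>) \<circ> A'" by (simp add: fun_eq_iff)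
  have "transport x \<odot> transport y = arrow X ((A \<circ> \<gamma> \<circ> A') \<circ> (A \<circ> \<delta> \<circ> A')) ((A \<circ> p) +++ ((A \<circ> \<gamma> \<circ> A') \<circ> (A \<circ> q)))"
    unfolding x(1) y(1) transport_arrow[OF x(3,4)] transport_arrow[OF y(3,4)]
    using x y by (intro mult_arrow conj_mem A_path A_path_image) (auto simp: pathstart_compose pathfinish_compose)
  also have "\<dots> = arrow X (A \<circ> (\<gamma> \<circ> \<delta>) \<circ> A') (A \<circ> (p +++ (\<gamma> \<circ> q)))"
    unfolding c c' by (simp add: path_compose_join)
  also have "\<dots> = transport (arrow X (\<gamma> \<circ> \<delta>) (p +++ (\<gamma> \<circ> q)))"
    using x y by (intro transport_arrow[symmetric] subset_path_image_join path_image_comp path_join_imp path_comp)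
      (auto simp: pathstart_compose)
  also have "\<dots> = transport (x \<odot> y)"
    using x y by (simp add: mult_arrow)
  finally show ?thesis ..
qed

lemma transport_unit: "z \<in> X \<Longrightarrow> transport (unit z) = unit (A z)"
  unfolding unit_def const_eq_linepath
  by (subst transport_arrow) (auto simp: inverses linepath_refl path_def intro!: arrow_cong)

lemma transport_local_arrow:
  assumes Y: "chart Y" "z \<in> Y" "\<gamma> w \<in> Y" and Y': "chart Y'" "A ` Y \<subseteq> Y'"
  shows "transport (local_arrow Y \<gamma> z w) = local_arrow Y' (A \<circ> \<gamma> \<circ> A') (A z) (A w)"
proof -
  obtain p where p: "path p" "path_image p \<subseteq> Y" "path_image p \<subseteq> X" "pathstart p = z" "pathfinish p = \<gamma> w"
    using local_arrow_path[OF Y(1-3)] .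
  show ?thesis
    unfolding arrow_local_arrow[where \<gamma>=\<gamma> and w=w, OF Y(1) p(1,2,4,5), symmetric] transport_arrow[OF p(1,3)]
  proof (rule arrow_local_arrow[OF Y'(1) A_path[OF p(1)]])
    show "path_image (A \<circ> p) \<subseteq> Y'" unfolding path_image_compose using p Y' by blast
  qed (use p in \<open>auto simp: pathstart_compose pathfinish_compose\<close>)
qed

end

lemma (in action_automorphism) transport_mutually_inverse:
  assumes "mutually_inverse z w g h"
  shows "mutually_inverse (A z) (A w) (transport g) (transport h)"
proof -
  have g: "g \<in> mor z w" "h \<in> mor w z" "g \<odot> h = unit z" "h \<odot> g = unit w"
    using assms by (auto simp: mutually_inverse_def)
  then have zw: "z \<in> X" "w \<in> X" using mor_source by auto
  show ?thesis
    using transport_mor[OF g(1)] transport_mor[OF g(2)] transport_mult[OF g(1,2)] transport_mult[OF g(2,1)]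
      transport_unit zw g(3,4) by (simp add: mutually_inverse_def)
qed

section \<open>The punctured plane in skew coordinates\<close>

abbreviation "punctured_plane \<equiv> - int_lattice"

abbreviation plane_mult (infixl "\<odot>" 70) where "x \<odot> y \<equiv> arrow_mult punctured_plane x y"

lemma not_Ints_between: "of_int k < x \<Longrightarrow> x < of_int k + 1 \<Longrightarrow> (x::real) \<notin> \<int>"
  by (auto elim!: Ints_cases)

text \<open>
  The rotation groups of the integral (\<open>\<rho> = 2\<close>) and of the half-integral lattice (\<open>\<rho> = 1\<close>) without
  reference to generators, see \<open>rotation_group_half_grid\<close>: rotations by the angle \<open>\<pi>\<close> and translations.
\<close>

definition affine_maps :: "int \<Rightarrow> (plane \<Rightarrow> plane) set"
  where "affine_maps \<rho> = {(\<lambda>z. e *\<^sub>R z + (of_int (\<rho> * i), of_int (\<rho> * j))) | e i j. e = 1 \<or> e = -1}"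

text \<open>
  A basis of the integer lattice. The vector \<open>v\<close> plays the role of the vertical direction; \<open>across\<close> and
  \<open>along\<close> are the coordinates, so that the lines parallel to \<open>v\<close> that contain lattice points are those
  on which \<open>across\<close> is an integer.
\<close>

locale skew_basis =
  fixes u v :: "int \<times> int"
  assumes det: "fst u * snd v - snd u * fst v = 1"
begin

definition pt :: "real \<Rightarrow> real \<Rightarrow> plane"
  where "pt x y = (x * of_int (fst u) + y * of_int (fst v), x * of_int (snd u) + y * of_int (snd v))"

definition across :: "plane \<Rightarrow> real" where "across z = fst z * of_int (snd v) - snd z * of_int (fst v)"
definition along :: "plane \<Rightarrow> real" where "along z = of_int (fst u) * snd z - of_int (snd u) * fst z"

lemma rdet: "real_of_int (fst u) * of_int (snd v) - of_int (snd u) * of_int (fst v) = 1"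
  using det by (metis of_int_1 of_int_diff of_int_mult)

lemma across_pt [simp]: "across (pt x y) = x"
proof -
  have "across (pt x y) = x * (real_of_int (fst u) * of_int (snd v) - of_int (snd u) * of_int (fst v))"
    by (simp add: across_def pt_def algebra_simps)
  then show ?thesis by (simp add: rdet)
qed

lemma along_pt [simp]: "along (pt x y) = y"
proof -
  have "along (pt x y) = y * (real_of_int (fst u) * of_int (snd v) - of_int (snd u) * of_int (fst v))"
    by (simp add: along_def pt_def algebra_simps)
  then show ?thesis by (simp add: rdet)
qed

lemma pt_coords [simp]: "pt (across z) (along z) = z"
proof -
  have "pt (across z) (along z) = (real_of_int (fst u) * of_int (snd v) - of_int (snd u) * of_int (fst v)) *\<^sub>R z"
    by (cases z) (simp add: across_def along_def pt_def algebra_simps)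
  then show ?thesis by (simp add: rdet)
qed

lemma coords_eqI: "across z = across w \<Longrightarrow> along z = along w \<Longrightarrow> z = w"
  by (metis pt_coords)

lemma across_linear [simp]: "across (z + w) = across z + across w" "across (z - w) = across z - across w" "across (c *\<^sub>R z) = c * across z" "across (- z) = - across z"
  by (simp_all add: across_def algebra_simps)

lemma along_linear [simp]: "along (z + w) = along z + along w" "along (z - w) = along z - along w" "along (c *\<^sub>R z) = c * along z" "along (- z) = - along z"
  by (simp_all add: along_def algebra_simps)

lemma int_lattice_iff: "z \<in> int_lattice \<longleftrightarrow> across z \<in> \<int> \<and> along z \<in> \<int>"
proof
  assume "z \<in> int_lattice"
  then show "across z \<in> \<int> \<and> along z \<in> \<int>"
    by (auto simp: int_lattice_def across_def along_def)
next
  assume "across z \<in> \<int> \<and> along z \<in> \<int>"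
  then have "pt (across z) (along z) \<in> int_lattice"
    by (auto simp: int_lattice_def pt_def)
  then show "z \<in> int_lattice" by simp
qed

lemma continuous_coords [continuous_intros]:
  "continuous_on S across" "continuous_on S along"
  unfolding across_def along_def by (intro continuous_intros)+

lemma continuous_pt [continuous_intros]:
  "continuous_on S f \<Longrightarrow> continuous_on S g \<Longrightarrow> continuous_on S (\<lambda>x. pt (f x) (g x))"
  unfolding pt_def by (intro continuous_intros)

definition vshift :: "int \<Rightarrow> plane \<Rightarrow> plane" where "vshift l z = z + pt 0 (of_int l)"

lemma vshift_coords [simp]: "across (vshift l z) = across z" "along (vshift l z) = along z + of_int l"
  by (simp_all add: vshift_def)

definition strip :: "int \<Rightarrow> plane set" where "strip k = {z. of_int k < across z \<and> across z < of_int k + 1}"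

text \<open>
  Two adjacent strips together with the gap between two consecutive lattice points on the line that
  separates them. The cells cover the punctured plane, and each is starlike about the midpoint of its gap.
\<close>

definition cell :: "int \<Rightarrow> int \<Rightarrow> plane set"
  where "cell k j = {z. of_int k - 1 < across z \<and> across z < of_int k + 1 \<and>
    (across z = of_int k \<longrightarrow> of_int j < along z \<and> along z < of_int j + 1)}"

lemma open_cell: "open (cell k j)"
proof -
  have "cell k j = {z. of_int k - 1 < across z} \<inter> {z. across z < of_int k + 1} \<inter>
      - ({z. across z = of_int k} \<inter> ({z. along z \<le> of_int j} \<union> {z. of_int j + 1 \<le> along z}))"
    by (auto simp: cell_def)
  also have "open \<dots>"
    by (intro open_Int open_Compl closed_Int closed_Un open_Collect_less closed_Collect_le closed_Collect_eq continuous_intros)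
  finally show ?thesis .
qed

lemma cell_int: "z \<in> cell k j \<Longrightarrow> across z = of_int a \<Longrightarrow> a = k"
  using of_int_less_iff[where 'a=real, of "k - 1" a] of_int_less_iff[where 'a=real, of a "k + 1"]
  by (auto simp: cell_def)

lemma cell_subset: "cell k j \<subseteq> punctured_plane"
proof
  fix z assume z: "z \<in> cell k j"
  show "z \<in> punctured_plane"
  proof
    assume "z \<in> int_lattice"
    then obtain a c where a: "across z = of_int a" "along z = of_int c"
      unfolding int_lattice_iff by (auto elim!: Ints_cases)
    have "a = k" using cell_int[OF z a(1)] .
    then have "of_int j < along z" "along z < of_int j + 1" using z a(1) by (auto simp: cell_def)
    then show False using not_Ints_between[of j "along z"] a(2) by simp
  qed
qed

lemma strip_subset: "strip k \<subseteq> punctured_plane"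
  using not_Ints_between by (auto simp: strip_def int_lattice_iff)

lemma starlike_cell: "starlike (cell k j)"
  unfolding starlike_def
proof (intro bexI ballI)
  let ?a = "pt (of_int k) (of_int j + 1/2)"
  show a: "?a \<in> cell k j" by (simp add: cell_def)
  fix w assume w: "w \<in> cell k j"
  show "closed_segment ?a w \<subseteq> cell k j"
  proof
    fix z assume "z \<in> closed_segment ?a w"
    then obtain t where t: "0 \<le> t" "t \<le> 1" "z = (1 - t) *\<^sub>R ?a + t *\<^sub>R w"
      unfolding in_segment by blast
    have across: "across z - of_int k = t * (across w - of_int k)" and along: "along z = (1 - t) * (of_int j + 1/2) + t * along w"
      by (simp_all add: t(3) algebra_simps add_divide_distrib diff_divide_distrib)
    have "\<bar>across z - of_int k\<bar> \<le> \<bar>across w - of_int k\<bar>"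
      unfolding across abs_mult using t mult_left_le_one_le[of "\<bar>across w - of_int k\<bar>" t] by simp
    moreover have "\<bar>across w - of_int k\<bar> < 1" using w by (auto simp: cell_def abs_if)
    ultimately have 1: "of_int k - 1 < across z" "across z < of_int k + 1" by linarith+
    have 2: "of_int j < along z \<and> along z < of_int j + 1" if "across z = of_int k"
    proof (cases "t = 0")
      case True then show ?thesis by (simp add: along)
    next
      case False
      then have "across w = of_int k" using across that by simp
      then have w': "of_int j < along w" "along w < of_int j + 1" using w by (auto simp: cell_def)
      have "along z - of_int j = (1 - t) * (1/2) + t * (along w - of_int j)"
        "of_int j + 1 - along z = (1 - t) * (1/2) + t * (of_int j + 1 - along w)"
        by (simp_all add: along algebra_simps)
      moreover have "0 < t" using False t by simp
      ultimately have "0 < along z - of_int j" "0 < of_int j + 1 - along z"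
        using t w' by (simp_all add: add_nonneg_pos)
      then show ?thesis by simp
    qed
    show "z \<in> cell k j" using 1 2 by (simp add: cell_def)
  qed
qed

lemma convex_strip: "convex (strip k)"
proof -
  have "across z = (of_int (snd v), - of_int (fst v)) \<bullet> z" for z
    by (simp add: across_def inner_prod_def)
  then have "convex {z. of_int k < across z}" "convex {z. across z < of_int k + 1}"
    using convex_halfspace_gt[of "of_int k" "(of_int (snd v), - of_int (fst v)) :: plane"]
      convex_halfspace_lt[of "(of_int (snd v), - of_int (fst v)) :: plane" "of_int k + 1"]
    by simp_all
  moreover have "strip k = {z. of_int k < across z} \<inter> {z. across z < of_int k + 1}"
    by (auto simp: strip_def)
  ultimately show ?thesis by (simp add: convex_Int)
qed

lemma cover_cells: "punctured_plane \<subseteq> \<Union> (range (case_prod cell))"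
proof
  fix z assume z: "z \<in> punctured_plane"
  show "z \<in> \<Union> (range (case_prod cell))"
  proof (cases "across z \<in> \<int>")
    case True
    then have "along z \<notin> \<int>" using z by (simp add: int_lattice_iff)
    then have "of_int \<lfloor>along z\<rfloor> < along z" using floor_correct[of "along z"] by (metis Ints_of_int order_le_less)
    then have "z \<in> cell \<lfloor>across z\<rfloor> \<lfloor>along z\<rfloor>"
      using True floor_correct[of "along z"] by (auto simp: cell_def elim!: Ints_cases)
    then show ?thesis by auto
  next
    case False
    then have "of_int \<lfloor>across z\<rfloor> < across z" using floor_correct[of "across z"] by (metis Ints_of_int order_le_less)
    then have "z \<in> cell \<lfloor>across z\<rfloor> 0" using floor_correct[of "across z"] by (auto simp: cell_def)
    then show ?thesis by auto
  qed
qed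

text \<open>
  A point on a line through lattice points lies in only one gap. So two different cells meet only in
  the strips, where all vertical segments are available.
\<close>

lemma cell_overlap:
  assumes "z \<in> cell k j" "z \<in> cell k' j'" "(k, j) \<noteq> (k', j')"
  shows "across z \<notin> \<int>"
proof
  assume "across z \<in> \<int>"
  then obtain a where a: "across z = of_int a" by (auto elim: Ints_cases)
  have k: "a = k" "a = k'" using assms(1,2) cell_int a by blast+
  then have "of_int j < along z" "along z < of_int j + 1" "of_int j' < along z" "along z < of_int j' + 1"
    using assms(1,2) a by (auto simp: cell_def)
  then have "j = j'" by linarith
  with k assms(3) show False by simp
qed

lemma strip_of_cell:
  assumes "z \<in> cell k j" "across z \<notin> \<int>"
  shows "z \<in> strip \<lfloor>across z\<rfloor>" "strip \<lfloor>across z\<rfloor> \<subseteq> cell k j"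
proof -
  have l: "of_int \<lfloor>across z\<rfloor> < across z" "across z < of_int \<lfloor>across z\<rfloor> + 1"
    using assms(2) floor_correct[of "across z"] by (metis Ints_of_int order_le_less, linarith)
  then show "z \<in> strip \<lfloor>across z\<rfloor>" by (simp add: strip_def)
  have "across z \<noteq> of_int k" using assms by auto
  then have "\<lfloor>across z\<rfloor> = k \<or> \<lfloor>across z\<rfloor> = k - 1" using assms(1) by (auto simp: cell_def) linarith
  then show "strip \<lfloor>across z\<rfloor> \<subseteq> cell k j" by (auto simp: strip_def cell_def)
qed

lemma affine_maps_coords:
  assumes "\<gamma> \<in> affine_maps \<rho>"
  obtains e i l :: int where "e = 1 \<or> e = -1" "\<rho> dvd i" "\<rho> dvd l"
    "\<And>z. across (\<gamma> z) = of_int e * across z + of_int i" "\<And>z. along (\<gamma> z) = of_int e * along z + of_int l"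
proof -
  obtain e' i' j' where g: "\<gamma> = (\<lambda>z. e' *\<^sub>R z + (of_int (\<rho> * i'), of_int (\<rho> * j')))" "e' = 1 \<or> e' = (-1::real)"
    using assms by (auto simp: affine_maps_def)
  define e :: int where "e = (if e' = 1 then 1 else -1)"
  show ?thesis
  proof (rule that)
    show "e = 1 \<or> e = -1" by (simp add: e_def)
    have e: "of_int e = e'" using g by (auto simp: e_def)
    show "across (\<gamma> z) = of_int e * across z + of_int (\<rho> * (i' * snd v - j' * fst v))" for z
      by (simp add: g e across_def algebra_simps)
    show "along (\<gamma> z) = of_int e * along z + of_int (\<rho> * (fst u * j' - snd u * i'))" for z
      by (simp add: g e along_def algebra_simps)
  qed auto
qed

lemma affine_mapsI:
  assumes "e = 1 \<or> e = -1" "\<rho> dvd i" "\<rho> dvd l"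
    "\<And>z. across (\<gamma> z) = of_int e * across z + of_int i" "\<And>z. along (\<gamma> z) = of_int e * along z + of_int l"
  shows "\<gamma> \<in> affine_maps \<rho>"
proof -
  obtain i' l' where il: "i = \<rho> * i'" "l = \<rho> * l'" using assms(2,3) by (auto elim!: dvdE)
  have "\<gamma> z = of_int e *\<^sub>R z + (of_int (\<rho> * (i' * fst u + l' * fst v)), of_int (\<rho> * (i' * snd u + l' * snd v)))" for z
  proof -
    have "\<gamma> z = of_int e *\<^sub>R z + pt (of_int i) (of_int l)"
      by (rule coords_eqI) (simp_all add: assms(4,5))
    also have "pt (of_int i) (of_int l) = (of_int (\<rho> * (i' * fst u + l' * fst v)), of_int (\<rho> * (i' * snd u + l' * snd v)))"
      by (simp add: pt_def il algebra_simps)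
    finally show ?thesis .
  qed
  then have "\<gamma> = (\<lambda>z. real_of_int e *\<^sub>R z + (of_int (\<rho> * (i' * fst u + l' * fst v)), of_int (\<rho> * (i' * snd u + l' * snd v))))"
    by (rule ext)
  moreover have "real_of_int e = 1 \<or> real_of_int e = -1" using assms(1) by auto
  ultimately show ?thesis unfolding affine_maps_def by blast
qed

end

lemma affine_maps_action: "action punctured_plane (affine_maps \<rho>)"
proof -
  interpret skew_basis "(1,0)" "(0,1)" by unfold_locales simp
  show ?thesis
  proof
    show "id \<in> affine_maps \<rho>"
      by (rule affine_mapsI[of 1 _ 0 0]) auto
    fix \<gamma> assume g: "\<gamma> \<in> affine_maps \<rho>"
    obtain e i l where e: "e = 1 \<or> e = -1" "\<rho> dvd i" "\<rho> dvd l"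
      "\<And>z. across (\<gamma> z) = of_int e * across z + of_int i" "\<And>z. along (\<gamma> z) = of_int e * along z + of_int l"
      using affine_maps_coords[OF g] by metis
    have ee: "real_of_int e * of_int e = 1" using e(1) by auto
    { fix \<delta> assume h: "\<delta> \<in> affine_maps \<rho>"
      obtain e' i' l' where e': "e' = 1 \<or> e' = -1" "\<rho> dvd i'" "\<rho> dvd l'"
        "\<And>z. across (\<delta> z) = of_int e' * across z + of_int i'" "\<And>z. along (\<delta> z) = of_int e' * along z + of_int l'"
        using affine_maps_coords[OF h] by metis
      show "\<gamma> \<circ> \<delta> \<in> affine_maps \<rho>"
        by (rule affine_mapsI[of "e * e'" _ "e * i' + i" "e * l' + l"]) (use e e' in \<open>auto simp: algebra_simps\<close>) }
    let ?d = "\<lambda>z. pt (of_int e * (across z - of_int i)) (of_int e * (along z - of_int l))"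
    have "?d \<in> affine_maps \<rho>"
      by (rule affine_mapsI[of e _ "- (e * i)" "- (e * l)"]) (use e in \<open>auto simp: algebra_simps\<close>)
    moreover have "\<gamma> \<circ> ?d = id" "?d \<circ> \<gamma> = id"
      by (rule ext, rule coords_eqI; simp add: e(4,5) ee flip: mult.assoc)+
    ultimately show "\<exists>\<delta>\<in>affine_maps \<rho>. \<gamma> \<circ> \<delta> = id \<and> \<delta> \<circ> \<gamma> = id" by blast
    have "continuous_on UNIV (\<lambda>z. pt (across (\<gamma> z)) (along (\<gamma> z)))"
      unfolding e by (intro continuous_intros)
    then show "continuous_on UNIV \<gamma>" by simp
    show "\<gamma> ` punctured_plane \<subseteq> punctured_plane"
    proof (rule ccontr)
      assume "\<not> \<gamma> ` punctured_plane \<subseteq> punctured_plane"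
      then obtain z where z: "z \<notin> int_lattice" and "\<gamma> z \<in> int_lattice" by auto
      then have "across (\<gamma> z) \<in> \<int>" "along (\<gamma> z) \<in> \<int>" by (auto simp: int_lattice_iff)
      then have "of_int e * (across (\<gamma> z) - of_int i) \<in> \<int>" "of_int e * (along (\<gamma> z) - of_int l) \<in> \<int>" by auto
      then have "across z \<in> \<int>" "along z \<in> \<int>" by (simp_all add: e(4,5) ee flip: mult.assoc)
      with z show False by (simp add: int_lattice_iff)
    qed
  qed
qed

section \<open>Vertical loops\<close>

locale lattice_action = skew_basis u v + action "- int_lattice" "affine_maps \<rho>"
  for u v :: "int \<times> int" and \<rho> :: int
begin

lemma chart_cell: "chart (cell k j)"
  by (simp add: chart_def cell_subset starlike_cell starlike_imp_simply_connected)

lemma chart_strip: "chart (strip k)"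
  by (simp add: chart_def strip_subset convex_strip convex_imp_simply_connected)

lemma vshift_mem: "\<rho> dvd l \<Longrightarrow> vshift l \<in> affine_maps \<rho>"
  by (rule affine_mapsI[of 1 _ 0 l]) auto

lemma vshift_comp: "vshift k \<circ> vshift l = vshift (k + l)"
  by (rule ext, rule coords_eqI) auto

lemma vshift_0: "vshift 0 = id"
  by (rule ext, rule coords_eqI) auto

lemma vshift_cell: "vshift l ` cell k j \<subseteq> cell k (j + l)"
  by (auto simp: cell_def)

lemma vshift_strip: "vshift l ` strip k \<subseteq> strip k"
  by (auto simp: strip_def)

text \<open>
  The arrow represented by the vertical segment of length \<open>l\<close> that starts at \<open>z\<close>, for \<open>z\<close> in a strip. It
  is a loop in the quotient if \<open>\<rho>\<close> divides \<open>l\<close>, as the vertical translation then is a group element.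
\<close>

definition vloop :: "int \<Rightarrow> plane \<Rightarrow> (plane \<Rightarrow> plane) \<times> (real \<Rightarrow> plane) set"
  where "vloop l z = local_arrow (strip \<lfloor>across z\<rfloor>) (vshift l) z z"

lemma in_strip_iff: "z \<in> strip k \<longleftrightarrow> across z \<notin> \<int> \<and> \<lfloor>across z\<rfloor> = k"
proof
  assume "z \<in> strip k"
  then show "across z \<notin> \<int> \<and> \<lfloor>across z\<rfloor> = k" using not_Ints_between[of k "across z"] by (auto simp: strip_def floor_eq_iff)
next
  assume z: "across z \<notin> \<int> \<and> \<lfloor>across z\<rfloor> = k"
  then have "of_int k \<noteq> across z" by auto
  moreover have "of_int k \<le> across z" "across z < of_int k + 1" using z floor_correct[of "across z"] by auto
  ultimately show "z \<in> strip k" by (simp add: strip_def)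
qed

lemma vloop_eq: "z \<in> strip k \<Longrightarrow> vloop l z = local_arrow (strip k) (vshift l) z z"
  unfolding vloop_def in_strip_iff by simp

lemma vshift_in_strip: "z \<in> strip k \<Longrightarrow> vshift l z \<in> strip k"
  by (simp add: strip_def)

lemma vloop_mor: "z \<in> strip k \<Longrightarrow> \<rho> dvd l \<Longrightarrow> vloop l z \<in> mor z z"
  unfolding vloop_eq by (intro local_arrow_mor chart_strip vshift_mem vshift_in_strip)

lemma vloop_mult:
  assumes z: "z \<in> strip k" and l: "\<rho> dvd l" shows "vloop l z \<odot> vloop l' z = vloop (l + l') z"
  unfolding vloop_eq[OF z]
  by (subst local_arrow_mult) (auto intro: chart_strip vshift_mem vshift_in_strip l z vshift_strip[THEN subsetD] simp: vshift_comp)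

text \<open>
  All points of a strip give the same loop, up to the path that joins them in the strip.
\<close>

lemma vloop_base_change:
  assumes z: "z \<in> strip k" "w \<in> strip k" and l: "\<rho> dvd l"
  shows "local_arrow (strip k) id z w \<odot> vloop l w \<odot> local_arrow (strip k) id w z = vloop l z"
  unfolding vloop_eq[OF z(1)] vloop_eq[OF z(2)]
  by (subst local_arrow_mult; (subst local_arrow_mult)?)
    (use z l in \<open>auto intro: chart_strip vshift_mem vshift_in_strip vshift_strip[THEN subsetD] id_mem\<close>)

lemma vloop_arrow:
  assumes z: "z \<in> strip k" shows "vloop l z = arrow punctured_plane (vshift l) (linepath z (vshift l z))"
proof -
  have "path_image (linepath z (vshift l z)) \<subseteq> strip k"
    by (simp, intro closed_segment_subset convex_strip z vshift_in_strip)
  then show ?thesis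
    unfolding vloop_eq[OF z] by (intro arrow_local_arrow[symmetric] chart_strip) auto
qed

lemma vloop_0: "z \<in> strip k \<Longrightarrow> vloop 0 z = unit z"
  unfolding vloop_eq vshift_0 by (rule local_arrow_const[OF chart_strip])

end

section \<open>Twists act trivially modulo the relators\<close>

text \<open>
  The data of an affine map \<open>(x, y) \<mapsto> (x, \<epsilon> y + c x + d)\<close> in the coordinates across and along \<open>v\<close>,
  whose displacements of the gaps are all divisible by \<open>m\<close>, where the vertical loops of length \<open>m\<close> are
  relators. The hypothesis on these loops excludes the base points on the lines halfway between lattice
  lines, because in the odd case the loops of \<open>half_lattice\<close> have to avoid these lines.
\<close>

locale twist = lattice_action u v \<rho> + action_mod "- int_lattice" "affine_maps \<rho>" b N
  for u v :: "int \<times> int" and \<rho> :: int and b :: plane and N +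
  fixes \<epsilon> c d m :: int
  assumes sign: "\<epsilon> = 1 \<or> \<epsilon> = -1" and rho: "\<rho> dvd m" "\<rho> dvd 2"
    and shift_dvd: "\<And>k j. m dvd (if \<epsilon> = 1 then c * k + d else c * k + d - 1 - 2 * j)"
    and null: "\<And>z g h. 2 * across z \<notin> \<int> \<Longrightarrow> g \<in> mor b z \<Longrightarrow> h \<in> mor z b \<Longrightarrow>
      g \<odot> h = unit b \<Longrightarrow> h \<odot> g = unit z \<Longrightarrow> g \<odot> vloop m z \<odot> h \<in> N"
begin

lemma sign_sq: "real_of_int \<epsilon> * (of_int \<epsilon> * x) = x"
  using sign by auto

text \<open>
  The map \<open>A\<close> takes the gap between \<open>(k, j)\<close> and \<open>(k, j + 1)\<close> to the one that starts at \<open>(k, j + \<sigma> k j)\<close>. If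
  \<open>\<epsilon> = -1\<close>, the lower end of the image gap is the image of the upper end, whence the summand \<open>-1\<close>.
\<close>

definition \<sigma> :: "int \<Rightarrow> int \<Rightarrow> int"
  where "\<sigma> k j = (if \<epsilon> = 1 then c * k + d else c * k + d - 1 - 2 * j)"

definition A :: "plane \<Rightarrow> plane"
  where "A z = pt (across z) (of_int \<epsilon> * along z + of_int c * across z + of_int d)"

definition A' :: "plane \<Rightarrow> plane"
  where "A' z = pt (across z) (of_int \<epsilon> * (along z - of_int c * across z - of_int d))"

lemma A_coords [simp]: "across (A z) = across z" "along (A z) = of_int \<epsilon> * along z + of_int c * across z + of_int d"
  by (simp_all add: A_def)

lemma A'_coords [simp]: "across (A' z) = across z" "along (A' z) = of_int \<epsilon> * (along z - of_int c * across z - of_int d)"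
  by (simp_all add: A'_def)

lemma dvd_\<sigma>: "m dvd \<sigma> k j" "\<rho> dvd \<sigma> k j"
  using shift_dvd rho dvd_trans unfolding \<sigma>_def by blast+

lemma A_automorphism: "action_automorphism punctured_plane (affine_maps \<rho>) A A'"
proof
  show "A \<circ> A' = id" "A' \<circ> A = id"
    by (rule ext, rule coords_eqI; simp add: sign_sq algebra_simps)+
  show "continuous_on UNIV A"
    unfolding A_def by (intro continuous_intros)
  show "A ` punctured_plane \<subseteq> punctured_plane"
  proof (rule ccontr)
    assume "\<not> A ` punctured_plane \<subseteq> punctured_plane"
    then obtain z where z: "z \<notin> int_lattice" and "A z \<in> int_lattice" by auto
    then have i: "across z \<in> \<int>" "of_int \<epsilon> * along z + of_int c * across z + of_int d \<in> \<int>" by (auto simp: int_lattice_iff)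
    then have "of_int \<epsilon> * (of_int \<epsilon> * along z + of_int c * across z + of_int d - of_int c * across z - of_int d) \<in> \<int>"
      by (intro Ints_mult Ints_diff) auto
    then have "along z \<in> \<int>" by (simp add: sign_sq)
    with i z show False by (simp add: int_lattice_iff)
  qed
  fix \<gamma> assume g: "\<gamma> \<in> affine_maps \<rho>"
  obtain e i l where e: "e = 1 \<or> e = -1" "\<rho> dvd i" "\<rho> dvd l"
    "\<And>z. across (\<gamma> z) = of_int e * across z + of_int i" "\<And>z. along (\<gamma> z) = of_int e * along z + of_int l"
    using affine_maps_coords[OF g] by metis
  have "\<rho> dvd d * (1 - e)" using e(1) rho(2) by auto
  then show "A \<circ> \<gamma> \<circ> A' \<in> affine_maps \<rho>"
    by (intro affine_mapsI[of e _ i "\<epsilon> * l + c * i + d * (1 - e)"])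
      (use e in \<open>auto simp: sign_sq algebra_simps\<close>)
qed

sublocale action_automorphism punctured_plane "affine_maps \<rho>" A A'
  by (rule A_automorphism)

lemma A_cell: "A ` cell k j \<subseteq> cell k (j + \<sigma> k j)"
proof
  fix w assume "w \<in> A ` cell k j"
  then obtain z where z: "z \<in> cell k j" "w = A z" by auto
  show "w \<in> cell k (j + \<sigma> k j)"
    unfolding z(2) cell_def using z(1) sign by (auto simp: cell_def \<sigma>_def algebra_simps)
qed

text \<open>
  The relators give this for base points away from the midline of the strip; the others are reached by
  sliding the loop inside the strip.
\<close>

lemma vloop_null:
  assumes z: "z \<in> strip k" shows "eqv z z (vloop m z) (unit z)"
proof -
  have *: "eqv w w (vloop m w) (unit w)" if w: "w \<in> strip k" "2 * across w \<notin> \<int>" for w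
  proof (rule eqv_unitI)
    show "vloop m w \<in> mor w w" by (rule vloop_mor[OF w(1) rho(1)])
    show "w \<in> punctured_plane" using strip_subset w by blast
    show "g \<odot> vloop m w \<odot> h \<in> N"
      if "g \<in> mor b w" "h \<in> mor w b" "g \<odot> h = unit b" "h \<odot> g = unit w" for g h
      using null[OF w(2) that] by simp
  qed
  \<comment> \<open>a point of the strip off its midline\<close>
  define w where "w = pt (of_int k + 1/4) 0"
  have w: "w \<in> strip k" by (simp add: w_def strip_def)
  have "2 * across w \<notin> \<int>" using not_Ints_between[of "2 * k" "2 * across w"] by (simp add: w_def)
  with * w have 1: "eqv w w (vloop m w) (unit w)" by blast
  let ?s = "local_arrow (strip k) id z w" and ?t = "local_arrow (strip k) id w z"
  have s: "?s \<in> mor z w" "?t \<in> mor w z" using z w by (auto intro!: local_arrow_mor chart_strip id_mem)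
  have "eqv z z (?s \<odot> vloop m w \<odot> ?t) (?s \<odot> unit w \<odot> ?t)"
    using s 1 by (intro eqv_mult[OF eqv_mult[OF eqv_refl] eqv_refl])
  moreover have "?s \<odot> unit w \<odot> ?t = unit z"
  proof -
    have "?s \<odot> ?t = local_arrow (strip k) (id \<circ> id) z z"
      using z w by (intro local_arrow_mult chart_strip id_mem) auto
    also have "\<dots> = unit z" using local_arrow_const[OF chart_strip z] by simp
    finally show ?thesis by (simp add: unit_right[OF s(1)])
  qed
  ultimately show ?thesis using vloop_base_change[OF z w rho(1)] by simp
qed

lemma vloop_null_dvd:
  assumes z: "z \<in> strip k" and l: "m dvd l" shows "eqv z z (vloop l z) (unit z)"
proof -
  have u: "unit z \<in> mor z z" using z strip_subset by (intro unit_mor) auto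
  note v0 = vloop_0[OF z]
  have pos: "eqv z z (vloop (m * int n) z) (unit z)" for n
  proof (induction n)
    case 0 show ?case by (simp add: v0 eqv_refl u)
  next
    case (Suc n)
    have "eqv z z (vloop m z \<odot> vloop (m * int n) z) (unit z \<odot> unit z)"
      by (rule eqv_mult[OF vloop_null[OF z] Suc])
    moreover have "unit z \<odot> unit z = unit z" by (rule unit_left[OF u])
    moreover have "vloop m z \<odot> vloop (m * int n) z = vloop (m * int (Suc n)) z"
      unfolding vloop_mult[OF z rho(1)] by (simp add: algebra_simps)
    ultimately show ?case by simp
  qed
  obtain q where q: "l = m * q" using l by (auto elim: dvdE)
  show ?thesis
  proof (cases "0 \<le> q")
    case True then show ?thesis using pos[of "nat q"] q by simp
  next
    case False
    then have e: "m * int (nat (- q)) = - l" using q by simp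
    have r: "\<rho> dvd l" "\<rho> dvd - l" using rho(1) l dvd_trans by auto
    have "eqv z z (vloop l z \<odot> vloop (- l) z) (vloop l z \<odot> unit z)"
      using eqv_mult[OF eqv_refl[OF vloop_mor[OF z r(1)]] pos[of "nat (- q)"]] unfolding e .
    moreover have "vloop l z \<odot> vloop (- l) z = unit z"
      unfolding vloop_mult[OF z r(1)] by (simp add: v0)
    ultimately show ?thesis
      using unit_right[OF vloop_mor[OF z r(1)]] eqv_sym by simp
  qed
qed

text \<open>
  The comparison of \<open>z\<close> with \<open>A z\<close>, with respect to a cell that contains \<open>z\<close>. The point \<open>A z\<close> itself need
  not be in the cell, and it may be impossible to reach it vertically; but it is in the cell after the
  translation by \<open>- \<sigma>\<close>, which is a group element.
\<close>

definition \<theta> :: "int \<Rightarrow> int \<Rightarrow> plane \<Rightarrow> (plane \<Rightarrow> plane) \<times> (real \<Rightarrow> plane) set"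
  where "\<theta> k j z = local_arrow (cell k j) (vshift (- \<sigma> k j)) z (A z)"

lemma shift_A_cell: "z \<in> cell k j \<Longrightarrow> vshift (- \<sigma> k j) (A z) \<in> cell k j"
  using A_cell[of k j] vshift_cell[of "- \<sigma> k j" k "j + \<sigma> k j"] by fastforce

lemma \<theta>_mor: "z \<in> cell k j \<Longrightarrow> \<theta> k j z \<in> mor z (A z)"
  unfolding \<theta>_def using dvd_\<sigma>(2)[of k j]
  by (intro local_arrow_mor chart_cell shift_A_cell vshift_mem) auto

text \<open>
  The heart of the matter: two cells that contain \<open>z\<close> give comparisons that differ by the vertical loop
  whose length is the difference of the two displacements, and \<open>m\<close> divides it.
\<close>

lemma \<theta>_indep:
  assumes z: "z \<in> cell k j" "z \<in> cell k' j'" shows "eqv z (A z) (\<theta> k j z) (\<theta> k' j' z)"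
proof (cases "(k, j) = (k', j')")
  case True then show ?thesis using \<theta>_mor[OF z(1)] eqv_refl by simp
next
  case False
  then have ni: "across z \<notin> \<int>" by (rule cell_overlap[OF z])
  let ?S = "strip \<lfloor>across z\<rfloor>"
  have zS: "z \<in> ?S" "A z \<in> ?S" using ni by (auto simp: in_strip_iff)
  have t: "\<theta> k j z = local_arrow ?S (vshift (- \<sigma> k j)) z (A z)"
    unfolding \<theta>_def using strip_of_cell(2)[OF z(1) ni] zS
    by (intro local_arrow_subset[symmetric] chart_strip chart_cell vshift_in_strip)
  have t': "\<theta> k' j' z = local_arrow ?S (vshift (- \<sigma> k' j')) z (A z)"
    unfolding \<theta>_def using strip_of_cell(2)[OF z(2) ni] zS
    by (intro local_arrow_subset[symmetric] chart_strip chart_cell vshift_in_strip)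
  let ?l = "\<sigma> k' j' - \<sigma> k j"
  have l: "m dvd ?l" "\<rho> dvd ?l" using dvd_\<sigma> by auto
  have "vloop ?l z \<odot> \<theta> k' j' z = local_arrow ?S (vshift ?l \<circ> vshift (- \<sigma> k' j')) z (A z)"
    unfolding t' vloop_eq[OF zS(1)] using zS l vshift_strip
    by (intro local_arrow_mult chart_strip vshift_mem vshift_in_strip)
  then have e: "vloop ?l z \<odot> \<theta> k' j' z = \<theta> k j z" unfolding t vshift_comp by simp
  have "eqv z (A z) (vloop ?l z \<odot> \<theta> k' j' z) (unit z \<odot> \<theta> k' j' z)"
    by (rule eqv_mult[OF vloop_null_dvd[OF zS(1) l(1)] eqv_refl[OF \<theta>_mor[OF z(2)]]])
  then show ?thesis unfolding e unit_left[OF \<theta>_mor[OF z(2)]] .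
qed

text \<open>
  Inside one cell naturality holds on the nose: both sides are arrows in the cell with the same end
  points, and their group elements agree because \<open>\<gamma>\<close> carries the cell \<open>(k', j')\<close> to the cell \<open>(k, j)\<close> and
  the displacements \<open>\<sigma>\<close> accordingly.
\<close>

lemma \<theta>_natural_local:
  assumes g: "\<gamma> \<in> affine_maps \<rho>" and z: "z \<in> cell k j" "\<gamma> w \<in> cell k j"
  shows "\<exists>k' j'. w \<in> cell k' j' \<and>
    \<theta> k j z \<odot> transport (local_arrow (cell k j) \<gamma> z w) = local_arrow (cell k j) \<gamma> z w \<odot> \<theta> k' j' w"
proof -
  obtain e i l where e: "e = 1 \<or> e = -1" "\<rho> dvd i" "\<rho> dvd l"
    "\<And>z. across (\<gamma> z) = of_int e * across z + of_int i" "\<And>z. along (\<gamma> z) = of_int e * along z + of_int l"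
    using affine_maps_coords[OF g] by metis
  \<comment> \<open>the preimage of the cell under \<open>\<gamma>\<close>; a rotation exchanges the two ends of the gap\<close>
  define k' where "k' = (if e = 1 then k - i else i - k)"
  define j' where "j' = (if e = 1 then j - l else l - j - 1)"
  have iff: "y \<in> cell k' j' \<longleftrightarrow> \<gamma> y \<in> cell k j" for y
    using e(1) unfolding cell_def k'_def j'_def by (auto simp: e(4,5))
  have w: "w \<in> cell k' j'" using iff z by simp
  have sub: "\<gamma> ` cell k' j' \<subseteq> cell k j" using iff by auto
  let ?\<tau> = "vshift (- \<sigma> k j)" and ?\<tau>' = "vshift (- \<sigma> k' j')"
  have \<tau>: "?\<tau> \<in> affine_maps \<rho>" "?\<tau>' \<in> affine_maps \<rho>" using dvd_\<sigma>(2) by (auto intro!: vshift_mem)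
  have "transport (local_arrow (cell k j) \<gamma> z w) = local_arrow (cell k (j + \<sigma> k j)) (A \<circ> \<gamma> \<circ> A') (A z) (A w)"
    using z A_cell by (intro transport_local_arrow chart_cell)
  then have "\<theta> k j z \<odot> transport (local_arrow (cell k j) \<gamma> z w)
      = local_arrow (cell k j) (?\<tau> \<circ> (A \<circ> \<gamma> \<circ> A')) z (A w)"
    unfolding \<theta>_def using z A_cell vshift_cell[of "- \<sigma> k j" k "j + \<sigma> k j"]
    by (simp only:) (intro local_arrow_mult chart_cell \<tau> shift_A_cell; auto)
  also have "?\<tau> \<circ> (A \<circ> \<gamma> \<circ> A') = \<gamma> \<circ> ?\<tau>'"
    by (rule ext, rule coords_eqI)
      (use e(1) sign in \<open>auto simp: e(4,5) \<sigma>_def k'_def j'_def algebra_simps\<close>)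
  also have "local_arrow (cell k j) (\<gamma> \<circ> ?\<tau>') z (A w) = local_arrow (cell k j) \<gamma> z w \<odot> \<theta> k' j' w"
    unfolding \<theta>_def using z g w sub
    by (intro local_arrow_mult[symmetric] chart_cell shift_A_cell)
  finally show ?thesis using w by blast
qed

lemma \<theta>_natural:
  assumes "x \<in> mor z w" "z \<in> cell k j" "w \<in> cell k' j'"
  shows "eqv z (A w) (\<theta> k j z \<odot> transport x) (x \<odot> \<theta> k' j' w)"
proof -
  define P where "P z w x \<longleftrightarrow> (\<forall>k j k' j'. z \<in> cell k j \<longrightarrow> w \<in> cell k' j' \<longrightarrow>
    eqv z (A w) (\<theta> k j z \<odot> transport x) (x \<odot> \<theta> k' j' w))" for z w x
  have "P z w x"
  proof (rule mor_induct[where \<Y>="range (case_prod cell)", OF assms(1)])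
    fix Y assume "Y \<in> range (case_prod cell)" then show "chart Y \<and> open Y"
      using chart_cell open_cell by auto
  next
    show "punctured_plane \<subseteq> \<Union> (range (case_prod cell))" by (rule cover_cells)
  next
    fix Y \<gamma> z w assume Y: "Y \<in> range (case_prod cell)" and g: "\<gamma> \<in> affine_maps \<rho>" and z: "z \<in> Y" "\<gamma> w \<in> Y"
    obtain k j where kj: "Y = cell k j" using Y by auto
    have L: "local_arrow Y \<gamma> z w \<in> mor z w" unfolding kj using z kj g by (intro local_arrow_mor chart_cell) auto
    obtain k' j' where w: "w \<in> cell k' j'"
      and e: "\<theta> k j z \<odot> transport (local_arrow Y \<gamma> z w) = local_arrow Y \<gamma> z w \<odot> \<theta> k' j' w"
      using \<theta>_natural_local[OF g] z unfolding kj by blast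
    show "P z w (local_arrow Y \<gamma> z w)" unfolding P_def
    proof (intro allI impI)
      fix k1 j1 k2 j2 assume z1: "z \<in> cell k1 j1" and w2: "w \<in> cell k2 j2"
      have "eqv z (A w) (\<theta> k1 j1 z \<odot> transport (local_arrow Y \<gamma> z w)) (\<theta> k j z \<odot> transport (local_arrow Y \<gamma> z w))"
        using z kj by (intro eqv_mult[OF \<theta>_indep[OF z1] eqv_refl[OF transport_mor[OF L]]]) auto
      also have "eqv z (A w) \<dots> (local_arrow Y \<gamma> z w \<odot> \<theta> k2 j2 w)"
        unfolding e by (rule eqv_mult[OF eqv_refl[OF L] \<theta>_indep[OF w w2]])
      finally show "eqv z (A w) (\<theta> k1 j1 z \<odot> transport (local_arrow Y \<gamma> z w)) (local_arrow Y \<gamma> z w \<odot> \<theta> k2 j2 w)" .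
    qed
  next
    fix x y z w t assume x: "x \<in> mor z w" and y: "y \<in> mor w t" and P: "P z w x" "P w t y"
    have "w \<in> punctured_plane" using y by (rule mor_source)
    then obtain k0 j0 where w: "w \<in> cell k0 j0" using cover_cells by auto
    show "P z t (x \<odot> y)" unfolding P_def
    proof (intro allI impI)
      fix k1 j1 k2 j2 assume z1: "z \<in> cell k1 j1" and t2: "t \<in> cell k2 j2"
      note m = \<theta>_mor[OF z1] \<theta>_mor[OF w] \<theta>_mor[OF t2] transport_mor[OF x] transport_mor[OF y]
      have "\<theta> k1 j1 z \<odot> transport (x \<odot> y) = \<theta> k1 j1 z \<odot> transport x \<odot> transport y"
        unfolding transport_mult[OF x y] by (rule mult_assoc[symmetric, OF m(1,4,5)])
      also have "eqv z (A t) \<dots> (x \<odot> \<theta> k0 j0 w \<odot> transport y)"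
        using P(1) z1 w unfolding P_def by (intro eqv_mult[OF _ eqv_refl[OF m(5)]]) auto
      also have "x \<odot> \<theta> k0 j0 w \<odot> transport y = x \<odot> (\<theta> k0 j0 w \<odot> transport y)"
        by (rule mult_assoc[OF x m(2,5)])
      also have "eqv z (A t) \<dots> (x \<odot> (y \<odot> \<theta> k2 j2 t))"
        using P(2) w t2 unfolding P_def by (intro eqv_mult[OF eqv_refl[OF x]]) auto
      also have "x \<odot> (y \<odot> \<theta> k2 j2 t) = x \<odot> y \<odot> \<theta> k2 j2 t"
        by (rule mult_assoc[symmetric, OF x y m(3)])
      finally show "eqv z (A t) (\<theta> k1 j1 z \<odot> transport (x \<odot> y)) (x \<odot> y \<odot> \<theta> k2 j2 t)" .
    qed
  qed
  then show ?thesis using assms unfolding P_def by blast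
qed

text \<open>
  Conjugation with \<open>\<theta>\<close> is the change of base point from \<open>A b\<close> back to \<open>b\<close>.
\<close>

lemma coset_transport:
  obtains t t' where "t \<in> mor b (A b)" "t' \<in> mor (A b) b" "t \<odot> t' = unit b" "t' \<odot> t = unit (A b)"
    "\<And>x. x \<in> mor b b \<Longrightarrow> N #>\<^bsub>G\<^esub> (t \<odot> transport x \<odot> t') = N #>\<^bsub>G\<^esub> x"
proof -
  obtain k j where b: "b \<in> cell k j" using base cover_cells by auto
  let ?t = "\<theta> k j b"
  have t: "?t \<in> mor b (A b)" by (rule \<theta>_mor[OF b])
  obtain t' where t': "t' \<in> mor (A b) b" "?t \<odot> t' = unit b" "t' \<odot> ?t = unit (A b)"
    using mor_inverse[OF t] by blast
  have "N #>\<^bsub>G\<^esub> (?t \<odot> transport x \<odot> t') = N #>\<^bsub>G\<^esub> x" if x: "x \<in> mor b b" for x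
  proof -
    have "eqv b b (?t \<odot> transport x \<odot> t') (x \<odot> ?t \<odot> t')"
      by (rule eqv_mult[OF \<theta>_natural[OF x b b] eqv_refl[OF t'(1)]])
    also have "x \<odot> ?t \<odot> t' = x"
      using mult_assoc[OF x t t'(1)] t'(2) unit_right[OF x] by simp
    finally show ?thesis by (rule eqv_coset)
  qed
  with t t' show ?thesis using that by blast
qed

end

section \<open>Slopes and integral vectors\<close>

definition cross :: "int \<times> int \<Rightarrow> int \<times> int \<Rightarrow> int"
  where "cross x y = fst x * snd y - snd x * fst y"

definition primitive :: "int \<times> int \<Rightarrow> bool"
  where "primitive x \<longleftrightarrow> coprime (fst x) (snd x)"

fun int_vec :: "qhat \<Rightarrow> int \<times> int" where
  "int_vec (Fin s) = (snd (quotient_of s), fst (quotient_of s))"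
| "int_vec Infty = (0, 1)"

lemma slope_vector_int_vec: "slope_vector s = (of_int (fst (int_vec s)), of_int (snd (int_vec s)))"
  by (cases s) (auto split: prod.split)

lemma primitive_int_vec: "primitive (int_vec s)"
  by (cases s) (auto simp: primitive_def coprime_commute intro: quotient_of_coprime prod.collapse)

lemma primitive_iff: "primitive x \<longleftrightarrow> (\<exists>y. cross x y = 1)"
proof
  assume "primitive x"
  then obtain a b where "fst x * a + snd x * b = 1"
    unfolding primitive_def using bezout_int[of "fst x" "snd x"] by (metis coprime_imp_gcd_eq_1 mult.commute)
  then have "cross x (- b, a) = 1" by (simp add: cross_def)
  then show "\<exists>y. cross x y = 1" by blast
next
  assume "\<exists>y. cross x y = 1"
  then obtain y where y: "fst x * snd y - snd x * fst y = 1" by (auto simp: cross_def)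
  show "primitive x" unfolding primitive_def
  proof (rule coprimeI)
    fix c assume "c dvd fst x" "c dvd snd x"
    then have "c dvd fst x * snd y - snd x * fst y" by simp
    then show "is_unit c" unfolding y by simp
  qed
qed

lemma primitive_cross: "\<bar>cross x y\<bar> = 1 \<Longrightarrow> primitive x" "\<bar>cross x y\<bar> = 1 \<Longrightarrow> primitive y"
proof -
  assume "\<bar>cross x y\<bar> = 1"
  then have "cross x y = 1 \<or> cross x (- fst y, - snd y) = 1" "cross y x = 1 \<or> cross y (- fst x, - snd x) = 1"
    by (auto simp: cross_def abs_if algebra_simps split: if_splits)
  then show "primitive x" "primitive y" unfolding primitive_iff by blast+
qed

lemma cross_self [simp]: "cross x x = 0"
  by (simp add: cross_def)

lemma cross_swap: "cross y x = - cross x y"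
  by (simp add: cross_def)

text \<open>
  The factor of proportionality is an integer because of \<open>primitive_iff\<close>, and a unit because \<open>y\<close> is
  primitive as well.
\<close>

lemma primitive_parallel:
  assumes "primitive x" "primitive y" "cross x y = 0"
  shows "y = x \<or> y = (- fst x, - snd x)"
proof -
  obtain w where w: "cross x w = 1" using assms(1) primitive_iff by blast
  define k where "k = cross y w"
  have z: "fst x * snd y = snd x * fst y" and w': "fst x * snd w - snd x * fst w = 1"
    using assms(3) w by (simp_all add: cross_def)
  have "k * fst x = fst x * fst y * snd w - fst w * (fst x * snd y)"
    by (simp add: k_def cross_def algebra_simps)
  also have "\<dots> = fst y * (fst x * snd w - snd x * fst w)" unfolding z by (simp add: algebra_simps)
  finally have 1: "fst y = k * fst x" by (simp add: w')
  have "k * snd x = snd w * (snd x * fst y) - snd x * snd y * fst w"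
    by (simp add: k_def cross_def algebra_simps)
  also have "\<dots> = snd y * (fst x * snd w - snd x * fst w)" unfolding z[symmetric] by (simp add: algebra_simps)
  finally have 2: "snd y = k * snd x" by (simp add: w')
  have "is_unit k" using assms(2) 1 2 unfolding primitive_def
    by (metis coprime_common_divisor dvd_triv_left)
  then have "k = 1 \<or> k = -1" by auto
  then show ?thesis using 1 2 by (auto simp: prod_eq_iff)
qed

lemma int_vec_parallel:
  assumes "cross (int_vec s) (int_vec t) = 0" shows "s = t"
proof -
  have p: "int_vec t = int_vec s \<or> int_vec t = (- fst (int_vec s), - snd (int_vec s))"
    by (rule primitive_parallel[OF primitive_int_vec primitive_int_vec assms])
  show ?thesis
  proof (cases s)
    case Infty
    show ?thesis
    proof (cases t)
      case (Fin x)
      then show ?thesis using p Infty quotient_of_denom_pos'[of x] by (auto simp: prod_eq_iff)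
    qed (simp add: Infty)
  next
    case (Fin x)
    have x: "snd (quotient_of x) > 0" by (rule quotient_of_denom_pos')
    show ?thesis
    proof (cases t)
      case (Fin y)
      have "snd (quotient_of y) > 0" by (rule quotient_of_denom_pos')
      then have "quotient_of x = quotient_of y" using p x Fin \<open>s = _\<close> by (auto simp: prod_eq_iff)
      then show ?thesis using Fin \<open>s = _\<close> quotient_of_inject by simp
    next
      case Infty then show ?thesis using p x \<open>s = _\<close> by auto
    qed
  qed
qed

text \<open>
  The slope of a non-zero integral vector. It only depends on the line spanned by the vector, while
  \<open>int_vec\<close> chooses one of its two primitive vectors; hence the signs in \<open>int_vec_slope_of\<close>.
\<close>

definition slope_of :: "int \<times> int \<Rightarrow> qhat"
  where "slope_of x = (if fst x = 0 then Infty else Fin (Fract (snd x) (fst x)))"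

lemma Fract_quotient: "x = of_int (fst (quotient_of x)) / of_int (snd (quotient_of x))"
  by (rule quotient_of_div) simp

lemma cross_slope_of: "cross (int_vec (slope_of x)) x = 0"
proof (cases "fst x = 0")
  case True then show ?thesis by (simp add: slope_of_def cross_def)
next
  case False
  let ?r = "Fract (snd x) (fst x)"
  have "Fract (fst (quotient_of ?r)) (snd (quotient_of ?r)) = Fract (snd x) (fst x)"
    using Fract_quotient[of ?r] by (simp only: Fract_of_int_quotient)
  then have "fst (quotient_of ?r) * fst x = snd x * snd (quotient_of ?r)"
    using False quotient_of_denom_pos'[of ?r] by (subst (asm) eq_rat(1)) auto
  then show ?thesis
    using False by (simp add: slope_of_def cross_def algebra_simps)
qed

lemma int_vec_slope_of: "primitive x \<Longrightarrow> int_vec (slope_of x) = x \<or> int_vec (slope_of x) = (- fst x, - snd x)"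
  using primitive_parallel[OF _ primitive_int_vec, of x "slope_of x"] cross_slope_of[of x] by (simp add: cross_swap[of x])

lemma slope_of_int_vec [simp]: "slope_of (int_vec s) = s"
  by (rule int_vec_parallel) (rule cross_slope_of)

lemma slope_ofI: "primitive x \<Longrightarrow> cross (int_vec s) x = 0 \<Longrightarrow> slope_of x = s"
  using int_vec_slope_of[of x] by (intro int_vec_parallel) (auto simp: cross_def algebra_simps)

lemma abs_cross_slope_of:
  "primitive x \<Longrightarrow> \<bar>cross (int_vec (slope_of x)) y\<bar> = \<bar>cross x y\<bar>"
  "primitive x \<Longrightarrow> \<bar>cross y (int_vec (slope_of x))\<bar> = \<bar>cross y x\<bar>"
  using int_vec_slope_of[of x] by (auto simp: cross_def)

section \<open>The Farey tessellation\<close>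

text \<open>
  The arithmetic description of the edges of the tessellation.
\<close>

definition adj :: "qhat \<Rightarrow> qhat \<Rightarrow> bool"
  where "adj a b \<longleftrightarrow> \<bar>cross (int_vec a) (int_vec b)\<bar> = 1"

lemma adj_sym: "adj a b \<longleftrightarrow> adj b a"
  unfolding adj_def by (subst cross_swap) simp

lemma adj_irrefl: "\<not> adj a a"
  by (simp add: adj_def)

lemma pluecker: "cross a b * cross c d = cross a c * cross b d - cross a d * cross b c"
  by (simp add: cross_def algebra_simps)

lemma sign_product:
  fixes p q r s :: int
  assumes "\<bar>p\<bar> = 1" "\<bar>q\<bar> = 1" "\<bar>r\<bar> = 1" "\<bar>s\<bar> = 1"
  shows "p * q = 1 \<or> p * q = -1" "p * q = r * s \<Longrightarrow> p * s - r * q = 0"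
proof -
  have "p = 1 \<or> p = -1" "q = 1 \<or> q = -1" "r = 1 \<or> r = -1" "s = 1 \<or> s = -1" using assms by arith+
  then show "p * q = 1 \<or> p * q = -1" "p * q = r * s \<Longrightarrow> p * s - r * q = 0"
    by (elim disjE; simp)+
qed

text \<open>
  If \<open>a\<close> and \<open>b\<close> are neighbours, the third vertex of a triangle over this edge is the slope of \<open>a + b\<close> or of
  \<open>a - b\<close>. The two are told apart by the sign of \<open>cross a x * cross b x\<close>, and the Pluecker relation shows that
  vertices with the same sign are parallel.
\<close>

lemma third_vertex_unique:
  assumes ab: "adj a b" and c: "adj a c" "adj b c" and d: "adj a d" "adj b d" and e: "adj a e" "adj b e"
    and ne: "c \<noteq> d" "c \<noteq> e"
  shows "d = e"
proof -
  have *: "x = y" if "cross (int_vec a) (int_vec x) * cross (int_vec b) (int_vec x) = cross (int_vec a) (int_vec y) * cross (int_vec b) (int_vec y)"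
    and x: "adj a x" "adj b x" and y: "adj a y" "adj b y" for x y
  proof -
    have "cross (int_vec a) (int_vec b) * cross (int_vec x) (int_vec y) = 0"
      by (subst pluecker, rule sign_product(2)[OF _ _ _ _ that(1)]) (use x y in \<open>simp_all add: adj_def\<close>)
    then have "cross (int_vec x) (int_vec y) = 0" using ab by (auto simp: adj_def)
    then show ?thesis by (rule int_vec_parallel)
  qed
  have pm: "cross (int_vec a) (int_vec x) * cross (int_vec b) (int_vec x) = 1 \<or> cross (int_vec a) (int_vec x) * cross (int_vec b) (int_vec x) = -1"
    if "adj a x" "adj b x" for x
    using that sign_product(1) unfolding adj_def by blast
  show ?thesis using *[OF _ c d] *[OF _ c e] *[OF _ d e] pm[OF c] pm[OF d] pm[OF e] ne by metis
qed

lemma reflect_fixes: "a \<noteq> b \<Longrightarrow> reflect a b a = a" "a \<noteq> b \<Longrightarrow> reflect a b b = b"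
  by (cases a; cases b; auto simp: power2_eq_square field_simps)+

text \<open>
  The formula for \<open>reflect\<close> is rational in the slopes; computations with it are done with these vectors
  and carried over to the integral vectors by homogeneity.
\<close>

fun rat_vec :: "qhat \<Rightarrow> rat \<times> rat" where
  "rat_vec (Fin s) = (1, s)"
| "rat_vec Infty = (0, 1)"

lemma int_vec_rat_vec: "\<exists>k::rat. k \<noteq> 0 \<and> of_int (fst (int_vec s)) = k * fst (rat_vec s) \<and> of_int (snd (int_vec s)) = k * snd (rat_vec s)"
proof (cases s)
  case (Fin x)
  have "snd (quotient_of x) > 0" by (rule quotient_of_denom_pos')
  then show ?thesis using Fract_quotient[of x] Fin
    by (intro exI[of _ "of_int (snd (quotient_of x))"]) (auto simp: field_simps)
next
  case Infty
  then show ?thesis by (intro exI[of _ 1]) auto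
qed

text \<open>
  Up to the factor \<open>cross a b\<close>, the image of \<open>c\<close> under the linear map that fixes \<open>a\<close> and negates \<open>b\<close>. On
  slopes this is the reflection in the edge from \<open>a\<close> to \<open>b\<close>.
\<close>

definition mirror :: "int \<times> int \<Rightarrow> int \<times> int \<Rightarrow> int \<times> int \<Rightarrow> int \<times> int"
  where "mirror a b c = (cross c b * fst a - cross a c * fst b, cross c b * snd a - cross a c * snd b)"

lemma cross_reflect:
  assumes "a \<noteq> b"
  shows "cross (int_vec (reflect a b c)) (mirror (int_vec a) (int_vec b) (int_vec c)) = 0"
proof -
  obtain ka where ka: "ka \<noteq> 0" "of_int (fst (int_vec a)) = ka * fst (rat_vec a)" "of_int (snd (int_vec a)) = ka * snd (rat_vec a)"
    using int_vec_rat_vec by blast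
  obtain kb where kb: "kb \<noteq> 0" "of_int (fst (int_vec b)) = kb * fst (rat_vec b)" "of_int (snd (int_vec b)) = kb * snd (rat_vec b)"
    using int_vec_rat_vec by blast
  obtain kc where kc: "kc \<noteq> 0" "of_int (fst (int_vec c)) = kc * fst (rat_vec c)" "of_int (snd (int_vec c)) = kc * snd (rat_vec c)"
    using int_vec_rat_vec by blast
  let ?d = "reflect a b c"
  obtain kd where kd: "kd \<noteq> 0" "of_int (fst (int_vec ?d)) = kd * fst (rat_vec ?d)" "of_int (snd (int_vec ?d)) = kd * snd (rat_vec ?d)"
    using int_vec_rat_vec by blast
  define rc :: "rat \<times> rat \<Rightarrow> rat \<times> rat \<Rightarrow> rat" where "rc x y = fst x * snd y - snd x * fst y" for x y
  let ?W = "(rc (rat_vec c) (rat_vec b) * fst (rat_vec a) - rc (rat_vec a) (rat_vec c) * fst (rat_vec b),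
             rc (rat_vec c) (rat_vec b) * snd (rat_vec a) - rc (rat_vec a) (rat_vec c) * snd (rat_vec b))"
  have W: "rc (rat_vec ?d) ?W = 0"
    using assms
    by (cases a; cases b; cases c) (auto simp: rc_def power2_eq_square divide_simps, auto simp: algebra_simps)
  have "(of_int (cross (int_vec ?d) (mirror (int_vec a) (int_vec b) (int_vec c))) :: rat) = kd * kc * kb * ka * rc (rat_vec ?d) ?W"
    unfolding cross_def mirror_def of_int_diff of_int_mult fst_conv snd_conv ka kb kc kd rc_def
    by (simp add: algebra_simps)
  then show ?thesis using W by simp
qed

text \<open>
  Reflection in an edge of a triangle leads to the triangle on the other side of this edge.
\<close>

lemma reflect_adj:
  assumes ab: "adj a b" and ac: "adj a c" and bc: "adj b c"
  shows "adj a (reflect a b c)" "adj b (reflect a b c)" "reflect a b c \<noteq> c"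
proof -
  let ?w = "mirror (int_vec a) (int_vec b) (int_vec c)"
  have "a \<noteq> b" using ab adj_irrefl by auto
  have 1: "cross (int_vec a) ?w = - cross (int_vec a) (int_vec c) * cross (int_vec a) (int_vec b)"
    "cross (int_vec b) ?w = - cross (int_vec c) (int_vec b) * cross (int_vec a) (int_vec b)"
    "cross (int_vec c) ?w = 2 * cross (int_vec c) (int_vec b) * cross (int_vec c) (int_vec a)"
    by (simp_all add: cross_def mirror_def algebra_simps)
  have 2: "\<bar>cross (int_vec c) (int_vec b)\<bar> = 1" "\<bar>cross (int_vec c) (int_vec a)\<bar> = 1"
    using ac bc adj_sym unfolding adj_def by metis+
  have w: "primitive ?w" using primitive_cross(2)[of "int_vec a" ?w] ac ab unfolding 1 abs_mult by (simp add: adj_def)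
  then have s: "slope_of ?w = reflect a b c" using slope_ofI cross_reflect[OF \<open>a \<noteq> b\<close>] by blast
  show "adj a (reflect a b c)" "adj b (reflect a b c)"
    unfolding adj_def s[symmetric] abs_cross_slope_of[OF w] 1 abs_mult using ab ac 2 by (simp_all add: adj_def)
  have "\<bar>cross (int_vec c) (int_vec (reflect a b c))\<bar> = 2"
    unfolding s[symmetric] abs_cross_slope_of[OF w] 1 abs_mult using 2 by simp
  then show "reflect a b c \<noteq> c" by auto
qed

definition triangle :: "qhat set \<Rightarrow> bool"
  where "triangle T \<longleftrightarrow> card T = 3 \<and> (\<forall>x\<in>T. \<forall>y\<in>T. x \<noteq> y \<longrightarrow> adj x y)"

lemma triangleI: "adj a b \<Longrightarrow> adj a c \<Longrightarrow> adj b c \<Longrightarrow> triangle {a, b, c}"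
  unfolding triangle_def using adj_irrefl adj_sym by (auto simp: card_insert_if)

lemma triangle_third:
  assumes "triangle T" "a \<in> T" "b \<in> T" "a \<noteq> b"
  obtains c where "T = {a, b, c}" "adj a b" "adj a c" "adj b c"
proof -
  have f: "finite T" "card T = 3" using assms(1) by (auto simp: triangle_def intro: card_ge_0_finite)
  have "card (T - {a, b}) = 1" using f assms by (simp add: card_Diff_subset)
  then obtain c where c: "T - {a, b} = {c}" by (auto simp: card_1_singleton_iff)
  then have "T = {a, b, c}" "c \<noteq> a" "c \<noteq> b" using assms by auto
  moreover from this have "adj a b" "adj a c" "adj b c" using assms unfolding triangle_def by auto
  ultimately show ?thesis using that by blast
qed

lemma farey_triangle: "T \<in> farey_triangles \<Longrightarrow> triangle T"
proof (induction rule: farey_triangles.induct)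
  case base
  show ?case by (rule triangleI) (simp_all add: adj_def cross_def)
next
  case (reflection T a b)
  obtain c where c: "T = {a, b, c}" "adj a b" "adj a c" "adj b c"
    using triangle_third[OF reflection(5,2-4)] .
  have "reflect a b ` T = {a, b, reflect a b c}"
    unfolding c(1) using reflect_fixes[OF reflection(4)] by simp
  then show ?case using c reflect_adj[OF c(2-4)] by (auto intro: triangleI)
qed

lemma farey_reflect:
  assumes "{a, b, c} \<in> farey_triangles" "a \<noteq> b"
  shows "{a, b, reflect a b c} \<in> farey_triangles"
  using farey_triangles.reflection[OF assms(1), of a b] assms(2) reflect_fixes[OF assms(2)] by simp

lemma farey_adj: "T \<in> farey_triangles \<Longrightarrow> a \<in> T \<Longrightarrow> b \<in> T \<Longrightarrow> a \<noteq> b \<Longrightarrow> adj a b"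
  using farey_triangle unfolding triangle_def by blast

lemma farey_edge_adj: "farey_edge a b \<Longrightarrow> adj a b"
  using farey_adj unfolding farey_edge_def by blast

lemma farey_edge_Infty: "farey_edge (Fin a) Infty \<Longrightarrow> a \<in> \<int>"
proof -
  assume "farey_edge (Fin a) Infty"
  then have "snd (quotient_of a) = 1"
    using farey_edge_adj quotient_of_denom_pos'[of a] by (force simp: adj_def cross_def)
  then show ?thesis using Fract_quotient[of a] by (metis Ints_of_int div_by_1 of_int_1)
qed

text \<open>
  The two properties of an integral matrix of determinant \<open>\<plusminus>1\<close> that give an action on slopes which respects
  the tessellation; opposite vectors have the same slope.
\<close>

definition unimodular :: "(int \<times> int \<Rightarrow> int \<times> int) \<Rightarrow> bool"
  where "unimodular L \<longleftrightarrow> (\<exists>\<delta>. \<bar>\<delta>\<bar> = 1 \<and> (\<forall>x y. cross (L x) (L y) = \<delta> * cross x y))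
    \<and> (\<forall>x. L (- fst x, - snd x) = (- fst (L x), - snd (L x)))"

definition act :: "(int \<times> int \<Rightarrow> int \<times> int) \<Rightarrow> qhat \<Rightarrow> qhat"
  where "act L s = slope_of (L (int_vec s))"

lemma unimodular_abs_cross: "unimodular L \<Longrightarrow> \<bar>cross (L x) (L y)\<bar> = \<bar>cross x y\<bar>"
  unfolding unimodular_def by (metis abs_mult mult_1)

lemma unimodular_primitive: "unimodular L \<Longrightarrow> primitive x \<Longrightarrow> primitive (L x)"
  unfolding primitive_iff[of x] using unimodular_abs_cross primitive_cross(1) by (metis abs_1)

lemma abs_cross_act: "unimodular L \<Longrightarrow> \<bar>cross (int_vec (act L s)) (int_vec (act L t))\<bar> = \<bar>cross (int_vec s) (int_vec t)\<bar>"
  unfolding act_def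
  by (simp add: abs_cross_slope_of unimodular_primitive primitive_int_vec unimodular_abs_cross)

lemma adj_act: "unimodular L \<Longrightarrow> adj (act L a) (act L b) \<longleftrightarrow> adj a b"
  by (simp add: adj_def abs_cross_act)

lemma act_inj: "unimodular L \<Longrightarrow> act L s = act L t \<Longrightarrow> s = t"
  using abs_cross_act[of L s t] int_vec_parallel[of s t] by simp

lemma act_slope_of:
  assumes "unimodular L" "primitive x" shows "act L (slope_of x) = slope_of (L x)"
proof -
  have L: "L (- fst x, - snd x) = (- fst (L x), - snd (L x))" using assms(1) unfolding unimodular_def by blast
  have "slope_of (- fst y, - snd y) = slope_of y" for y
    by (auto simp: slope_of_def eq_rat)
  then show ?thesis unfolding act_def using int_vec_slope_of[OF assms(2)] L by auto
qed

text \<open>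
  The inductive definition of the triangles is by reflections, and a unimodular map commutes with
  them: it carries the two triangles over an edge to the two triangles over the image edge.
\<close>

lemma farey_act:
  assumes L: "unimodular L" and base: "act L ` {Fin 0, Fin 1, Infty} \<in> farey_triangles"
  shows "T \<in> farey_triangles \<Longrightarrow> act L ` T \<in> farey_triangles"
proof (induction rule: farey_triangles.induct)
  case base then show ?case by (rule assms(2))
next
  case (reflection T a b)
  obtain c where c: "T = {a, b, c}" "adj a b" "adj a c" "adj b c"
    using triangle_third[OF farey_triangle[OF reflection(1)] reflection(2-4)] .
  let ?c = "reflect a b c"
  note r = reflect_adj[OF c(2-4)]
  have a: "adj (act L a) (act L b)" "adj (act L a) (act L c)" "adj (act L b) (act L c)"
    "adj (act L a) (act L ?c)" "adj (act L b) (act L ?c)"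
    using c r by (simp_all add: adj_act[OF L])
  have ne: "act L c \<noteq> act L ?c" using r act_inj[OF L] by metis
  have "act L ?c = reflect (act L a) (act L b) (act L c)"
    by (rule third_vertex_unique[OF a(1-5)]) (use reflect_adj[OF a(1-3)] ne in auto)
  moreover have "{act L a, act L b, reflect (act L a) (act L b) (act L c)} \<in> farey_triangles"
    proof (rule farey_reflect)
    show "{act L a, act L b, act L c} \<in> farey_triangles" using reflection(5) unfolding c(1) by simp
    show "act L a \<noteq> act L b" using a(1) adj_irrefl by metis
  qed
  ultimately show ?case
    unfolding c(1) using reflect_fixes[OF reflection(4)] by simp
qed

text \<open>
  The Euclidean algorithm: the set of vertices is invariant under \<open>s \<mapsto> -s\<close>, \<open>s \<mapsto> 1 / s\<close> and \<open>s \<mapsto> s + 1\<close>.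
\<close>

lemma farey_vertex: "\<exists>T\<in>farey_triangles. s \<in> T"
proof -
  define V where "V = \<Union> farey_triangles"
  have V: "act L s \<in> V" if "unimodular L" "act L ` {Fin 0, Fin 1, Infty} \<in> farey_triangles" "s \<in> V" for L s
    using farey_act[OF that(1,2)] that(3) unfolding V_def by blast
  define neg :: "int \<times> int \<Rightarrow> int \<times> int" where "neg x = (fst x, - snd x)" for x
  define swap :: "int \<times> int \<Rightarrow> int \<times> int" where "swap x = (snd x, fst x)" for x
  define add :: "int \<times> int \<Rightarrow> int \<times> int" where "add x = (fst x, snd x + fst x)" for x
  have u: "unimodular neg" "unimodular swap" "unimodular add"
  proof -
    show "unimodular neg" unfolding unimodular_def
      by (rule conjI, rule exI[of _ "-1"]) (simp_all add: neg_def cross_def)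
    show "unimodular swap" unfolding unimodular_def
      by (rule conjI, rule exI[of _ "-1"]) (simp_all add: swap_def cross_def algebra_simps)
    show "unimodular add" unfolding unimodular_def
      by (rule conjI, rule exI[of _ 1]) (simp_all add: add_def cross_def algebra_simps)
  qed
  have T0: "{Fin 0, Fin 1, Infty} \<in> farey_triangles" by (rule farey_triangles.base)
  have m: "act neg ` {Fin 0, Fin 1, Infty} \<in> farey_triangles"
    "act swap ` {Fin 0, Fin 1, Infty} \<in> farey_triangles" "act add ` {Fin 0, Fin 1, Infty} \<in> farey_triangles"
  proof -
    have "act neg ` {Fin 0, Fin 1, Infty} = {Fin 0, Infty, reflect (Fin 0) Infty (Fin 1)}"
      by (auto simp: act_def neg_def slope_of_def rat_number_collapse)
    moreover have "{Fin 0, Infty, reflect (Fin 0) Infty (Fin 1)} \<in> farey_triangles"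
      by (rule farey_reflect) (use T0 in \<open>auto simp: insert_commute\<close>)
    ultimately show "act neg ` {Fin 0, Fin 1, Infty} \<in> farey_triangles" by simp
    have "act swap ` {Fin 0, Fin 1, Infty} = {Fin 0, Fin 1, Infty}"
      by (auto simp: act_def swap_def slope_of_def rat_number_collapse)
    then show "act swap ` {Fin 0, Fin 1, Infty} \<in> farey_triangles" using T0 by simp
    have "act add ` {Fin 0, Fin 1, Infty} = {Fin 1, Infty, reflect (Fin 1) Infty (Fin 0)}"
      by (auto simp: act_def add_def slope_of_def rat_number_collapse)
    moreover have "{Fin 1, Infty, reflect (Fin 1) Infty (Fin 0)} \<in> farey_triangles"
      by (rule farey_reflect) (use T0 in \<open>auto simp: insert_commute\<close>)
    ultimately show "act add ` {Fin 0, Fin 1, Infty} \<in> farey_triangles" by simp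
  qed
  have T0V: "Fin 0 \<in> V" "Fin 1 \<in> V" "Infty \<in> V" using T0 unfolding V_def by blast+
  have pos: "slope_of (q, p) \<in> V" if "nat (p + q) = n" "0 \<le> p" "0 \<le> q" "coprime q p" for n p q
    using that
  proof (induction n arbitrary: p q rule: less_induct)
    case (less n)
    consider "q = 0" | "p = 0" | "0 < q" "q \<le> p" | "0 < p" "p < q" using less.prems by linarith
    then show ?case
    proof cases
      case 1 then show ?thesis using T0V by (simp add: slope_of_def)
    next
      case 2 then have "q = 1" using less.prems by simp
      then show ?thesis using T0V 2 by (simp add: slope_of_def rat_number_collapse)
    next
      case 3
      have c: "coprime q (p - q)" using less.prems(4) gcd_diff1[of p q] by (simp add: coprime_iff_gcd_eq_1 gcd.commute)
      have "slope_of (q, p - q) \<in> V" using less.prems 3 c by (intro less.IH[OF _ refl]) auto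
      then have "act add (slope_of (q, p - q)) \<in> V" by (intro V u m)
      then show ?thesis using c by (subst (asm) act_slope_of[OF u(3)]) (auto simp: primitive_def add_def)
    next
      case 4
      have c: "coprime p (q - p)" using less.prems(4) gcd_diff1[of q p] by (simp add: coprime_iff_gcd_eq_1 gcd.commute)
      have c': "coprime p q" using less.prems(4) by (simp add: coprime_commute)
      have "slope_of (p, q - p) \<in> V" using less.prems 4 c by (intro less.IH[OF _ refl]) auto
      then have "act add (slope_of (p, q - p)) \<in> V" by (intro V u m)
      then have "slope_of (p, q) \<in> V" using c by (subst (asm) act_slope_of[OF u(3)]) (auto simp: primitive_def add_def)
      then have "act swap (slope_of (p, q)) \<in> V" by (intro V u m)
      then show ?thesis using c' by (subst (asm) act_slope_of[OF u(2)]) (auto simp: primitive_def swap_def)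
    qed
  qed
  have "s \<in> V"
  proof (cases "0 \<le> snd (int_vec s)")
    case True
    have "0 \<le> fst (int_vec s)" by (cases s) (auto simp: less_imp_le quotient_of_denom_pos')
    then have "slope_of (fst (int_vec s), snd (int_vec s)) \<in> V"
      using True primitive_int_vec[of s] by (intro pos[OF refl]) (auto simp: primitive_def)
    then show ?thesis by simp
  next
    case False
    have "0 \<le> fst (int_vec s)" by (cases s) (auto simp: less_imp_le quotient_of_denom_pos')
    then have "slope_of (neg (int_vec s)) \<in> V"
      using False primitive_int_vec[of s] unfolding neg_def by (intro pos[OF refl]) (auto simp: primitive_def)
    then have "act neg (slope_of (neg (int_vec s))) \<in> V" by (intro V u m)
    then show ?thesis using primitive_int_vec[of s]
      by (subst (asm) act_slope_of[OF u(1)]) (auto simp: unimodular_primitive[OF u(1)], simp add: neg_def)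
  qed
  then show ?thesis unfolding V_def by blast
qed

lemma agree_across_edge:
  assumes f: "farey_automorphism f" and L: "unimodular L"
    and T: "{a, b, c} \<in> farey_triangles" "{a, b, c'} \<in> farey_triangles" "a \<noteq> b" "a \<noteq> c" "b \<noteq> c" "a \<noteq> c'" "b \<noteq> c'" "c \<noteq> c'"
    and e: "f a = act L a" "f b = act L b" "f c = act L c"
  shows "f c' = act L c'"
proof -
  have inj: "inj f" using f by (simp add: farey_automorphism_def bij_is_inj)
  have "f ` {a, b, c'} \<in> farey_triangles" using f T(2) unfolding farey_automorphism_def by blast
  then have fc: "adj (f a) (f c')" "adj (f b) (f c')"
    using T inj by (auto intro!: farey_adj dest: injD)
  have "adj a b" "adj a c" "adj b c" "adj a c'" "adj b c'"
    using T farey_adj[OF T(1)] farey_adj[OF T(2)] by auto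
  then have A: "adj (f a) (f b)" "adj (f a) (f c)" "adj (f b) (f c)" "adj (f a) (act L c')" "adj (f b) (act L c')"
    unfolding e by (simp_all add: adj_act[OF L])
  show ?thesis
    by (rule third_vertex_unique[OF A(1-3) fc A(4,5)]) (use T inj act_inj[OF L] e in \<open>auto dest: injD\<close>)
qed

text \<open>
  Agreement on a triangle passes to the neighbouring triangles by \<open>agree_across_edge\<close>. Since this step is
  reversible, every triangle can be linked to the base triangle.
\<close>

lemma agree_everywhere:
  assumes f: "farey_automorphism f" and L: "unimodular L"
    and T: "T \<in> farey_triangles" "\<And>x. x \<in> T \<Longrightarrow> f x = act L x"
  shows "f = act L"
proof -
  define P where "P T \<longleftrightarrow> (\<forall>x\<in>T. f x = act L x)" for T
  have iff: "P T \<longleftrightarrow> P {Fin 0, Fin 1, Infty}" if "T \<in> farey_triangles" for T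
    using that
  proof (induction rule: farey_triangles.induct)
    case (reflection T a b)
    obtain c where c: "T = {a, b, c}" "adj a b" "adj a c" "adj b c"
      using triangle_third[OF farey_triangle[OF reflection(1)] reflection(2-4)] .
    note r = reflect_adj[OF c(2-4)]
    have R: "reflect a b ` T = {a, b, reflect a b c}"
      unfolding c(1) using reflect_fixes[OF reflection(4)] by simp
    have F: "{a, b, c} \<in> farey_triangles" "{a, b, reflect a b c} \<in> farey_triangles"
      using reflection(1) c(1) farey_reflect reflection(4) by auto
    have n: "a \<noteq> c" "b \<noteq> c" "a \<noteq> reflect a b c" "b \<noteq> reflect a b c"
      using c(3,4) r(1,2) adj_irrefl by metis+
    have "P {a, b, reflect a b c} \<longleftrightarrow> P {a, b, c}"
      unfolding P_def
      using agree_across_edge[OF f L F reflection(4) n r(3)[symmetric]]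
        agree_across_edge[OF f L F(2,1) reflection(4) n(3,4,1,2) r(3)] by auto
    then show ?case using reflection(5) R c(1) by (simp only:)
  qed simp
  have "P {Fin 0, Fin 1, Infty}" using iff[OF T(1)] T(2) by (simp add: P_def)
  then have "f s = act L s" for s using farey_vertex[of s] iff unfolding P_def by blast
  then show ?thesis by blast
qed

text \<open>
  This fixes \<open>v\<close> and adds a multiple of \<open>v\<close> to all other vectors; for primitive \<open>v\<close> it gives the
  parabolic automorphism at the slope of \<open>v\<close> that shifts by \<open>c\<close> units.
\<close>

definition shear :: "int \<times> int \<Rightarrow> int \<Rightarrow> int \<times> int \<Rightarrow> int \<times> int"
  where "shear v c w = (fst w + c * cross w v * fst v, snd w + c * cross w v * snd v)"

lemma unimodular_shear: "unimodular (shear v c)"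
  unfolding unimodular_def
  by (intro conjI exI[of _ 1]) (auto simp: shear_def cross_def algebra_simps)

lemma shear_shear: "shear v c (shear v d w) = shear v (c + d) w"
  by (auto simp: shear_def cross_def algebra_simps)

text \<open>
  Let \<open>x1 = f x0\<close> for a neighbour \<open>x0\<close> of \<open>r\<close>, and let \<open>x2\<close> be the next neighbour in the same direction. Then
  \<open>f x1\<close> is \<open>x0\<close> or \<open>x2\<close>. If it were \<open>x0\<close>, then \<open>f x2\<close>, being adjacent to \<open>r\<close>, \<open>x0\<close> and \<open>x2\<close>, would be \<open>x1 = f x0\<close>,
  which contradicts injectivity. So \<open>f\<close> agrees on the triangle \<open>{r, x0, x1}\<close> with a shear, and rigidity applies.
\<close>

lemma unit_shift_eq_shear:
  assumes "unit_shift r f"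
  shows "\<exists>t. \<bar>t\<bar> = 1 \<and> f = act (shear (int_vec r) t)"
proof -
  have f: "farey_automorphism f" "f r = r" "\<And>x. farey_edge r x \<Longrightarrow> f x \<noteq> x \<and> {r, x, f x} \<in> farey_triangles"
    using assms by (auto simp: unit_shift_def)
  have inj: "f x = f y \<Longrightarrow> x = y" for x y using f(1) by (metis farey_automorphism_def bij_is_inj injD)
  have fT: "T \<in> farey_triangles \<Longrightarrow> f ` T \<in> farey_triangles" for T using f(1) by (simp add: farey_automorphism_def)
  obtain T where T: "T \<in> farey_triangles" "r \<in> T" using farey_vertex by blast
  have "\<not> T \<subseteq> {r}"
    using farey_triangle[OF T(1)] card_mono[of "{r}" T] unfolding triangle_def by auto
  then obtain x0 where x0: "x0 \<in> T" "x0 \<noteq> r" by blast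
  have e0: "farey_edge r x0" using T x0 by (auto simp: farey_edge_def)
  define x1 where "x1 = f x0"
  have t01: "x1 \<noteq> x0" "{r, x0, x1} \<in> farey_triangles" using f(3)[OF e0] by (auto simp: x1_def)
  have n1: "x1 \<noteq> r" using inj[of x0 r] f(2) x0 by (auto simp: x1_def)
  have a01: "adj r x0" "adj r x1" "adj x0 x1"
    using farey_adj[OF t01(2)] n1 t01(1) x0 by auto
  define x2 where "x2 = reflect r x1 x0"
  have a10: "adj x1 x0" using a01 adj_sym by blast
  note r2 = reflect_adj[OF a01(2,1) a10, folded x2_def]
  have t12: "{r, x1, x2} \<in> farey_triangles"
    unfolding x2_def using t01(2) n1 by (intro farey_reflect) (auto simp: insert_commute)
  have n2: "x2 \<noteq> r" "x2 \<noteq> x1" using r2 adj_irrefl by auto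
  have e1: "farey_edge r x1" "farey_edge r x2" using t12 n1 n2 by (auto simp: farey_edge_def)
  note f1 = f(3)[OF e1(1)] and f2 = f(3)[OF e1(2)]
  have nf: "f x1 \<noteq> r" "f x2 \<noteq> r" using inj[of x1 r] inj[of x2 r] f(2) n1 n2 by auto
  have af1: "adj r (f x1)" "adj x1 (f x1)" using farey_adj f1 nf by auto
  have af2: "adj r (f x2)" "adj x2 (f x2)" using farey_adj f2 nf by auto
  let ?v = "int_vec r" and ?u = "int_vec x0"
  let ?w = "int_vec x1"
  \<comment> \<open>the sign for which the shear takes \<open>x0\<close> to \<open>x1\<close>\<close>
  define t where "t = - (cross ?w ?u * cross ?u ?v * cross ?w ?v)"
  have unit: "\<bar>cross ?u ?v\<bar> = 1" "\<bar>cross ?w ?v\<bar> = 1" "\<bar>cross ?w ?u\<bar> = 1"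
    using a01 adj_sym by (auto simp: adj_def)
  then have t: "\<bar>t\<bar> = 1" and sq: "cross ?u ?v * cross ?u ?v = 1" "cross ?w ?v * cross ?w ?v = 1"
    by (auto simp: t_def abs_mult abs_if split: if_splits)
  have tuv: "t * cross ?u ?v * cross ?w ?v = - cross ?w ?u"
  proof -
    have "t * cross ?u ?v * cross ?w ?v = - cross ?w ?u * (cross ?u ?v * cross ?u ?v) * (cross ?w ?v * cross ?w ?v)"
      by (simp add: t_def algebra_simps)
    then show ?thesis by (simp add: sq)
  qed
  let ?L = "shear ?v t"
  note L = unimodular_shear[of ?v t]
  have prim: "primitive (?L ?u)" "primitive (?L ?w)" by (rule unimodular_primitive[OF L primitive_int_vec])+
  have Lr: "act ?L r = r" by (simp add: act_def shear_def)
  have L0: "act ?L x0 = x1"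
    unfolding act_def
  proof (rule slope_ofI[OF prim(1)])
    have "cross ?w (?L ?u) = cross ?w ?u + t * cross ?u ?v * cross ?w ?v"
      by (simp add: shear_def cross_def algebra_simps)
    then show "cross ?w (?L ?u) = 0" by (simp add: tuv)
  qed
  have a12: "adj r (act ?L x1)" "adj x1 (act ?L x1)"
    using adj_act[OF L, of r x1] adj_act[OF L, of x0 x1] a01 Lr L0 by auto
  have "cross ?u (?L ?w) = cross ?u ?w + t * cross ?u ?v * cross ?w ?v"
    by (simp add: shear_def cross_def algebra_simps)
  also have "\<dots> = 2 * cross ?u ?w" unfolding tuv by (simp add: cross_swap[of ?u ?w])
  finally have "\<bar>cross ?u (int_vec (act ?L x1))\<bar> = 2"
    unfolding act_def abs_cross_slope_of(2)[OF prim(2)] using a01(3) by (simp add: adj_def abs_mult)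
  then have "act ?L x1 \<noteq> x0" by auto
  then have L1: "act ?L x1 = x2"
    using third_vertex_unique[OF a01(2,1) a10 r2(1,2) a12] r2(3) by auto
  have "f x1 \<noteq> x0"
  proof
    assume fx: "f x1 = x0"
    let ?y = "int_vec (f x2)"
    have "f ` {r, x1, x2} \<in> farey_triangles" by (rule fT[OF t12])
    then have "{r, x0, f x2} \<in> farey_triangles" using f(2) fx by simp
    moreover have "f x2 \<noteq> x0" using inj[of x2 x1] n2 fx by auto
    ultimately have "adj x0 (f x2)" by (auto intro: farey_adj)
    then have y: "\<bar>cross ?y ?u\<bar> = 1" "\<bar>cross ?y ?v\<bar> = 1" "\<bar>cross ?y (int_vec x2)\<bar> = 1"
      using af2 adj_sym by (auto simp: adj_def)
    have "x2 = slope_of (shear ?v (2 * t) ?u)"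
    proof -
      have "x2 = act ?L (slope_of (?L ?u))" using L0 L1 by (simp add: act_def)
      then show ?thesis unfolding act_slope_of[OF L prim(1)] shear_shear by simp
    qed
    then have "\<bar>cross ?y (shear ?v (2 * t) ?u)\<bar> = 1"
      using y(3) abs_cross_slope_of(2)[OF unimodular_primitive[OF unimodular_shear primitive_int_vec]] by simp
    moreover have "cross ?y (shear ?v c ?u) = cross ?y ?u + c * cross ?u ?v * cross ?y ?v" for c
      by (simp add: shear_def cross_def algebra_simps)
    moreover have "\<bar>t * cross ?u ?v * cross ?y ?v\<bar> = 1" using t y(2) unit(1) by (simp add: abs_mult)
    ultimately have "cross ?y (?L ?u) = 0" using y(1) by (auto simp: abs_if split: if_splits)
    then have "f x2 = x1" using slope_ofI[OF prim(1)] L0 by (simp add: act_def)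
    then have "x2 = x0" using inj[of x2 x0] by (simp add: x1_def)
    with r2(3) show False by simp
  qed
  then have "f x1 = x2"
    using third_vertex_unique[OF a01(2,1) a10 r2(1,2) af1] r2(3) by auto
  then have "f = act ?L"
    using L0 L1 Lr f(2) by (intro agree_everywhere[OF f(1) L t01(2)]) (auto simp: x1_def)
  then show ?thesis using t by blast
qed

section \<open>The rotation groups\<close>

lemma generate_BijGroup_subset:
  assumes S: "S \<subseteq> K" and K: "\<And>f. f \<in> K \<Longrightarrow> bij f" and id: "id \<in> K"
    and comp: "\<And>f g. f \<in> K \<Longrightarrow> g \<in> K \<Longrightarrow> f \<circ> g \<in> K" and inv: "\<And>f. f \<in> S \<Longrightarrow> inv_into UNIV f \<in> K"
  shows "generate (BijGroup UNIV) S \<subseteq> K"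
proof
  have B: "Bij UNIV = {f. bij f}" by (auto simp: Bij_def extensional_def)
  fix f assume "f \<in> generate (BijGroup UNIV) S"
  then show "f \<in> K"
  proof induction
    case one then show ?case using id by (simp add: BijGroup_def id_def)
  next
    case (incl h) then show ?case using S by blast
  next
    case (inv h)
    then have "h \<in> Bij UNIV" using S K B by auto
    then show ?case using assms(5)[OF inv] by (simp add: inv_BijGroup)
  next
    case (eng h1 h2)
    then have "h1 \<in> Bij UNIV" "h2 \<in> Bij UNIV" using K B by auto
    then have "h1 \<otimes>\<^bsub>BijGroup UNIV\<^esub> h2 = h1 \<circ> h2"
      by (simp add: BijGroup_def compose_def fun_eq_iff)
    then show ?case using comp[OF eng.IH] by (simp only:)
  qed
qed

lemma generate_BijGroup_comp:
  assumes "\<And>f. f \<in> S \<Longrightarrow> bij f" "f \<in> generate (BijGroup UNIV) S" "g \<in> generate (BijGroup UNIV) S"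
  shows "f \<circ> g \<in> generate (BijGroup UNIV) S"
proof -
  have B: "Bij UNIV = {f. bij f}" by (auto simp: Bij_def extensional_def)
  have "generate (BijGroup UNIV) S \<subseteq> {f. bij f}"
    by (rule generate_BijGroup_subset) (use assms(1) in \<open>auto intro: bij_comp bij_imp_bij_inv\<close>)
  then have "f \<in> Bij UNIV" "g \<in> Bij UNIV" using assms B by auto
  then have "f \<otimes>\<^bsub>BijGroup UNIV\<^esub> g = f \<circ> g"
    by (simp add: BijGroup_def compose_def fun_eq_iff)
  then show ?thesis using generate.eng[OF assms(2,3)] by simp
qed

text \<open>
  The integral and the half-integral lattice, for \<open>\<rho> = 2\<close> and \<open>\<rho> = 1\<close>.
\<close>

definition half_grid :: "int \<Rightarrow> plane set"
  where "half_grid \<rho> = {z. \<exists>i j. 2 *\<^sub>R z = (of_int (\<rho> * i), of_int (\<rho> * j))}"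

lemma int_lattice_half_grid: "int_lattice = half_grid 2"
proof (intro equalityI subsetI)
  fix z assume "z \<in> int_lattice"
  then obtain i j where "z = (of_int i, of_int j)" by (auto simp: int_lattice_def elim!: Ints_cases)
  then have "2 *\<^sub>R z = (of_int (2 * i), of_int (2 * j))" by simp
  then show "z \<in> half_grid 2" unfolding half_grid_def by blast
next
  fix z assume "z \<in> half_grid 2"
  then show "z \<in> int_lattice" by (auto simp: half_grid_def int_lattice_def prod_eq_iff mem_Times_iff)
qed

lemma half_lattice_half_grid: "half_lattice = half_grid 1"
proof (intro equalityI subsetI)
  fix z assume "z \<in> half_lattice"
  then obtain i j where "2 *\<^sub>R z = (of_int i, of_int j)"
    by (auto simp: half_lattice_def int_lattice_def mem_Times_iff prod_eq_iff elim!: Ints_cases)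
  then show "z \<in> half_grid 1" by (auto simp: half_grid_def)
next
  fix z assume "z \<in> half_grid 1"
  then show "z \<in> half_lattice" by (auto simp: half_grid_def half_lattice_def int_lattice_def prod_eq_iff mem_Times_iff)
qed

lemma rotation_group_half_grid: "rotation_group (half_grid \<rho>) = affine_maps \<rho>"
proof
  interpret action punctured_plane "affine_maps \<rho>" by (rule affine_maps_action)
  have bij: "bij \<gamma>" if "\<gamma> \<in> affine_maps \<rho>" for \<gamma>
    using inverse_mem[OF that] o_bij by blast
  have rot: "pi_rotation ` half_grid \<rho> = {(\<lambda>z. (of_int (\<rho> * i), of_int (\<rho> * j)) - z) | i j. True}"
  proof (intro equalityI subsetI)
    fix f assume "f \<in> pi_rotation ` half_grid \<rho>"
    then obtain a i j where "f = pi_rotation a" "2 *\<^sub>R a = (of_int (\<rho> * i), of_int (\<rho> * j))"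
      unfolding half_grid_def by blast
    then have "f = (\<lambda>z. (of_int (\<rho> * i), of_int (\<rho> * j)) - z)" by (simp only: pi_rotation_def)
    then show "f \<in> {(\<lambda>z. (of_int (\<rho> * i), of_int (\<rho> * j)) - z) | i j. True}" by blast
  next
    fix f :: "plane \<Rightarrow> plane" assume "f \<in> {(\<lambda>z. (of_int (\<rho> * i), of_int (\<rho> * j)) - z) | i j. True}"
    then obtain i j where f: "f = (\<lambda>z. (of_int (\<rho> * i), of_int (\<rho> * j)) - z)" by blast
    let ?a = "(1/2) *\<^sub>R (of_int (\<rho> * i), of_int (\<rho> * j)) :: plane"
    have "?a \<in> half_grid \<rho>" unfolding half_grid_def by (auto simp: prod_eq_iff)
    moreover have "f = pi_rotation ?a" unfolding f pi_rotation_def by (simp add: fun_eq_iff prod_eq_iff)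
    ultimately show "f \<in> pi_rotation ` half_grid \<rho>" by blast
  qed
  have rot_sub: "pi_rotation ` half_grid \<rho> \<subseteq> affine_maps \<rho>"
  proof
    fix f assume "f \<in> pi_rotation ` half_grid \<rho>"
    then obtain i j where f: "f = (\<lambda>z. (of_int (\<rho> * i), of_int (\<rho> * j)) - z)" unfolding rot by blast
    have "f = (\<lambda>z. (-1) *\<^sub>R z + (of_int (\<rho> * i), of_int (\<rho> * j)))" unfolding f by (simp add: fun_eq_iff)
    then show "f \<in> affine_maps \<rho>" unfolding affine_maps_def by blast
  qed
  show "rotation_group (half_grid \<rho>) \<subseteq> affine_maps \<rho>"
    unfolding rotation_group_def
  proof (rule generate_BijGroup_subset[OF rot_sub bij id_mem comp_mem])
    fix f assume f: "f \<in> pi_rotation ` half_grid \<rho>"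
    then obtain i j where e: "f = (\<lambda>z. (of_int (\<rho> * i), of_int (\<rho> * j)) - z)" unfolding rot by blast
    have "f \<circ> f = id" unfolding e by (simp add: fun_eq_iff)
    then have "inv_into UNIV f = f" by (rule inv_unique_comp) (simp add: e fun_eq_iff)
    then show "inv_into UNIV f \<in> affine_maps \<rho>" using rot_sub f by auto
  qed auto
  show "affine_maps \<rho> \<subseteq> rotation_group (half_grid \<rho>)"
  proof
    fix f assume "f \<in> affine_maps \<rho>"
    then obtain e i j where f: "f = (\<lambda>z. e *\<^sub>R z + (of_int (\<rho> * i), of_int (\<rho> * j)))" "e = 1 \<or> e = -1"
      by (auto simp: affine_maps_def)
    let ?r = "\<lambda>i j z. (of_int (\<rho> * i), of_int (\<rho> * j)) - z :: plane"
    have r: "?r i j \<in> pi_rotation ` half_grid \<rho>" for i j unfolding rot by blast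
    show "f \<in> rotation_group (half_grid \<rho>)"
    proof (cases "e = 1")
      case True
      then have "f = ?r i j \<circ> ?r 0 0" by (simp add: f(1) fun_eq_iff algebra_simps zero_prod_def)
      moreover have "?r i j \<circ> ?r 0 0 \<in> rotation_group (half_grid \<rho>)"
        unfolding rotation_group_def
        by (intro generate_BijGroup_comp generate.incl r bij rot_sub[THEN subsetD])
      ultimately show ?thesis by (simp only:)
    next
      case False
      then have "f = ?r i j" using f by (simp add: fun_eq_iff)
      moreover have "?r i j \<in> rotation_group (half_grid \<rho>)"
        unfolding rotation_group_def by (rule generate.incl[OF r])
      ultimately show ?thesis by (simp only:)
    qed
  qed
qed

section \<open>Loops of rational slope\<close>

context skew_basis
begin

lemma half_grid_iff: "z \<in> half_grid \<rho> \<longleftrightarrow> (\<exists>i. 2 * across z = of_int (\<rho> * i)) \<and> (\<exists>l. 2 * along z = of_int (\<rho> * l))"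
proof
  assume "z \<in> half_grid \<rho>"
  then obtain i j where "2 *\<^sub>R z = (of_int (\<rho> * i), of_int (\<rho> * j))" by (auto simp: half_grid_def)
  then have "across (2 *\<^sub>R z) = of_int (\<rho> * (i * snd v - j * fst v))" "along (2 *\<^sub>R z) = of_int (\<rho> * (fst u * j - snd u * i))"
    by (simp_all add: across_def along_def algebra_simps)
  then show "(\<exists>i. 2 * across z = of_int (\<rho> * i)) \<and> (\<exists>l. 2 * along z = of_int (\<rho> * l))" unfolding across_linear along_linear by blast
next
  assume "(\<exists>i. 2 * across z = of_int (\<rho> * i)) \<and> (\<exists>l. 2 * along z = of_int (\<rho> * l))"
  then obtain i l where il: "2 * across z = of_int (\<rho> * i)" "2 * along z = of_int (\<rho> * l)" by blast
  have "2 *\<^sub>R z = pt (of_int (\<rho> * i)) (of_int (\<rho> * l))"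
    by (rule coords_eqI) (simp_all add: il)
  also have "\<dots> = (of_int (\<rho> * (i * fst u + l * fst v)), of_int (\<rho> * (i * snd u + l * snd v)))"
    by (simp add: pt_def algebra_simps)
  finally show "z \<in> half_grid \<rho>" unfolding half_grid_def by blast
qed

definition avoids :: "int \<Rightarrow> plane \<Rightarrow> bool" where "avoids \<rho> a \<longleftrightarrow> \<not> (\<exists>i. 2 * across a = of_int (\<rho> * i))"

lemma avoids_2: "avoids 2 a \<longleftrightarrow> across a \<notin> \<int>"
  by (auto simp: avoids_def elim: Ints_cases)

lemma line_avoids: "(\<forall>t. a + t *\<^sub>R pt 0 1 \<notin> half_grid \<rho>) \<longleftrightarrow> avoids \<rho> a"
proof -
  have 0: "2 * along (a + (- along a) *\<^sub>R pt 0 1) = of_int (\<rho> * 0)" by simp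
  show ?thesis
  proof
    assume *: "\<forall>t. a + t *\<^sub>R pt 0 1 \<notin> half_grid \<rho>"
    show "avoids \<rho> a"
    proof (rule ccontr)
      assume "\<not> avoids \<rho> a"
      then obtain i where "2 * across (a + (- along a) *\<^sub>R pt 0 1) = of_int (\<rho> * i)" by (auto simp: avoids_def)
      then have "a + (- along a) *\<^sub>R pt 0 1 \<in> half_grid \<rho>" unfolding half_grid_iff using 0 by blast
      with * show False by blast
    qed
  qed (auto simp: half_grid_iff avoids_def)
qed

text \<open>
  A rotation cannot move \<open>a\<close> along a line that avoids its centre, so \<open>\<gamma>\<close> is a translation along the line; for
  a multiple of the generating translation the loop would run several times around its image.
\<close>

lemma simple_line_loop_iff:
  assumes s: "slope_vector s = pt 0 1" and \<rho>: "0 < \<rho>"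
  shows "simple_line_loop (half_grid \<rho>) s \<gamma> a \<longleftrightarrow> avoids \<rho> a \<and> (\<gamma> = vshift \<rho> \<or> \<gamma> = vshift (- \<rho>))"
proof
  assume L: "simple_line_loop (half_grid \<rho>) s \<gamma> a"
  then have av: "avoids \<rho> a" and g: "\<gamma> \<in> affine_maps \<rho>" "\<gamma> a \<noteq> a" and ex: "\<exists>t. \<gamma> a = a + t *\<^sub>R pt 0 1"
    and simple: "\<And>h t u. h \<in> affine_maps \<rho> \<Longrightarrow> t \<in> {0..<1} \<Longrightarrow> u \<in> {0..<1} \<Longrightarrow>
        h (linepath a (\<gamma> a) t) = linepath a (\<gamma> a) u \<Longrightarrow> t = u"
    unfolding simple_line_loop_def s line_avoids rotation_group_half_grid by blast+
  obtain e i l where e: "e = 1 \<or> e = -1" "\<rho> dvd i" "\<rho> dvd l"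
    "\<And>z. across (\<gamma> z) = of_int e * across z + of_int i" "\<And>z. along (\<gamma> z) = of_int e * along z + of_int l"
    using affine_maps_coords[OF g(1)] by metis
  have across: "across (\<gamma> a) = across a" using ex by auto
  have e1: "e = 1"
  proof (rule ccontr)
    assume "e \<noteq> 1"
    then have "2 * across a = of_int i" using e(1) across e(4)[of a] by auto
    then show False using av e(2) by (auto simp: avoids_def elim!: dvdE)
  qed
  then have "i = 0" using across e(4)[of a] by simp
  then have gl: "\<gamma> = vshift l" using e1 e(4,5) by (intro ext coords_eqI) auto
  obtain k where k: "l = \<rho> * k" using e(3) by (auto elim: dvdE)
  have "k \<noteq> 0" using g(2) unfolding gl k by (auto simp: vshift_def pt_def zero_prod_def[symmetric])
  have "\<bar>k\<bar> = 1"
  proof (rule ccontr)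
    assume "\<bar>k\<bar> \<noteq> 1"
    then have k2: "\<bar>k\<bar> \<ge> 2" using \<open>k \<noteq> 0\<close> by linarith
    \<comment> \<open>the generating translation maps the start of the segment to an interior point\<close>
    let ?h = "vshift (\<rho> * sgn k)"
    have "?h \<in> affine_maps \<rho>" by (rule affine_mapsI[of 1 _ 0 "\<rho> * sgn k"]) auto
    moreover have "?h (linepath a (\<gamma> a) 0) = linepath a (\<gamma> a) (1 / of_int \<bar>k\<bar>)"
    proof (rule coords_eqI)
      have "real_of_int (sgn k) = of_int k / of_int \<bar>k\<bar>" using \<open>k \<noteq> 0\<close> by (auto simp: sgn_if)
      then show "along (?h (linepath a (\<gamma> a) 0)) = along (linepath a (\<gamma> a) (1 / of_int \<bar>k\<bar>))"
        unfolding gl k linepath_def along_linear vshift_coords by (simp add: algebra_simps)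
    qed (simp add: gl linepath_def algebra_simps)
    moreover have "2 \<le> real_of_int \<bar>k\<bar>" using k2 by linarith
    then have "1 / real_of_int \<bar>k\<bar> \<in> {0..<1}" by (simp add: divide_simps)
    ultimately have "0 = 1 / real_of_int \<bar>k\<bar>" by (intro simple[of ?h 0 "1 / real_of_int \<bar>k\<bar>"]) auto
    then show False using \<open>k \<noteq> 0\<close> by simp
  qed
  then have "k = 1 \<or> k = -1" by linarith
  then show "avoids \<rho> a \<and> (\<gamma> = vshift \<rho> \<or> \<gamma> = vshift (- \<rho>))" using av gl k by auto
next
  assume "avoids \<rho> a \<and> (\<gamma> = vshift \<rho> \<or> \<gamma> = vshift (- \<rho>))"
  then obtain \<delta> :: int where av: "avoids \<rho> a" and d: "\<delta> = 1 \<or> \<delta> = -1" "\<gamma> = vshift (\<rho> * \<delta>)"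
    by (metis mult.right_neutral mult_minus1_right)
  have g: "\<gamma> \<in> affine_maps \<rho>" unfolding d(2) by (rule affine_mapsI[of 1 _ 0 "\<rho> * \<delta>"]) auto
  have along: "along (linepath a (\<gamma> a) t) = along a + t * of_int (\<rho> * \<delta>)"
    and across: "across (linepath a (\<gamma> a) t) = across a" for t
    unfolding d(2) linepath_def across_linear along_linear vshift_coords by (simp_all add: algebra_simps)
  have "t = u" if h: "h \<in> affine_maps \<rho>" and t: "t \<in> {0..<1}" "u \<in> {0..<1}"
    and eq: "h (linepath a (\<gamma> a) t) = linepath a (\<gamma> a) u" for h t u
  proof -
    obtain e i l where e: "e = 1 \<or> e = -1" "\<rho> dvd i" "\<rho> dvd l"
      "\<And>z. across (h z) = of_int e * across z + of_int i" "\<And>z. along (h z) = of_int e * along z + of_int l"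
      using affine_maps_coords[OF h] by metis
    have 1: "across a = of_int e * across a + of_int i" "along a + u * of_int (\<rho> * \<delta>) = of_int e * (along a + t * of_int (\<rho> * \<delta>)) + of_int l"
      using arg_cong[OF eq, of across] arg_cong[OF eq, of along] unfolding e(4,5) across along by auto
    have "e = 1"
    proof (rule ccontr)
      assume "e \<noteq> 1"
      then have "2 * across a = of_int i" using e(1) 1 by auto
      then show False using av e(2) by (auto simp: avoids_def elim!: dvdE)
    qed
    obtain k where k: "l = \<rho> * k" using e(3) by (auto elim: dvdE)
    have "of_int \<rho> * ((u - t) * of_int \<delta>) = of_int \<rho> * real_of_int k" using 1(2) \<open>e = 1\<close> k by (simp add: algebra_simps)
    then have "(u - t) * of_int \<delta> = of_int k" using \<rho> by simp
    moreover have "\<bar>(u - t) * of_int \<delta>\<bar> < 1" using t d(1) by (auto simp: abs_if)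
    ultimately have "\<bar>real_of_int k\<bar> < 1" by simp
    then have "k = 0" by linarith
    with \<open>(u - t) * of_int \<delta> = of_int k\<close> show ?thesis using d(1) by auto
  qed
  moreover have "\<gamma> a \<noteq> a"
  proof
    assume "\<gamma> a = a"
    then have "along (vshift (\<rho> * \<delta>) a) = along a" by (simp add: d(2))
    then show False using d(1) \<rho> by auto
  qed
  moreover have "\<gamma> a = a + (of_int (\<rho> * \<delta>)) *\<^sub>R pt 0 1"
    unfolding d(2) by (rule coords_eqI) simp_all
  ultimately show "simple_line_loop (half_grid \<rho>) s \<gamma> a"
    unfolding simple_line_loop_def s line_avoids rotation_group_half_grid using av g by blast
qed

end

lemma base_point_in: "base_point \<in> punctured_plane"
  using not_Ints_between[of 0 "1/4"] by (simp add: base_point_def int_lattice_def)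

context lattice_action
begin

lemma vshift_conj:
  assumes "\<gamma> \<in> affine_maps \<rho>" "\<gamma> \<circ> \<delta> = id"
  shows "\<gamma> \<circ> vshift k \<circ> \<delta> = vshift k \<or> \<gamma> \<circ> vshift k \<circ> \<delta> = vshift (- k)"
proof -
  obtain e i l where e: "e = 1 \<or> e = -1"
    "\<And>z. across (\<gamma> z) = of_int e * across z + of_int i" "\<And>z. along (\<gamma> z) = of_int e * along z + of_int l"
    using affine_maps_coords[OF assms(1)] by metis
  have "(\<gamma> \<circ> vshift k \<circ> \<delta>) z = vshift (e * k) (\<gamma> (\<delta> z))" for z
    by (rule coords_eqI) (simp_all add: e(2,3) algebra_simps)
  then have "\<gamma> \<circ> vshift k \<circ> \<delta> = vshift (e * k)"
    using assms(2) by (intro ext) (metis comp_apply id_apply)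
  then show ?thesis using e(1) by auto
qed

lemma affine_linepath:
  assumes "\<gamma> \<in> affine_maps \<rho>" shows "\<gamma> \<circ> linepath a c = linepath (\<gamma> a) (\<gamma> c)"
proof -
  obtain e i l where e: "e = 1 \<or> e = -1"
    "\<And>z. across (\<gamma> z) = of_int e * across z + of_int i" "\<And>z. along (\<gamma> z) = of_int e * along z + of_int l"
    using affine_maps_coords[OF assms(1)] by metis
  show ?thesis
    by (rule ext, rule coords_eqI) (simp_all add: linepath_def e(2,3) algebra_simps)
qed

lemma avoids_affine:
  assumes "\<gamma> \<in> affine_maps \<rho>" "\<rho>' dvd 2 * \<rho>" "avoids \<rho>' a" shows "avoids \<rho>' (\<gamma> a)"
proof -
  obtain e i l where e: "e = 1 \<or> e = -1" "\<rho> dvd i"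
    "\<And>z. across (\<gamma> z) = of_int e * across z + of_int i"
    using affine_maps_coords[OF assms(1)] by metis
  show ?thesis unfolding avoids_def
  proof
    assume "\<exists>j. 2 * across (\<gamma> a) = of_int (\<rho>' * j)"
    then obtain j where j: "2 * across (\<gamma> a) = of_int (\<rho>' * j)" by blast
    have "\<rho>' dvd 2 * i" using assms(2) e(2) by (metis dvd_trans mult_dvd_mono dvd_refl)
    then obtain q where q: "2 * i = \<rho>' * q" by (auto elim: dvdE)
    have "2 * across (\<gamma> a) = of_int e * (2 * across a) + of_int (2 * i)" by (simp add: e(3))
    moreover have "real_of_int (2 * i) = of_int (\<rho>' * q)" using q by simp
    ultimately have "of_int e * (2 * across a) = of_int (\<rho>' * (j - q))" using j by (simp add: algebra_simps)
    then have "2 * across a = of_int (\<rho>' * (e * (j - q)))" using e(1) by (auto simp: algebra_simps)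
    then show False using assms(3) unfolding avoids_def by blast
  qed
qed

lemma avoids_strip: "\<rho>' dvd 2 \<Longrightarrow> avoids \<rho>' a \<Longrightarrow> a \<in> strip \<lfloor>across a\<rfloor>"
proof -
  assume "\<rho>' dvd 2" "avoids \<rho>' a"
  then have "across a \<notin> \<int>" by (auto simp: avoids_def elim!: Ints_cases dvdE) (metis mult.assoc of_int_mult of_int_numeral)
  then show ?thesis by (simp add: in_strip_iff)
qed

text \<open>
  This lemma and the next describe the based representatives of a simple loop in the groupoid: they are
  the conjugates of the vertical loops of length \<open>\<plusminus>\<rho>'\<close>. Two rotation groups are involved, \<open>\<rho>'\<close> for
  the loops and \<open>\<rho>\<close> for the fundamental group, because in the odd case loops in the Conway sphere
  are considered in the fundamental group of its quotient orbifold.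
\<close>

lemma line_loop_elementsI:
  assumes s: "slope_vector s = pt 0 1" and \<rho>: "0 < \<rho>'" "\<rho>' dvd 2" "\<rho>' dvd 2 * \<rho>" "\<rho> dvd \<rho>'"
    and a: "avoids \<rho>' a" and gh: "mutually_inverse base_point a g h" and k: "k = \<rho>' \<or> k = - \<rho>'"
  shows "g \<odot> vloop k a \<odot> h \<in> line_loop_elements (half_grid \<rho>') s"
proof -
  have gm: "g \<in> mor base_point a" "h \<in> mor a base_point" "h \<odot> g = unit a"
    using gh by (auto simp: mutually_inverse_def)
  obtain \<gamma> p where g: "g = arrow punctured_plane \<gamma> p" "\<gamma> \<in> affine_maps \<rho>" "path p" "path_image p \<subseteq> punctured_plane" "pathstart p = base_point" "pathfinish p = \<gamma> a"
    using gm(1) by (rule morE)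
  obtain \<delta> where d: "\<delta> \<in> affine_maps \<rho>" "\<gamma> \<circ> \<delta> = id" "\<delta> \<circ> \<gamma> = id" using inverse_mem[OF g(2)] by blast
  have dg: "\<delta> (\<gamma> t) = t" for t using d(3) by (metis comp_apply id_apply)
  let ?S = "strip \<lfloor>across a\<rfloor>"
  have aS: "a \<in> ?S" by (rule avoids_strip[OF \<rho>(2) a])
  let ?q = "linepath a (vshift k a)" and ?\<tau> = "\<gamma> \<circ> vshift k \<circ> \<delta>"
  have "closed_segment a (vshift k a) \<subseteq> ?S" by (intro closed_segment_subset convex_strip aS vshift_in_strip)
  then have q: "path_image ?q \<subseteq> punctured_plane" using strip_subset by auto
  have "g \<odot> vloop k a \<odot> h = arrow punctured_plane ?\<tau> (p +++ (\<gamma> \<circ> ?q) +++ reversepath (?\<tau> \<circ> p))"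
    unfolding vloop_arrow[OF aS] g(1) using g gm d q k \<rho>(4)
    by (intro conjugate_arrow) (auto intro: vshift_mem)
  also have "\<gamma> \<circ> ?q = linepath (\<gamma> a) (?\<tau> (\<gamma> a))"
    unfolding affine_linepath[OF g(2)] by (simp add: dg)
  also have "arrow punctured_plane ?\<tau> (p +++ \<dots> +++ reversepath (?\<tau> \<circ> p)) \<in> line_loop_elements (half_grid \<rho>') s"
  proof -
    have "simple_line_loop (half_grid \<rho>') s ?\<tau> (\<gamma> a)"
      unfolding simple_line_loop_iff[OF s \<rho>(1)]
      using avoids_affine[OF g(2) \<rho>(3) a] vshift_conj[OF g(2) d(2), of k] k by auto
    then show ?thesis unfolding line_loop_elements_def arrow_def using g by blast
  qed
  finally show ?thesis .
qed

lemma line_loop_elementsE: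
  assumes x: "x \<in> line_loop_elements (half_grid \<rho>') s" and s: "slope_vector s = pt 0 1"
    and \<rho>: "0 < \<rho>'" "\<rho>' dvd 2" "\<rho> dvd \<rho>'"
  obtains a g h k where "avoids \<rho>' a" "mutually_inverse base_point a g h" "k = \<rho>' \<or> k = - \<rho>'"
    "x = g \<odot> vloop k a \<odot> h"
proof -
  obtain \<tau> a p where t: "simple_line_loop (half_grid \<rho>') s \<tau> a" and p: "path p" "path_image p \<subseteq> punctured_plane"
    "pathstart p = base_point" "pathfinish p = a"
    and xe: "x = arrow punctured_plane \<tau> (p +++ linepath a (\<tau> a) +++ reversepath (\<tau> \<circ> p))"
    using x unfolding line_loop_elements_def arrow_def by blast
  have a: "avoids \<rho>' a" and "\<tau> = vshift \<rho>' \<or> \<tau> = vshift (- \<rho>')"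
    using t unfolding simple_line_loop_iff[OF s \<rho>(1)] by auto
  then obtain k where k: "k = \<rho>' \<or> k = - \<rho>'" "\<tau> = vshift k" by blast
  let ?g = "arrow punctured_plane id p"
  have gm: "?g \<in> mor base_point a" using p by (intro morI id_mem) auto
  obtain h where h: "h \<in> mor a base_point" "?g \<odot> h = unit base_point" "h \<odot> ?g = unit a"
    using mor_inverse[OF gm] by blast
  let ?S = "strip \<lfloor>across a\<rfloor>"
  have aS: "a \<in> ?S" by (rule avoids_strip[OF \<rho>(2) a])
  let ?q = "linepath a (vshift k a)"
  have "closed_segment a (vshift k a) \<subseteq> ?S" by (intro closed_segment_subset convex_strip aS vshift_in_strip)
  then have q: "path_image ?q \<subseteq> punctured_plane" using strip_subset by auto
  have "?g \<odot> vloop k a \<odot> h = arrow punctured_plane (id \<circ> vshift k \<circ> id) (p +++ (id \<circ> ?q) +++ reversepath ((id \<circ> vshift k \<circ> id) \<circ> p))"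
    unfolding vloop_arrow[OF aS] using p h q k \<rho>(3)
    by (intro conjugate_arrow id_mem) (auto intro: vshift_mem)
  also have "\<dots> = x" unfolding xe k(2) by simp
  finally show ?thesis using that[OF a _ k(1)] gm h by (simp add: mutually_inverse_def)
qed

lemma power_vloop:
  assumes b: "b \<in> punctured_plane" and a: "a \<in> strip k" and gh: "mutually_inverse b a g h" and l: "\<rho> dvd l"
  shows "(g \<odot> vloop l a \<odot> h) [^]\<^bsub>orbifold_pi1 punctured_plane (affine_maps \<rho>) b\<^esub> (n::nat) = g \<odot> vloop (int n * l) a \<odot> h"
proof (induction n)
  interpret G: group "orbifold_pi1 punctured_plane (affine_maps \<rho>) b" by (rule group_pi1[OF b])
  case 0
  have "g \<odot> unit a \<odot> h = unit b" using gh unit_right[of g b a] by (simp add: mutually_inverse_def)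
  then show ?case using vloop_0[OF a] by (simp add: one_pi1)
next
  case (Suc n)
  interpret G: group "orbifold_pi1 punctured_plane (affine_maps \<rho>) b" by (rule group_pi1[OF b])
  have "(g \<odot> vloop l a \<odot> h) [^]\<^bsub>orbifold_pi1 punctured_plane (affine_maps \<rho>) b\<^esub> Suc n
      = (g \<odot> vloop (int n * l) a \<odot> h) \<odot> (g \<odot> vloop l a \<odot> h)"
    by (simp add: mult_pi1 Suc)
  also have "\<dots> = g \<odot> (vloop (int n * l) a \<odot> vloop l a) \<odot> h"
    using a l by (intro conjugate_mult[OF gh] vloop_mor) auto
  also have "vloop (int n * l) a \<odot> vloop l a = vloop (int (Suc n) * l) a"
    using l by (subst vloop_mult[OF a]) (auto simp: algebra_simps)
  finally show ?case .
qed

lemma relator_null: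
  assumes s: "slope_vector s = pt 0 1" and \<rho>: "0 < \<rho>" "\<rho> dvd 2"
    and rel: "\<And>x. x \<in> line_loop_elements (half_grid \<rho>) s \<Longrightarrow> x [^]\<^bsub>orbifold_pi1 punctured_plane (affine_maps \<rho>) base_point\<^esub> (n::nat) \<in> N"
    and z: "2 * across z \<notin> \<int>" and gh: "mutually_inverse base_point z g h"
  shows "g \<odot> vloop (int n * \<rho>) z \<odot> h \<in> N"
proof -
  note b = base_point_in
  have av: "avoids \<rho> z" using z unfolding avoids_def by (metis Ints_of_int)
  have "g \<odot> vloop \<rho> z \<odot> h \<in> line_loop_elements (half_grid \<rho>) s"
    using \<rho> by (intro line_loop_elementsI[OF s]) (auto intro: av gh)
  from rel[OF this] show ?thesis
    unfolding power_vloop[OF b avoids_strip[OF \<rho>(2) av] gh dvd_refl] .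
qed

end

definition real_vec :: "int \<times> int \<Rightarrow> plane" where "real_vec w = (of_int (fst w), of_int (snd w))"

lemma slope_vector_real_vec: "slope_vector s = real_vec (int_vec s)"
  by (simp add: real_vec_def slope_vector_int_vec)

lemma skew_basis_ex: "\<exists>u. skew_basis u (int_vec s)"
proof -
  obtain y where "cross (int_vec s) y = 1" using primitive_int_vec primitive_iff by blast
  then have "skew_basis (- fst y, - snd y) (int_vec s)"
    by unfold_locales (simp add: cross_def algebra_simps)
  then show ?thesis by blast
qed

lemma (in skew_basis) slope_vector_pt: "int_vec s = v \<Longrightarrow> slope_vector s = pt 0 1"
  by (simp add: slope_vector_int_vec pt_def)

lemma (in skew_basis) vshift_slope: "int_vec s = v \<Longrightarrow> vshift l z = z + of_int l *\<^sub>R slope_vector s"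
  by (rule coords_eqI) (simp_all add: slope_vector_pt)

lemma (in skew_basis) line_avoids_lattice:
  "int_vec s = v \<Longrightarrow> (\<forall>t. a + t *\<^sub>R slope_vector s \<notin> int_lattice) \<longleftrightarrow> avoids 2 a"
  using line_avoids[of a 2] slope_vector_pt[of s] int_lattice_half_grid by simp

context twist
begin

lemma A_linepath: "A \<circ> linepath a w = linepath (A a) (A w)"
  by (rule ext, rule coords_eqI) (simp_all add: linepath_def algebra_simps)

text \<open>
  If the linear part of the twist induces \<open>L\<close> on integral vectors, then the functor given by the twist carries
  loops of slope \<open>s\<close> to loops of slope \<open>act L s\<close>, and \<open>coset_transport\<close> brings them back to the base point
  without changing the coset.
\<close>

lemma loop_transfer:
  assumes b: "b = base_point" and \<rho>: "0 < \<rho>" and L: "unimodular L"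
    and lin: "\<And>z t w. A (z + t *\<^sub>R real_vec w) = A z + t *\<^sub>R real_vec (L w)"
    and x: "x \<in> alpha_elements s"
  shows "\<exists>y \<in> alpha_elements (act L s). N #>\<^bsub>G\<^esub> x = N #>\<^bsub>G\<^esub> y"
proof -
  let ?s' = "act L s"
  obtain u1 where "skew_basis u1 (int_vec s)" using skew_basis_ex by blast
  then interpret S: lattice_action u1 "int_vec s" \<rho>
    by (intro lattice_action.intro affine_maps_action)
  obtain u2 where "skew_basis u2 (int_vec ?s')" using skew_basis_ex by blast
  then interpret T: lattice_action u2 "int_vec ?s'" \<rho>
    by (intro lattice_action.intro affine_maps_action)
  obtain \<kappa> :: int where \<kappa>: "\<kappa> = 1 \<or> \<kappa> = -1" "real_vec (L (int_vec s)) = of_int \<kappa> *\<^sub>R slope_vector ?s'"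
  proof -
    have "int_vec ?s' = L (int_vec s) \<or> int_vec ?s' = (- fst (L (int_vec s)), - snd (L (int_vec s)))"
      unfolding act_def by (rule int_vec_slope_of[OF unimodular_primitive[OF L primitive_int_vec]])
    then show ?thesis using that[of 1] that[of "-1"] by (auto simp: slope_vector_real_vec real_vec_def)
  qed
  have x': "x \<in> line_loop_elements (half_grid 2) s" using x by (simp add: alpha_elements_def int_lattice_half_grid)
  obtain a g h k where a: "S.avoids 2 a" and gh: "mutually_inverse b a g h" and k: "k = 2 \<or> k = -2"
    and xe: "x = g \<odot> S.vloop k a \<odot> h"
    by (rule S.line_loop_elementsE[OF x' S.slope_vector_pt[OF refl] zero_less_numeral dvd_refl rho(2)])
      (rule that, simp_all add: b)
  have aS: "a \<in> S.strip \<lfloor>S.across a\<rfloor>" by (rule S.avoids_strip[OF _ a]) simp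
  let ?q = "linepath a (S.vshift k a)"
  have "closed_segment a (S.vshift k a) \<subseteq> S.strip \<lfloor>S.across a\<rfloor>"
    by (intro closed_segment_subset S.convex_strip aS S.vshift_in_strip)
  then have q: "path_image ?q \<subseteq> punctured_plane" using S.strip_subset by auto
  have "\<forall>t. A a + t *\<^sub>R slope_vector ?s' \<notin> int_lattice"
  proof
    fix t
    have "a + (of_int \<kappa> * t) *\<^sub>R slope_vector s \<in> punctured_plane"
      using S.line_avoids_lattice[OF refl] a by blast
    then have "A (a + (of_int \<kappa> * t) *\<^sub>R slope_vector s) \<in> punctured_plane" using A_maps by blast
    moreover have "real_of_int \<kappa> * of_int \<kappa> = 1" using \<kappa>(1) by auto
    then have "A (a + (of_int \<kappa> * t) *\<^sub>R slope_vector s) = A a + t *\<^sub>R slope_vector ?s'"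
      unfolding slope_vector_real_vec[of s] lin \<kappa>(2) by (simp add: mult.commute mult.left_commute)
    ultimately show "A a + t *\<^sub>R slope_vector ?s' \<notin> int_lattice" by simp
  qed
  then have Aa: "T.avoids 2 (A a)" using T.line_avoids_lattice[OF refl] by blast
  have AS: "A a \<in> T.strip \<lfloor>T.across (A a)\<rfloor>" by (rule T.avoids_strip[OF _ Aa]) simp
  have sh: "A (S.vshift k z) = T.vshift (\<kappa> * k) (A z)" for z
    unfolding S.vshift_slope[OF refl] T.vshift_slope[OF refl] slope_vector_real_vec[of s] lin \<kappa>(2)
    by (simp add: mult.commute)
  have "A (A' z) = z" for z using inverses(1) by (metis comp_apply id_apply)
  then have tau: "A \<circ> S.vshift k \<circ> A' = T.vshift (\<kappa> * k)" by (simp add: fun_eq_iff sh)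
  have "transport (S.vloop k a) = arrow punctured_plane (T.vshift (\<kappa> * k)) (linepath (A a) (T.vshift (\<kappa> * k) (A a)))"
    unfolding S.vloop_arrow[OF aS] using q by (subst transport_arrow) (auto simp: tau A_linepath sh)
  then have tl: "transport (S.vloop k a) = T.vloop (\<kappa> * k) (A a)" using T.vloop_arrow[OF AS] by simp
  have gm: "g \<in> mor b a" "h \<in> mor a b" using gh by (auto simp: mutually_inverse_def)
  have lm: "S.vloop k a \<in> mor a a" using rho(2) k by (intro S.vloop_mor[OF aS]) auto
  have lm': "T.vloop (\<kappa> * k) (A a) \<in> mor (A a) (A a)" using transport_mor[OF lm] tl by simp
  obtain t t' where t: "t \<in> mor b (A b)" "t' \<in> mor (A b) b" "t \<odot> t' = unit b" "t' \<odot> t = unit (A b)"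
    and tx: "\<And>x. x \<in> mor b b \<Longrightarrow> N #>\<^bsub>G\<^esub> (t \<odot> transport x \<odot> t') = N #>\<^bsub>G\<^esub> x"
    by (rule coset_transport) blast
  have tt: "mutually_inverse b (A b) t t'" using t by (simp add: mutually_inverse_def)
  have xm: "x \<in> mor b b" unfolding xe by (rule mult_mor[OF mult_mor[OF gm(1) lm] gm(2)])
  let ?y = "t \<odot> transport x \<odot> t'"
  have "transport x = transport g \<odot> T.vloop (\<kappa> * k) (A a) \<odot> transport h"
    unfolding xe using transport_mult[OF mult_mor[OF gm(1) lm] gm(2)] transport_mult[OF gm(1) lm] tl by simp
  then have "?y = (t \<odot> transport g) \<odot> T.vloop (\<kappa> * k) (A a) \<odot> (transport h \<odot> t')"
    using conjugate_conjugate[OF tt transport_mutually_inverse[OF gh] lm'] by simp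
  also have "\<dots> \<in> line_loop_elements (half_grid 2) ?s'"
    using rho(2) \<kappa>(1) k mutually_inverse_mult[OF tt transport_mutually_inverse[OF gh]]
    unfolding b by (intro T.line_loop_elementsI[OF T.slope_vector_pt[OF refl] _ _ _ _ Aa]) auto
  finally have "?y \<in> alpha_elements ?s'" by (simp add: alpha_elements_def int_lattice_half_grid)
  then show ?thesis using tx[OF xm] by metis
qed

end

text \<open>
  The reflection in the edge from \<open>a\<close> to \<open>\<infinity>\<close> on integral vectors.
\<close>

definition flip :: "int \<Rightarrow> int \<times> int \<Rightarrow> int \<times> int" where "flip a w = (fst w, 2 * a * fst w - snd w)"

lemma unimodular_flip: "unimodular (flip a)"
  unfolding unimodular_def
  by (rule conjI, rule exI[of _ "-1"]) (auto simp: flip_def cross_def algebra_simps)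

lemma reflect_flip: "reflect (Fin (of_int a)) Infty s = act (flip a) s"
proof -
  have "cross (int_vec (reflect (Fin (of_int a)) Infty s)) (flip a (int_vec s)) = 0"
  proof (cases s)
    case (Fin x)
    let ?y = "2 * of_int a - x"
    have pos: "snd (quotient_of x) > 0" "snd (quotient_of ?y) > 0" by (rule quotient_of_denom_pos')+
    have "rat_of_int (fst (quotient_of ?y)) / of_int (snd (quotient_of ?y)) = 2 * of_int a - of_int (fst (quotient_of x)) / of_int (snd (quotient_of x))"
      using Fract_quotient[of x] Fract_quotient[of ?y] by simp
    then have "rat_of_int (fst (quotient_of ?y)) * of_int (snd (quotient_of x)) = (2 * of_int a * of_int (snd (quotient_of x)) - of_int (fst (quotient_of x))) * of_int (snd (quotient_of ?y))"
      using pos by (simp add: field_simps)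
    then have "fst (quotient_of ?y) * snd (quotient_of x) = (2 * a * snd (quotient_of x) - fst (quotient_of x)) * snd (quotient_of ?y)"
      by (metis (mono_tags, lifting) of_int_diff of_int_eq_iff of_int_mult of_int_numeral)
    then show ?thesis unfolding Fin by (simp add: cross_def flip_def algebra_simps)
  next
    case Infty then show ?thesis by (simp add: cross_def flip_def)
  qed
  then show ?thesis unfolding act_def
    by (intro slope_ofI[symmetric] unimodular_primitive[OF unimodular_flip primitive_int_vec])
qed

section \<open>Invariance of the classes of loops\<close>

text \<open>
  The common form of the even (\<open>\<rho> = 2\<close>, \<open>k = 1\<close>, \<open>l = n\<close>) and the odd (\<open>\<rho> = 1\<close>, \<open>k = 2\<close>, \<open>l = 2n\<close>) Heckoid groups.
  In both cases the relators are vertical loops of length \<open>2\<close> for the slope \<open>\<infinity>\<close> and of length \<open>m = 2n\<close> for the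
  slope \<open>r\<close>, since a simple loop has length \<open>\<rho>\<close>.
\<close>

locale heckoid_quotient =
  fixes r :: rat and \<rho> m :: int and k l :: nat and N
  assumes \<rho>: "\<rho> = 1 \<or> \<rho> = 2"
    and normal: "N \<lhd> orbifold_pi1 punctured_plane (affine_maps \<rho>) base_point"
    and exps: "int k * \<rho> = 2" "int l * \<rho> = m"
    and rel_Infty: "\<And>x. x \<in> line_loop_elements (half_grid \<rho>) Infty \<Longrightarrow>
      x [^]\<^bsub>orbifold_pi1 punctured_plane (affine_maps \<rho>) base_point\<^esub> k \<in> N"
    and rel_r: "\<And>x. x \<in> line_loop_elements (half_grid \<rho>) (Fin r) \<Longrightarrow>
      x [^]\<^bsub>orbifold_pi1 punctured_plane (affine_maps \<rho>) base_point\<^esub> l \<in> N"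
begin

abbreviation "P \<equiv> orbifold_pi1 punctured_plane (affine_maps \<rho>) base_point"

lemma \<rho>_facts: "0 < \<rho>" "\<rho> dvd 2"
  using \<rho> by auto

lemma action_mod_N: "action_mod punctured_plane (affine_maps \<rho>) base_point N"
  by (intro action_mod.intro affine_maps_action action_mod_axioms.intro base_point_in normal)

lemma twistI:
  assumes u: "skew_basis u (int_vec s)" and M: "M = int j * \<rho>"
    and rel: "\<And>x. x \<in> line_loop_elements (half_grid \<rho>) s \<Longrightarrow> x [^]\<^bsub>P\<^esub> j \<in> N"
    and sign: "\<epsilon> = 1 \<or> \<epsilon> = -1"
    and dvd: "\<And>k j. M dvd (if \<epsilon> = 1 then c * k + d else c * k + d - 1 - 2 * j)"
  shows "twist u (int_vec s) \<rho> base_point N \<epsilon> c d M"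
proof -
  interpret lattice_action u "int_vec s" \<rho>
    by (intro lattice_action.intro affine_maps_action u)
  show ?thesis
  proof (intro twist.intro twist_axioms.intro action_mod_N)
    show "lattice_action u (int_vec s) \<rho>" by unfold_locales
    fix z g h assume z: "2 * across z \<notin> \<int>" and gh: "g \<in> mor base_point z" "h \<in> mor z base_point"
      "g \<odot> h = unit base_point" "h \<odot> g = unit z"
    show "g \<odot> vloop M z \<odot> h \<in> N"
      unfolding M using gh by (intro relator_null[OF slope_vector_pt[OF refl] \<rho>_facts rel z]) (auto simp: mutually_inverse_def)
  qed (use M \<rho>_facts sign dvd in auto)
qed

text \<open>
  The twist is the linear shear along the slope vector of \<open>r\<close>.
\<close>

lemma shear_step:
  assumes x: "x \<in> alpha_elements s" and c: "m dvd c"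
  shows "\<exists>y \<in> alpha_elements (act (shear (int_vec (Fin r)) c) s). N #>\<^bsub>P\<^esub> x = N #>\<^bsub>P\<^esub> y"
proof -
  obtain u where u: "skew_basis u (int_vec (Fin r))" using skew_basis_ex by blast
  interpret twist u "int_vec (Fin r)" \<rho> base_point N 1 c 0 m
    by (rule twistI[OF u exps(2)[symmetric] rel_r]) (use c in auto)
  have A: "A z = z + (of_int c * across z) *\<^sub>R pt 0 1" for z
    by (rule coords_eqI) (simp_all del: int_vec.simps)
  have p: "pt 0 1 = real_vec (int_vec (Fin r))" by (rule trans[OF slope_vector_pt[OF refl, symmetric] slope_vector_real_vec])
  have "A (z + t *\<^sub>R real_vec w) = A z + t *\<^sub>R real_vec (shear (int_vec (Fin r)) c w)" for z t w
  proof -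
    have "across (real_vec w) = of_int (cross w (int_vec (Fin r)))" unfolding across_def real_vec_def cross_def by simp
    moreover have "real_vec (shear (int_vec (Fin r)) c w) = real_vec w + (of_int c * of_int (cross w (int_vec (Fin r)))) *\<^sub>R real_vec (int_vec (Fin r))"
      unfolding real_vec_def shear_def by simp
    ultimately show ?thesis unfolding A p by (simp add: algebra_simps del: int_vec.simps)
  qed
  then show ?thesis by (rule loop_transfer[OF refl \<rho>_facts(1) unimodular_shear _ x])
qed

text \<open>
  The twist is the affine reflection \<open>(x, y) \<mapsto> (x, 2 a x + 1 - y)\<close>. The summand \<open>1\<close> makes the displacements
  of the gaps even.
\<close>

lemma reflect_step:
  assumes x: "x \<in> alpha_elements s"
  shows "\<exists>y \<in> alpha_elements (reflect (Fin (of_int a)) Infty s). N #>\<^bsub>P\<^esub> x = N #>\<^bsub>P\<^esub> y"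
proof -
  have u: "skew_basis (1, 0) (int_vec Infty)" by unfold_locales simp
  interpret twist "(1, 0)" "int_vec Infty" \<rho> base_point N "-1" "2 * a" 1 2
    by (rule twistI[OF u exps(1)[symmetric] rel_Infty]) auto
  have A: "A z = (fst z, 2 * of_int a * fst z - snd z + 1)" for z
    unfolding A_def pt_def across_def along_def by simp
  have "A (z + t *\<^sub>R real_vec w) = A z + t *\<^sub>R real_vec (flip a w)" for z t w
    unfolding A by (simp add: real_vec_def flip_def algebra_simps)
  then show ?thesis unfolding reflect_flip
    by (rule loop_transfer[OF refl \<rho>_facts(1) unimodular_flip _ x])
qed

lemma Infty_trivial:
  assumes x: "x \<in> alpha_elements Infty" shows "N #>\<^bsub>P\<^esub> x = N"
proof -
  have u: "skew_basis (1, 0) (int_vec Infty)" by unfold_locales simp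
  interpret twist "(1, 0)" "int_vec Infty" \<rho> base_point N 1 0 0 2
    by (rule twistI[OF u exps(1)[symmetric] rel_Infty]) auto
  have x': "x \<in> line_loop_elements (half_grid 2) Infty" using x by (simp add: alpha_elements_def int_lattice_half_grid)
  obtain a g h k where a: "avoids 2 a" and gh: "mutually_inverse base_point a g h" and k: "k = 2 \<or> k = -2"
    and xe: "x = g \<odot> vloop k a \<odot> h"
    by (rule line_loop_elementsE[OF x' slope_vector_pt[OF refl] zero_less_numeral dvd_refl rho(2)])
      (rule that)
  have gm: "g \<in> mor base_point a" "h \<in> mor a base_point" "g \<odot> h = unit base_point" using gh by (auto simp: mutually_inverse_def)
  have "eqv a a (vloop k a) (unit a)"
    using k by (intro vloop_null_dvd[OF avoids_strip[OF _ a]]) auto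
  then have "eqv base_point base_point x (g \<odot> unit a \<odot> h)"
    unfolding xe by (intro eqv_mult[OF eqv_mult[OF eqv_refl[OF gm(1)]] eqv_refl[OF gm(2)]])
  then have "N #>\<^bsub>P\<^esub> x = N #>\<^bsub>P\<^esub> unit base_point"
    using gm unit_right[OF gm(1)] by (intro eqv_coset) simp
  also have "\<dots> = N"
    using normal.axioms[OF normal]
    by (metis group.coset_mult_one group_pi1[OF base_point_in] normal_imp_subgroup one_pi1 subgroup.subset normal)
  finally show ?thesis .
qed

end

section \<open>The Heckoid groups\<close>

text \<open>
  If \<open>A\<close> were not contained in the carrier, the family in the definition would be empty, and its
  intersection would be the whole type.
\<close>

lemma normal_closure_normal:
  assumes G: "group G" and A: "A \<subseteq> carrier G"
  shows "normal_closure G A \<lhd> G" "A \<subseteq> normal_closure G A"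
proof -
  interpret G: group G by (rule G)
  let ?F = "{N. N \<lhd> G \<and> A \<subseteq> N}"
  have top: "carrier G \<in> ?F" using A G.normal_inv_iff G.subgroup_self by auto
  have "subgroup (\<Inter> ?F) G"
    by (rule G.subgroups_Inter) (use top in \<open>auto intro: normal_imp_subgroup\<close>)
  moreover have "x \<otimes>\<^bsub>G\<^esub> h \<otimes>\<^bsub>G\<^esub> inv\<^bsub>G\<^esub> x \<in> \<Inter> ?F" if "x \<in> carrier G" "h \<in> \<Inter> ?F" for x h
    using that by (auto simp: G.normal_inv_iff)
  ultimately show "normal_closure G A \<lhd> G"
    unfolding normal_closure_def G.normal_inv_iff by blast
  show "A \<subseteq> normal_closure G A" unfolding normal_closure_def by blast
qed

lemma pi1_S_eq: "pi1_S = orbifold_pi1 punctured_plane (affine_maps 2) base_point"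
  by (simp add: pi1_S_def int_lattice_half_grid[symmetric] rotation_group_half_grid[of 2, folded int_lattice_half_grid])

lemma pi1_O_eq: "pi1_O = orbifold_pi1 punctured_plane (affine_maps 1) base_point"
  by (simp add: pi1_O_def rotation_group_half_grid[of 1, folded half_lattice_half_grid])

lemma group_pi1_maps: "group (orbifold_pi1 punctured_plane (affine_maps \<rho>) base_point)"
  by (rule action.group_pi1[OF affine_maps_action base_point_in])

lemma line_loop_elements_carrier:
  assumes "\<rho> = 1 \<or> \<rho> = 2" "x \<in> line_loop_elements (half_grid \<rho>) s"
  shows "x \<in> carrier (orbifold_pi1 punctured_plane (affine_maps \<rho>) base_point)"
proof -
  obtain u where "skew_basis u (int_vec s)" using skew_basis_ex by blast
  then interpret lattice_action u "int_vec s" \<rho>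
    by (intro lattice_action.intro affine_maps_action)
  have \<rho>: "0 < \<rho>" "\<rho> dvd 2" using assms(1) by auto
  obtain a g h k where a: "avoids \<rho> a" and gh: "mutually_inverse base_point a g h" and k: "k = \<rho> \<or> k = - \<rho>"
    and xe: "x = g \<odot> vloop k a \<odot> h"
    by (rule line_loop_elementsE[OF assms(2) slope_vector_pt[OF refl] \<rho> dvd_refl]) (rule that)
  have gm: "g \<in> mor base_point a" "h \<in> mor a base_point" using gh by (auto simp: mutually_inverse_def)
  have "vloop k a \<in> mor a a" using k by (intro vloop_mor[OF avoids_strip[OF \<rho>(2) a]]) auto
  then show ?thesis unfolding xe carrier_pi1 by (intro mult_mor[OF mult_mor[OF gm(1)] gm(2)])
qed

lemma pi1_S_subgroup: "subgroup (carrier pi1_S) pi1_O"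
proof -
  interpret O: action punctured_plane "affine_maps 1" by (rule affine_maps_action)
  interpret S: action punctured_plane "affine_maps 2" by (rule affine_maps_action)
  interpret GO: group pi1_O unfolding pi1_O_eq by (rule group_pi1_maps)
  interpret GS: group pi1_S unfolding pi1_S_eq by (rule group_pi1_maps)
  have mult: "x \<otimes>\<^bsub>pi1_S\<^esub> y = x \<otimes>\<^bsub>pi1_O\<^esub> y" for x y by (simp add: pi1_S_eq pi1_O_eq S.mult_pi1 O.mult_pi1)
  have one: "\<one>\<^bsub>pi1_S\<^esub> = \<one>\<^bsub>pi1_O\<^esub>" by (simp add: pi1_S_eq pi1_O_eq S.one_pi1 O.one_pi1 S.unit_def O.unit_def)
  have "affine_maps 2 \<subseteq> affine_maps 1"
  proof
    fix \<gamma> assume "\<gamma> \<in> affine_maps 2"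
    then obtain e i j where "\<gamma> = (\<lambda>z. e *\<^sub>R z + (of_int (1 * (2 * i)), of_int (1 * (2 * j))))" "e = 1 \<or> e = -1"
      unfolding affine_maps_def by auto
    then show "\<gamma> \<in> affine_maps 1" unfolding affine_maps_def by blast
  qed
  then have sub: "carrier pi1_S \<subseteq> carrier pi1_O"
    unfolding pi1_S_eq pi1_O_eq S.carrier_pi1 O.carrier_pi1 S.mor_def O.mor_def by blast
  show ?thesis
  proof (rule GO.subgroupI[OF sub])
    show "carrier pi1_S \<noteq> {}" using GS.one_closed by blast
    fix x assume x: "x \<in> carrier pi1_S"
    have "inv\<^bsub>pi1_S\<^esub> x \<otimes>\<^bsub>pi1_O\<^esub> x = \<one>\<^bsub>pi1_O\<^esub>" using GS.l_inv[OF x] by (simp add: mult one)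
    then have "inv\<^bsub>pi1_O\<^esub> x = inv\<^bsub>pi1_S\<^esub> x" using x sub by (intro GO.inv_equality) auto
    then show "inv\<^bsub>pi1_O\<^esub> x \<in> carrier pi1_S" using x by simp
    fix y assume "y \<in> carrier pi1_S"
    then show "x \<otimes>\<^bsub>pi1_O\<^esub> y \<in> carrier pi1_S" using x by (simp flip: mult)
  qed
qed

text \<open>
  The group structure is recorded as well, since the trivial conjugacy class has to be identified in the
  second half of the theorem. In the odd case the Heckoid group is a subgroup of the quotient by \<open>N\<close>.
\<close>

lemma heckoid_quotient_ex:
  fixes r n :: rat
  assumes n: "n > 1" "2 * n \<in> \<int>"
  shows "\<exists>\<rho> k l N. heckoid_quotient r \<rho> (int (nat \<lfloor>2 * n\<rfloor>)) k l N \<and>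
    heckoid_map r n = (\<lambda>x. N #>\<^bsub>orbifold_pi1 punctured_plane (affine_maps \<rho>) base_point\<^esub> x) \<and>
    group (heckoid r n) \<and> N = \<one>\<^bsub>heckoid r n\<^esub>"
proof (cases "n \<in> \<int>")
  case True
  let ?N = "normal_closure pi1_S (even_relators r n)"
  interpret G: group pi1_S unfolding pi1_S_eq by (rule group_pi1_maps)
  have car: "x \<in> carrier pi1_S" if "x \<in> alpha_elements s" for x s
    using that line_loop_elements_carrier[of 2] unfolding alpha_elements_def int_lattice_half_grid pi1_S_eq by blast
  have "even_relators r n \<subseteq> carrier pi1_S"
    unfolding even_relators_def using car by auto
  note N = normal_closure_normal[OF G.is_group this]
  obtain z where z: "n = of_int z" using True by (auto elim: Ints_cases)
  have "\<lfloor>2 * n\<rfloor> = 2 * z" unfolding z by (metis floor_of_int of_int_mult of_int_numeral)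
  then have fl: "int (nat \<lfloor>n\<rfloor>) * 2 = int (nat \<lfloor>2 * n\<rfloor>)" using n(1) by (simp add: z)
  have "heckoid_quotient r 2 (int (nat \<lfloor>2 * n\<rfloor>)) 1 (nat \<lfloor>n\<rfloor>) ?N"
  proof (rule heckoid_quotient.intro)
    show "?N \<lhd> orbifold_pi1 punctured_plane (affine_maps 2) base_point" using N(1) by (simp add: pi1_S_eq)
    fix x
    show "x [^]\<^bsub>orbifold_pi1 punctured_plane (affine_maps 2) base_point\<^esub> (1::nat) \<in> ?N" if "x \<in> line_loop_elements (half_grid 2) Infty"
    proof -
      have x: "x \<in> alpha_elements Infty" using that by (simp add: alpha_elements_def int_lattice_half_grid)
      then have "x [^]\<^bsub>pi1_S\<^esub> (1::nat) = x" using car[of x Infty] by simp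
      then show ?thesis using N(2) x unfolding even_relators_def pi1_S_eq by auto
    qed
    show "x [^]\<^bsub>orbifold_pi1 punctured_plane (affine_maps 2) base_point\<^esub> nat \<lfloor>n\<rfloor> \<in> ?N" if "x \<in> line_loop_elements (half_grid 2) (Fin r)"
    proof -
      have "x \<in> alpha_elements (Fin r)" using that by (simp add: alpha_elements_def int_lattice_half_grid)
      then show ?thesis using N(2) unfolding even_relators_def pi1_S_eq by blast
    qed
  qed (use fl in auto)
  moreover have "heckoid_map r n = (\<lambda>x. ?N #>\<^bsub>pi1_S\<^esub> x)" using True by (simp add: heckoid_map_def fun_eq_iff)
  moreover have "group (heckoid r n)" "?N = \<one>\<^bsub>heckoid r n\<^esub>"
    using True normal.factorgroup_is_group[OF N(1)] by (simp_all add: heckoid_def FactGroup_def)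
  ultimately show ?thesis unfolding pi1_S_eq by blast
next
  case False
  let ?N = "normal_closure pi1_O (odd_relators r n)"
  interpret G: group pi1_O unfolding pi1_O_eq by (rule group_pi1_maps)
  have car: "x \<in> carrier pi1_O" if "x \<in> beta_elements s" for x s
    using that line_loop_elements_carrier[of 1] unfolding beta_elements_def half_lattice_half_grid pi1_O_eq by blast
  have "odd_relators r n \<subseteq> carrier pi1_O"
    unfolding odd_relators_def using car by auto
  note N = normal_closure_normal[OF G.is_group this]
  interpret N: normal ?N pi1_O by (rule N(1))
  have "heckoid_quotient r 1 (int (nat \<lfloor>2 * n\<rfloor>)) 2 (nat \<lfloor>2 * n\<rfloor>) ?N"
  proof (rule heckoid_quotient.intro)
    show "?N \<lhd> orbifold_pi1 punctured_plane (affine_maps 1) base_point" using N(1) by (simp add: pi1_O_eq)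
    fix x
    show "x [^]\<^bsub>orbifold_pi1 punctured_plane (affine_maps 1) base_point\<^esub> (2::nat) \<in> ?N" if "x \<in> line_loop_elements (half_grid 1) Infty"
    proof -
      have "x \<in> beta_elements Infty" using that by (simp add: beta_elements_def half_lattice_half_grid)
      then show ?thesis using N(2) unfolding odd_relators_def pi1_O_eq by blast
    qed
    show "x [^]\<^bsub>orbifold_pi1 punctured_plane (affine_maps 1) base_point\<^esub> nat \<lfloor>2 * n\<rfloor> \<in> ?N" if "x \<in> line_loop_elements (half_grid 1) (Fin r)"
    proof -
      have "x \<in> beta_elements (Fin r)" using that by (simp add: beta_elements_def half_lattice_half_grid)
      then show ?thesis using N(2) unfolding odd_relators_def pi1_O_eq by blast
    qed
  qed auto
  moreover have hm: "heckoid_map r n = (\<lambda>x. ?N #>\<^bsub>pi1_O\<^esub> x)" using False by (simp add: heckoid_map_def fun_eq_iff)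
  moreover have "group (heckoid r n)"
  proof -
    interpret Q: group "pi1_O Mod ?N" by (rule N.factorgroup_is_group)
    interpret h: group_hom pi1_O "pi1_O Mod ?N" "\<lambda>x. ?N #>\<^bsub>pi1_O\<^esub> x"
      by unfold_locales (rule N.r_coset_hom_Mod)
    have "subgroup (heckoid_map r n ` carrier pi1_S) (pi1_O Mod ?N)"
      unfolding hm by (rule h.subgroup_img_is_subgroup[OF pi1_S_subgroup])
    then show ?thesis using False by (simp add: heckoid_def Q.subgroup_imp_group)
  qed
  moreover have "?N = \<one>\<^bsub>heckoid r n\<^esub>" using False by (simp add: heckoid_def FactGroup_def)
  ultimately show ?thesis unfolding pi1_O_eq by blast
qed

lemma conj_class_one:
  assumes "group G" shows "conj_class G \<one>\<^bsub>G\<^esub> = {\<one>\<^bsub>G\<^esub>}"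
proof -
  interpret group G by (rule assms)
  show ?thesis unfolding conj_class_def using one_closed by force
qed

lemma alpha_elements_nonempty: "alpha_elements Infty \<noteq> {}"
proof -
  interpret lattice_action "(1, 0)" "(0, 1)" 1
    by (intro lattice_action.intro affine_maps_action skew_basis.intro) simp
  have s: "slope_vector Infty = pt 0 1" by (rule slope_vector_pt) simp
  have "mutually_inverse base_point base_point (unit base_point) (unit base_point)"
    using unit_mor[OF base_point_in] unit_left[OF unit_mor[OF base_point_in]] by (simp add: mutually_inverse_def)
  moreover have "avoids 2 base_point"
    unfolding avoids_2 using not_Ints_between[of 0 "1/4"] by (simp add: across_def base_point_def)
  ultimately have "unit base_point \<odot> vloop 2 base_point \<odot> unit base_point \<in> line_loop_elements (half_grid 2) Infty"
    by (intro line_loop_elementsI[OF s]) auto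
  then show ?thesis by (auto simp: alpha_elements_def int_lattice_half_grid)
qed

lemma act_shear_inverse: "act (shear v (- c)) (act (shear v c) s) = s"
proof -
  have "act (shear v (- c)) (act (shear v c) s) = slope_of (shear v (- c) (shear v c (int_vec s)))"
    unfolding act_def[of "shear v c"] by (rule act_slope_of[OF unimodular_shear unimodular_primitive[OF unimodular_shear primitive_int_vec]])
  also have "\<dots> = s" unfolding shear_shear by (simp add: shear_def)
  finally show ?thesis .
qed

lemma act_shear_power: "act (shear v c) ^^ n = act (shear v (int n * c))"
proof (induction n)
  case 0 show ?case by (rule ext) (simp add: act_def shear_def)
next
  case (Suc n)
  have "act (shear v c) (act (shear v (int n * c)) s) = slope_of (shear v c (shear v (int n * c) (int_vec s)))" for s
    unfolding act_def[of "shear v (int n * c)"]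
    by (rule act_slope_of[OF unimodular_shear unimodular_primitive[OF unimodular_shear primitive_int_vec]])
  then show ?case using Suc by (simp add: fun_eq_iff shear_shear act_def[of "shear v (c + _)"] algebra_simps)
qed

theorem theorem2p4:
  fixes r n :: rat
  assumes "n > 1" and "2 * n \<in> \<int>"
  shows "(\<forall>s s' :: qhat. (\<exists>g \<in> Gamma_group r n. g s = s') \<longrightarrow> alpha r n s = alpha r n s') \<and>
         (\<forall>s :: qhat. (\<exists>g \<in> Gamma_group r n. g Infty = s) \<longrightarrow> alpha r n s = {{\<one>\<^bsub>heckoid r n\<^esub>}})"
proof -
  define m where "m = nat \<lfloor>2 * n\<rfloor>"
  obtain \<rho> k l N where Q: "heckoid_quotient r \<rho> (int m) k l N"
    and map: "heckoid_map r n = (\<lambda>x. N #>\<^bsub>orbifold_pi1 punctured_plane (affine_maps \<rho>) base_point\<^esub> x)"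
    and grp: "group (heckoid r n)" and one: "N = \<one>\<^bsub>heckoid r n\<^esub>"
    using heckoid_quotient_ex[OF assms, of r] unfolding m_def by blast
  interpret Q: heckoid_quotient r \<rho> "int m" k l N by (rule Q)
  define cl where "cl s = heckoid_map r n ` alpha_elements s" for s
  have shear_sub: "cl s \<subseteq> cl (act (shear (int_vec (Fin r)) (int m * t)) s)" for s t
    unfolding cl_def map using Q.shear_step[of _ s "int m * t"] by fastforce
  have shear: "cl (act (shear (int_vec (Fin r)) (int m * t)) s) = cl s" for s t
    using shear_sub[of s t] shear_sub[of "act (shear (int_vec (Fin r)) (int m * t)) s" "- t"]
    by (simp add: act_shear_inverse del: int_vec.simps)
  have reflect_sub: "cl s \<subseteq> cl (reflect (Fin (of_int a)) Infty s)" for s a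
    unfolding cl_def map using Q.reflect_step[of _ s a] by fastforce
  have invol: "reflect (Fin a) Infty (reflect (Fin a) Infty s) = s" for a s
    by (cases s) simp_all
  have reflect: "cl (reflect (Fin (of_int a)) Infty s) = cl s" for s a
    using reflect_sub[of s a] reflect_sub[of "reflect (Fin (of_int a)) Infty s" a] by (simp add: invol)

  \<comment> \<open>\<open>cl s\<close> is the set of the images of the based loops; the conjugacy classes are taken in the end\<close>
  define K where "K = {f. bij f \<and> (\<forall>s. cl (f s) = cl s)}"
  have Kbij: "bij f" if "f \<in> K" for f using that by (simp add: K_def)
  have Kid: "id \<in> K" by (simp add: K_def)
  have Kcomp: "f \<circ> g \<in> K" if "f \<in> K" "g \<in> K" for f g using that by (auto simp: K_def intro: bij_comp)
  have Kinv: "inv_into UNIV f \<in> K" if "f \<in> K" for f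
  proof -
    have f: "bij f" "\<And>s. cl (f s) = cl s" using that by (auto simp: K_def)
    have "cl (inv_into UNIV f s) = cl s" for s
      using f(2)[of "inv_into UNIV f s"] f(1) by (simp add: bij_is_surj surj_f_inv_f)
    then show ?thesis using f(1) by (simp add: K_def bij_imp_bij_inv)
  qed
  have gen: "generate (BijGroup UNIV) S \<subseteq> K" if "S \<subseteq> K" for S
    using that Kinv by (intro generate_BijGroup_subset Kbij Kid Kcomp) auto
  have "reflect a Infty \<in> K" if e: "farey_edge a Infty" for a
  proof (cases a)
    case (Fin x)
    then obtain i where "x = of_int i" using farey_edge_Infty e by (auto elim: Ints_cases)
    then have "cl (reflect a Infty s) = cl s" for s using reflect Fin by simp
    moreover have "bij (reflect a Infty)"
      using invol[of x] unfolding Fin by (intro o_bij[of "reflect (Fin x) Infty"]) (simp_all add: fun_eq_iff)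
    ultimately show ?thesis by (simp add: K_def)
  next
    case Infty then show ?thesis using e by (simp add: farey_edge_def)
  qed
  then have 1: "Gamma_infty \<subseteq> K" unfolding Gamma_infty_def by (intro gen) auto
  have "f ^^ m \<in> K" if f: "unit_shift (Fin r) f" for f
  proof -
    obtain t where t: "f = act (shear (int_vec (Fin r)) t)" using unit_shift_eq_shear[OF f] by blast
    have fm: "f ^^ m = act (shear (int_vec (Fin r)) (int m * t))" unfolding t by (rule act_shear_power)
    have "bij f" using f by (simp add: unit_shift_def farey_automorphism_def)
    then have "bij (f ^^ m)" by (rule bij_fn)
    then show ?thesis using shear unfolding K_def fm by (simp del: int_vec.simps)
  qed
  then have 2: "shift_group (Fin r) m \<subseteq> K" unfolding shift_group_def by (intro gen) auto
  have "Gamma_group r n \<subseteq> K" unfolding Gamma_group_def m_def[symmetric] using 1 2 by (intro gen) auto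
  then have inv: "alpha r n (g s) = alpha r n s" if "g \<in> Gamma_group r n" for g s
    using that unfolding alpha_def cl_def[symmetric] K_def by auto
  have "cl Infty = {N}"
    using alpha_elements_nonempty Q.Infty_trivial unfolding cl_def map by auto
  then have "alpha r n Infty = {{\<one>\<^bsub>heckoid r n\<^esub>}}"
    unfolding alpha_def cl_def[symmetric] using conj_class_one[OF grp] one by simp
  then show ?thesis using inv by metis
qed

end
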